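(* Assume the reward takes values in $[0,1]$ and the user-task distribution does not depend on the agent. Run step $k$ by the one-candidate update protocol under the standard evaluation conditions (defined in the context), using Measured-margin validation with allowed retained-task decrease $\delta^->0$ to decide adoption. Let $\mathsf{Acc}^M_k\subseteq\mathsf{Cand}_k\cap\mathsf{Ready}_k$ be the resulting adoption event, $I_k=J_{\mathrm{user}}(A_{k+1})-J_{\mathrm{user}}(A_k)$, and $\beta_{\mathrm{step},k}=2\beta_Z+\beta_{F,k}+\beta_R+2(n_F+n_R)\beta_V^{(1)}$. (i) $\mathbb P\bigl(\mathsf{Acc}^M_k\cap\{I_k<\widehat M_k\}\bigr)\le\beta_{\mathrm{step},k}$. Since acceptance requires $\widehat M_k>0$, the event of adoption together with $I_k\le0$ has probability at most $\beta_{\mathrm{step},k}$. (ii) Using the same evaluation data and per-task reward estimates, with matched bounds $\delta^-=\delta$ and matched radii, every ready sample path accepted by Two-Gate validation (with thresholds $\tau,\delta>0$) is accepted by Measured-margin validation; the reverse inclusion does not hold in general.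
   Context: **Setting.** $\mathcal T_{\mathrm{user}}$ (user tasks) and $\mathcal O$ (outputs) are measurable spaces. An agent $A$ is a Markov kernel $A(\cdot\mid t)$ from tasks to outputs. The reward $r:\mathcal T_{\mathrm{user}}\times\mathcal O\to[0,1]$ and failure detector $\phi:\mathcal T_{\mathrm{user}}\times\mathcal O\to\{0,1\}$ are jointly measurable and fixed; $\mathcal D_{\mathrm{user}}$ is a probability measure on $\mathcal T_{\mathrm{user}}$, the same for all agents. Put $V(A,t)=\int r(t,o)A(do\mid t)$, $J_{\mathrm{user}}(A)=\int V(A,t)\mathcal D_{\mathrm{user}}(dt)$, $\psi_A(t)=\int\phi(t,o)A(do\mid t)$, $Z_k=\int\psi_{A_k}d\mathcal D_{\mathrm{user}}\in(0,1)$, $\mathcal D_{F,k}(dt)=\frac{\psi_{A_k}(t)}{Z_k}\mathcal D_{\mathrm{user}}(dt)$, $\mathcal D_{R,k}(dt)=\frac{1-\psi_{A_k}(t)}{1-Z_k}\mathcal D_{\mathrm{user}}(dt)$, $\mathrm{Adv}_{A_k}(\widetilde A,t)=V(\widetilde A,t)-V(A_k,t)$. **One-candidate update protocol.** $\mathcal M$ is the measurable space of valid modifications; $c\in\mathcal M$ gives an agent $A_k\oplus c$; $\bot$ denotes a failed generation output. (1) $A_k$ handles at most a fixed finite number of arriving user tasks; the first $n_F$ failure-marked tasks form the generation material (abstain if there are fewer). A terminal output $\Delta C\in\mathcal M\sqcup\{\bot\}$ is drawn from the current agent's generation kernel given this material; abstain if $\Delta C=\bot$. $\mathsf{Cand}_k=\{\Delta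 C\in\mathcal M\}$ and $\widetilde A=A_k\oplus\Delta C$. (2) A stored sample of $n_R$ labelled records $(t_j^R,\phi_j^R)$ is used; $S_R=\{j:\phi_j^R=0\}$. Abstain unless a valid stored sample with $|S_R|\ge1$ is available (event $\mathsf{Ready}_{R,k}$). (3) After the candidate, all radii, risks, horizon and return rule are frozen, a new window of $H_{F,k}<\infty$ task arrivals is observed with $A_k$ and $\phi$ fixed; the first $n_F$ failure-marked tasks $t^F_1,\dots,t^F_{n_F}$ are returned (event $\mathsf{Ret}_{F,k}$), otherwise abstain. $\mathsf{Ready}_k=\mathsf{Ret}_{F,k}\cap\mathsf{Ready}_{R,k}$. (4) On $\mathsf{Cand}_k\cap\mathsf{Ready}_k$, for each evaluation task $t$ and each $A\in\{A_k,\widetilde A\}$, given the frozen agents and records, compute $\hat V(A,t)=\frac1m\sum_{l=1}^m r(t,o_l)$ from $m$ fresh i.i.d. rollouts $o_l\sim A(\cdot\mid t)$, with independent groups for the two agents. Estimates: $\hat Z_k=\frac1{n_R}\sum_j\phi_j^R$, $\hat L_k=\hat Z_k\frac1{n_F}\sum_i[\hat V(\widetilde A,t_i^F)-\hat V(A_k,t_i^F)]$, $\hat D_R=\frac1{|S_R|}\sum_{j\in S_R}|\hat V(\widetilde A,t_j^R)-\hat V(A_k,t_j^R)|$, $\hat D^-_{R,k}=\frac1{|S_R|}\sum_{j\in S_R}(\hat V(A_k,t_j^R)-\hat V(\widetilde A,t_j^R))_+$. Radii, for risks $\beta_V^{(1)},\beta_Z,\beta_R,\beta_{F,k}\in(0,1)$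 and block gap $\ell$: $\varepsilon_V=\sqrt{\log(2/\beta_V^{(1)})/(2m)}$; $\varepsilon_Z=\sqrt{\log(2/\widetilde\beta_Z)/(2n_R)}$ with $\widetilde\beta_Z=\beta_Z-2n_R\beta(\ell)$; $\varepsilon_R=\sqrt{\log(2/\widetilde\beta_R)/(2n_R)}$ with $\widetilde\beta_R=\beta_R-2n_R\beta(\ell)$; $\varepsilon_F$ a radius frozen before (3); $\varepsilon_L=\varepsilon_Z+(\hat Z_k+\varepsilon_Z)(2\varepsilon_V+\varepsilon_F)$; $\varepsilon_D=\varepsilon_D^-=(2\varepsilon_V+\varepsilon_R+\varepsilon_Z)/(1-\hat Z_k)$. **Measured-margin validation:** on $\mathsf{Cand}_k\cap\mathsf{Ready}_k$ put $\widehat M_k=\hat L_k-\varepsilon_L-(1-\hat Z_k+\varepsilon_Z)(\hat D^-_{R,k}+\varepsilon_D^-)$ and accept if and only if $\hat D^-_{R,k}\le\delta^-$ and $\widehat M_k>0$; off this event $\widehat M_k=0$ and there is no adoption. $A_{k+1}=\widetilde A$ if adopted, $A_{k+1}=A_k$ otherwise. **Two-Gate validation:** accept if and only if $\hat L_k\ge\tau$, $\hat D_R\le\delta$ and $\tau-\varepsilon_L-(1-\hat Z_k+\varepsilon_Z)(\delta+\varepsilon_D)>0$. **Standard evaluation conditions.** (a) The task stream $(T_n)$ is stationary ergodic with marginal $\mathcal D_{\mathrm{user}}$ and $\beta$-mixing: $\beta(j)=\sup_n\mathbb E[\sup_{B\in\sigma(T_{n+j},T_{n+j+1},\dots)}|\mathbb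 P(B\mid T_1,\dots,T_n)-\mathbb P(B)|]\to0$. (b) $O_n\sim A_k(\cdot\mid T_n)$ and, given $T_n$, $O_n$ is conditionally independent of all other $(T_m,O_m)$, $m\neq n$, and of all fresh rollouts; the mark is $\Phi_n=\phi(T_n,O_n)$; repeated evaluations of $\phi$ and $r$ for a fixed agent and task are i.i.d. (c) The generation material is disjoint from the failure batch and stored sample. Let $\mathcal G_k$ contain the current agent, the frozen candidate, generation information and randomness, and any stored-sample offset. The joint law $\mathbb P$ of this information and the stored records is within total variation $2n_R\beta(\ell)$ of a reference law $\mathbb P^\circ$ with the same $\mathcal G_k$-marginal under which, conditionally on $\mathcal G_k$, the stored tasks are i.i.d. from $\mathcal D_{\mathrm{user}}$ and, given them, the labels are independent $\mathrm{Bernoulli}(\psi_{A_k}(t_j^R))$. (d) With $f=\mathrm{Adv}_{A_k}(\widetilde A,\cdot)$, $\mathbb P\bigl(\mathsf{Ret}_{F,k}\cap\{|\frac1{n_F}\sum_i f(t_i^F)-\mathbb E_{\mathcal D_{F,k}}f|>\varepsilon_F\}\bigr)\le\beta_{F,k}$, where $\widetilde A$, $\varepsilon_F$ and the return rule do not depend on outcomes of the window in (3). (e) $2n_R\beta(\ell)<\min\{\beta_Z,\beta_R\}$. *)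

theory Defs
  imports "HOL-Probability.Probability"
begin

text \<open>
  One step \<open>k\<close> of the update protocol. The current agent may itself be random (it results from
  earlier steps), so agents are points \<open>a\<close> of a measurable space, and \<open>runK S a\<close> is the Markov
  kernel from tasks to outputs that \<open>a\<close> stands for; \<open>genK S a\<close> is its generation kernel.
  A fixed current agent is the case where \<open>cur S\<close> is constant.

  \<open>task S n\<close>, \<open>outp S n\<close> are the task \<open>T n\<close> arriving at time \<open>n\<close> and the current agent's output
  \<open>O n\<close>. Labels and marks in \<open>{0,1}\<close> are Booleans, and \<open>None\<close> is the failed generation output.
  \<open>sched S u j\<close> is the arrival time of the \<open>j\<close>-th stored record when the stored-sample
  offset is \<open>u\<close>. \<open>aux S\<close> is the generation randomness together with any further information
  contained in \<open>\<G>\<^sub>k\<close>.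

  Rollouts are indexed by the agent (\<open>True\<close> for the candidate, \<open>False\<close> for the current agent), by
  the evaluation task (\<open>Inl i\<close> for the \<open>i\<close>-th task of the failure batch, \<open>Inr j\<close> for the \<open>j\<close>-th
  stored task) and by the number of the rollout.
\<close>

record ('w, 't, 'o, 'a, 'c, 'u) step =
  Pr :: "'w measure"
  taskS :: "'t measure"
  outS :: "'o measure"
  agentS :: "'a measure"
  modS :: "'c measure"
  auxS :: "'u measure"
  runK :: "'a \<Rightarrow> 't \<Rightarrow> 'o measure"
  genK :: "'a \<Rightarrow> (nat \<Rightarrow> 't) \<Rightarrow> 'c option measure"
  oplus :: "'a \<Rightarrow> 'c \<Rightarrow> 'a"
  rew :: "'t \<Rightarrow> 'o \<Rightarrow> real"
  fails :: "'t \<Rightarrow> 'o \<Rightarrow> bool"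
  Duser :: "'t measure"
  task :: "nat \<Rightarrow> 'w \<Rightarrow> 't"
  outp :: "nat \<Rightarrow> 'w \<Rightarrow> 'o"
  cur :: "'w \<Rightarrow> 'a"
  modif :: "'w \<Rightarrow> 'c option"
  aux :: "'w \<Rightarrow> 'u"
  offset :: "'w \<Rightarrow> nat"
  gen_start :: nat
  gen_len :: nat
  sched :: "nat \<Rightarrow> nat \<Rightarrow> nat"
  srec_task :: "nat \<Rightarrow> 'w \<Rightarrow> 't"
  srec_lab :: "nat \<Rightarrow> 'w \<Rightarrow> bool"
  valid_sample :: "'w set"
  win_start :: "'w \<Rightarrow> nat"
  win_len :: "'w \<Rightarrow> nat"
  epsF :: "'w \<Rightarrow> real"
  roll :: "bool \<Rightarrow> nat + nat \<Rightarrow> nat \<Rightarrow> 'w \<Rightarrow> 'o"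
  nF :: nat
  nR :: nat
  nroll :: nat
  gap :: nat
  betaV :: real
  betaZ :: real
  betaR :: real
  betaF :: real

section \<open>Agents, rewards and failures\<close>

definition val :: "('w, 't, 'o, 'a, 'c, 'u) step \<Rightarrow> 'a \<Rightarrow> 't \<Rightarrow> real" where
  "val S a t = (\<integral>x. rew S t x \<partial>runK S a t)"

definition J_user :: "('w, 't, 'o, 'a, 'c, 'u) step \<Rightarrow> 'a \<Rightarrow> real" where
  "J_user S a = (\<integral>t. val S a t \<partial>Duser S)"

definition psi :: "('w, 't, 'o, 'a, 'c, 'u) step \<Rightarrow> 'a \<Rightarrow> 't \<Rightarrow> real" where
  "psi S a t = (\<integral>x. of_bool (fails S t x) \<partial>runK S a t)"

definition fail_mass :: "('w, 't, 'o, 'a, 'c, 'u) step \<Rightarrow> 'a \<Rightarrow> real" where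
  "fail_mass S a = (\<integral>t. psi S a t \<partial>Duser S)"

definition D_fail :: "('w, 't, 'o, 'a, 'c, 'u) step \<Rightarrow> 'a \<Rightarrow> 't measure" where
  "D_fail S a = density (Duser S) (\<lambda>t. ennreal (psi S a t / fail_mass S a))"

definition Adv :: "('w, 't, 'o, 'a, 'c, 'u) step \<Rightarrow> 'a \<Rightarrow> 'a \<Rightarrow> 't \<Rightarrow> real" where
  "Adv S a b t = val S b t - val S a t"

section \<open>The protocol\<close>

text \<open>The measurable space \<open>M \<squnion> {\<bottom>}\<close>.\<close>

definition with_bot :: "'c measure \<Rightarrow> 'c option measure" where
  "with_bot M = sigma (insert None (Some ` space M)) (insert {None} ((\<lambda>B. Some ` B) ` sets M))"

definition marked :: "('w, 't, 'o, 'a, 'c, 'u) step \<Rightarrow> nat \<Rightarrow> nat \<Rightarrow> 'w \<Rightarrow> nat list" where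
  "marked S s h \<omega> = filter (\<lambda>n. fails S (task S n \<omega>) (outp S n \<omega>)) [s..<s + h]"

text \<open>Arrival time of the \<open>i\<close>-th failure-marked task in the window of length \<open>h\<close> starting at \<open>s\<close>;
  the default \<open>s\<close> only occurs if there are too few of them, in which case the step abstains.\<close>

definition pick :: "('w, 't, 'o, 'a, 'c, 'u) step \<Rightarrow> nat \<Rightarrow> nat \<Rightarrow> nat \<Rightarrow> 'w \<Rightarrow> nat" where
  "pick S s h i \<omega> = (if i < length (marked S s h \<omega>) then marked S s h \<omega> ! i else s)"

definition gen_idx :: "('w, 't, 'o, 'a, 'c, 'u) step \<Rightarrow> nat \<Rightarrow> 'w \<Rightarrow> nat" where
  "gen_idx S i \<omega> = pick S (gen_start S) (gen_len S) i \<omega>"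

definition gen_full :: "('w, 't, 'o, 'a, 'c, 'u) step \<Rightarrow> 'w set" where
  "gen_full S = {\<omega> \<in> space (Pr S). nF S \<le> length (marked S (gen_start S) (gen_len S) \<omega>)}"

definition material :: "('w, 't, 'o, 'a, 'c, 'u) step \<Rightarrow> 'w \<Rightarrow> nat \<Rightarrow> 't" where
  "material S \<omega> = (\<lambda>i\<in>{..<nF S}. task S (gen_idx S i \<omega>) \<omega>)"

definition materialS :: "('w, 't, 'o, 'a, 'c, 'u) step \<Rightarrow> (nat \<Rightarrow> 't) measure" where
  "materialS S = (\<Pi>\<^sub>M i\<in>{..<nF S}. taskS S)"

definition win_idx :: "('w, 't, 'o, 'a, 'c, 'u) step \<Rightarrow> nat \<Rightarrow> 'w \<Rightarrow> nat" where
  "win_idx S i \<omega> = pick S (win_start S \<omega>) (win_len S \<omega>) i \<omega>"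

definition batch :: "('w, 't, 'o, 'a, 'c, 'u) step \<Rightarrow> nat \<Rightarrow> 'w \<Rightarrow> 't" where
  "batch S i \<omega> = task S (win_idx S i \<omega>) \<omega>"

definition RetF :: "('w, 't, 'o, 'a, 'c, 'u) step \<Rightarrow> 'w set" where
  "RetF S = {\<omega> \<in> space (Pr S). nF S \<le> length (marked S (win_start S \<omega>) (win_len S \<omega>) \<omega>)}"

definition SR :: "('w, 't, 'o, 'a, 'c, 'u) step \<Rightarrow> 'w \<Rightarrow> nat set" where
  "SR S \<omega> = {j. j < nR S \<and> \<not> srec_lab S j \<omega>}"

definition ReadyR :: "('w, 't, 'o, 'a, 'c, 'u) step \<Rightarrow> 'w set" where
  "ReadyR S = {\<omega> \<in> valid_sample S. 1 \<le> card (SR S \<omega>)}"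

definition Ready :: "('w, 't, 'o, 'a, 'c, 'u) step \<Rightarrow> 'w set" where
  "Ready S = RetF S \<inter> ReadyR S"

definition Cand :: "('w, 't, 'o, 'a, 'c, 'u) step \<Rightarrow> 'w set" where
  "Cand S = {\<omega> \<in> space (Pr S). modif S \<omega> \<noteq> None}"

text \<open>Off \<open>Cand S\<close> there is no candidate; the value \<open>cur S \<omega>\<close> there is a dummy.\<close>

definition candidate :: "('w, 't, 'o, 'a, 'c, 'u) step \<Rightarrow> 'w \<Rightarrow> 'a" where
  "candidate S \<omega> = (case modif S \<omega> of None \<Rightarrow> cur S \<omega> | Some c \<Rightarrow> oplus S (cur S \<omega>) c)"

definition evaluated :: "('w, 't, 'o, 'a, 'c, 'u) step \<Rightarrow> 'w \<Rightarrow> (nat + nat) set" where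
  "evaluated S \<omega> = Inl ` {..<nF S} \<union> Inr ` SR S \<omega>"

definition eval_task :: "('w, 't, 'o, 'a, 'c, 'u) step \<Rightarrow> nat + nat \<Rightarrow> 'w \<Rightarrow> 't" where
  "eval_task S e \<omega> = (case e of Inl i \<Rightarrow> batch S i \<omega> | Inr j \<Rightarrow> srec_task S j \<omega>)"

definition eval_agent :: "('w, 't, 'o, 'a, 'c, 'u) step \<Rightarrow> bool \<Rightarrow> 'w \<Rightarrow> 'a" where
  "eval_agent S b \<omega> = (if b then candidate S \<omega> else cur S \<omega>)"

definition records :: "('w, 't, 'o, 'a, 'c, 'u) step \<Rightarrow> 'w \<Rightarrow> nat \<Rightarrow> 't \<times> bool" where
  "records S \<omega> = (\<lambda>j\<in>{..<nR S}. (srec_task S j \<omega>, srec_lab S j \<omega>))"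

definition recordS :: "('w, 't, 'o, 'a, 'c, 'u) step \<Rightarrow> (nat \<Rightarrow> 't \<times> bool) measure" where
  "recordS S = (\<Pi>\<^sub>M j\<in>{..<nR S}. taskS S \<Otimes>\<^sub>M count_space UNIV)"

text \<open>\<open>info S\<close> generates the \<open>\<sigma>\<close>-algebra \<open>\<G>\<^sub>k\<close>.\<close>

definition info :: "('w, 't, 'o, 'a, 'c, 'u) step
    \<Rightarrow> 'w \<Rightarrow> 'a \<times> 'c option \<times> (nat \<Rightarrow> 't) \<times> nat \<times> 'u" where
  "info S \<omega> = (cur S \<omega>, modif S \<omega>, material S \<omega>, offset S \<omega>, aux S \<omega>)"

definition infoS :: "('w, 't, 'o, 'a, 'c, 'u) step
    \<Rightarrow> ('a \<times> 'c option \<times> (nat \<Rightarrow> 't) \<times> nat \<times> 'u) measure" where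
  "infoS S = agentS S \<Otimes>\<^sub>M with_bot (modS S) \<Otimes>\<^sub>M materialS S \<Otimes>\<^sub>M count_space UNIV \<Otimes>\<^sub>M auxS S"

definition pre_window :: "('w, 't, 'o, 'a, 'c, 'u) step \<Rightarrow> 'w measure" where
  "pre_window S = vimage_algebra (space (Pr S)) (\<lambda>\<omega>. (info S \<omega>, records S \<omega>))
     (infoS S \<Otimes>\<^sub>M recordS S)"

text \<open>On \<open>Cand S \<inter> Ready S\<close> and given the random element \<open>F\<close>, the two groups of rollouts for an
  evaluation task are independent i.i.d. samples from the two agents at that task.\<close>

definition fresh_rollouts ::
  "('w, 't, 'o, 'a, 'c, 'u) step \<Rightarrow> ('w \<Rightarrow> 'z) \<Rightarrow> 'z measure \<Rightarrow> bool" where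
  "fresh_rollouts S F N \<longleftrightarrow>
    (\<forall>e. \<forall>C\<in>sets N. \<forall>B :: bool \<Rightarrow> nat \<Rightarrow> 'o set. (\<forall>b l. B b l \<in> sets (outS S)) \<longrightarrow>
      (let E = {\<omega> \<in> Cand S \<inter> Ready S. e \<in> evaluated S \<omega> \<and> F \<omega> \<in> C} in
        measure (Pr S) {\<omega> \<in> E. \<forall>b. \<forall>l<nroll S. roll S b e l \<omega> \<in> B b l}
        = (\<integral>\<omega>. indicator E \<omega> * (\<Prod>b\<in>UNIV. \<Prod>l<nroll S.
              measure (runK S (eval_agent S b \<omega>) (eval_task S e \<omega>)) (B b l)) \<partial>Pr S)))"

definition frozen :: "('w, 't, 'o, 'a, 'c, 'u) step
    \<Rightarrow> 'w \<Rightarrow> 'a \<times> 'a \<times> (nat \<Rightarrow> 't) \<times> (nat \<Rightarrow> 't \<times> bool)" where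
  "frozen S \<omega> = (cur S \<omega>, candidate S \<omega>, (\<lambda>i\<in>{..<nF S}. batch S i \<omega>), records S \<omega>)"

definition frozenS :: "('w, 't, 'o, 'a, 'c, 'u) step
    \<Rightarrow> ('a \<times> 'a \<times> (nat \<Rightarrow> 't) \<times> (nat \<Rightarrow> 't \<times> bool)) measure" where
  "frozenS S = agentS S \<Otimes>\<^sub>M agentS S \<Otimes>\<^sub>M materialS S \<Otimes>\<^sub>M recordS S"

definition setting :: "('w, 't, 'o, 'a, 'c, 'u) step \<Rightarrow> bool" where
  "setting S \<longleftrightarrow>
    prob_space (Pr S) \<and>
    prob_space (Duser S) \<and> sets (Duser S) = sets (taskS S) \<and>
    (\<lambda>(a, t). runK S a t) \<in> agentS S \<Otimes>\<^sub>M taskS S \<rightarrow>\<^sub>M prob_algebra (outS S) \<and>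
    (\<lambda>(a, x). genK S a x) \<in> agentS S \<Otimes>\<^sub>M materialS S \<rightarrow>\<^sub>M prob_algebra (with_bot (modS S)) \<and>
    (\<lambda>(a, c). oplus S a c) \<in> agentS S \<Otimes>\<^sub>M modS S \<rightarrow>\<^sub>M agentS S \<and>
    (\<lambda>(t, x). rew S t x) \<in> borel_measurable (taskS S \<Otimes>\<^sub>M outS S) \<and>
    (\<forall>t\<in>space (taskS S). \<forall>x\<in>space (outS S). 0 \<le> rew S t x \<and> rew S t x \<le> 1) \<and>
    (\<lambda>(t, x). fails S t x) \<in> taskS S \<Otimes>\<^sub>M outS S \<rightarrow>\<^sub>M count_space UNIV \<and>
    (\<forall>n. task S n \<in> Pr S \<rightarrow>\<^sub>M taskS S) \<and>
    (\<forall>n. outp S n \<in> Pr S \<rightarrow>\<^sub>M outS S) \<and>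
    cur S \<in> Pr S \<rightarrow>\<^sub>M agentS S \<and>
    modif S \<in> Pr S \<rightarrow>\<^sub>M with_bot (modS S) \<and>
    aux S \<in> Pr S \<rightarrow>\<^sub>M auxS S \<and>
    offset S \<in> Pr S \<rightarrow>\<^sub>M count_space UNIV \<and>
    (\<forall>j<nR S. srec_task S j \<in> Pr S \<rightarrow>\<^sub>M taskS S) \<and>
    (\<forall>j<nR S. srec_lab S j \<in> Pr S \<rightarrow>\<^sub>M count_space UNIV) \<and>
    valid_sample S \<in> sets (Pr S) \<and>
    (\<forall>b e l. roll S b e l \<in> Pr S \<rightarrow>\<^sub>M outS S) \<and>
    (\<forall>\<omega>\<in>space (Pr S). 0 < fail_mass S (cur S \<omega>) \<and> fail_mass S (cur S \<omega>) < 1) \<and>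
    0 < nF S \<and> 0 < nR S \<and> 0 < nroll S \<and>
    0 < betaV S \<and> betaV S < 1 \<and> 0 < betaZ S \<and> betaZ S < 1 \<and>
    0 < betaR S \<and> betaR S < 1 \<and> 0 < betaF S \<and> betaF S < 1"

definition one_candidate_protocol :: "('w, 't, 'o, 'a, 'c, 'u) step \<Rightarrow> bool" where
  "one_candidate_protocol S \<longleftrightarrow>
    \<comment> \<open>generation: \<open>modif S\<close> is drawn from the generation kernel given the material\<close>
    (\<forall>\<omega>\<in>space (Pr S) - gen_full S. modif S \<omega> = None) \<and>
    (\<forall>C\<in>sets (agentS S \<Otimes>\<^sub>M materialS S). \<forall>B\<in>sets (with_bot (modS S)).
      measure (Pr S) {\<omega> \<in> gen_full S. (cur S \<omega>, material S \<omega>) \<in> C \<and> modif S \<omega> \<in> B}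
      = (\<integral>\<omega>. indicator {\<omega> \<in> gen_full S. (cur S \<omega>, material S \<omega>) \<in> C} \<omega>
            * measure (genK S (cur S \<omega>) (material S \<omega>)) B \<partial>Pr S)) \<and>
    \<comment> \<open>the stored sample consists of records of the stream\<close>
    (\<forall>\<omega>\<in>valid_sample S. \<forall>j<nR S. let n = sched S (offset S \<omega>) j in
      srec_task S j \<omega> = task S n \<omega> \<and>
      srec_lab S j \<omega> = fails S (task S n \<omega>) (outp S n \<omega>)) \<and>
    \<comment> \<open>the window for the failure batch is new, its position and length are frozen before it\<close>
    (\<forall>\<omega>\<in>space (Pr S). gen_start S + gen_len S \<le> win_start S \<omega>) \<and>
    (\<forall>\<omega>\<in>valid_sample S. \<forall>j<nR S. sched S (offset S \<omega>) j < win_start S \<omega>) \<and>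
    win_start S \<in> pre_window S \<rightarrow>\<^sub>M count_space UNIV \<and>
    win_len S \<in> pre_window S \<rightarrow>\<^sub>M count_space UNIV \<and>
    epsF S \<in> borel_measurable (pre_window S) \<and>
    fresh_rollouts S (frozen S) (frozenS S)"

section \<open>Estimates, radii and acceptance rules\<close>

text \<open>
  The supremum over \<open>B\<close> inside the expectation defining the \<open>\<beta>\<close>-mixing coefficient is an essential
  supremum, since the conditional probabilities are only defined almost everywhere for each
  \<open>B\<close>. The mean of the essential supremum of a family is the least mean of a measurable
  function dominating each member almost everywhere.
\<close>

definition beta_dep :: "'w measure \<Rightarrow> 'w measure \<Rightarrow> 'w measure \<Rightarrow> ennreal" where
  "beta_dep M F G =
    (INF Y\<in>{Y \<in> borel_measurable M. \<forall>B\<in>sets G.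
        AE \<omega> in M. ennreal \<bar>real_cond_exp M F (indicator B) \<omega> - measure M B\<bar> \<le> Y \<omega>}.
      \<integral>\<^sup>+\<omega>. Y \<omega> \<partial>M)"

definition stream_alg :: "('w, 't, 'o, 'a, 'c, 'u) step \<Rightarrow> nat set \<Rightarrow> 'w measure" where
  "stream_alg S I = vimage_algebra (space (Pr S)) (\<lambda>\<omega>. \<lambda>n\<in>I. task S n \<omega>) (\<Pi>\<^sub>M n\<in>I. taskS S)"

text \<open>Arrival times start at 0 here, so the past up to \<open>n\<close> is never empty.\<close>

definition beta_mix :: "('w, 't, 'o, 'a, 'c, 'u) step \<Rightarrow> nat \<Rightarrow> real" where
  "beta_mix S j = enn2real (SUP n. beta_dep (Pr S) (stream_alg S {..n}) (stream_alg S {n + j..}))"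

definition epsV :: "('w, 't, 'o, 'a, 'c, 'u) step \<Rightarrow> real" where
  "epsV S = sqrt (ln (2 / betaV S) / (2 * real (nroll S)))"

definition epsZ :: "('w, 't, 'o, 'a, 'c, 'u) step \<Rightarrow> real" where
  "epsZ S = sqrt (ln (2 / (betaZ S - 2 * real (nR S) * beta_mix S (gap S))) / (2 * real (nR S)))"

definition epsR :: "('w, 't, 'o, 'a, 'c, 'u) step \<Rightarrow> real" where
  "epsR S = sqrt (ln (2 / (betaR S - 2 * real (nR S) * beta_mix S (gap S))) / (2 * real (nR S)))"

definition Vhat :: "('w, 't, 'o, 'a, 'c, 'u) step \<Rightarrow> bool \<Rightarrow> nat + nat \<Rightarrow> 'w \<Rightarrow> real" where
  "Vhat S b e \<omega> = (\<Sum>l<nroll S. rew S (eval_task S e \<omega>) (roll S b e l \<omega>)) / real (nroll S)"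

definition Zhat :: "('w, 't, 'o, 'a, 'c, 'u) step \<Rightarrow> 'w \<Rightarrow> real" where
  "Zhat S \<omega> = (\<Sum>j<nR S. of_bool (srec_lab S j \<omega>)) / real (nR S)"

definition Lhat :: "('w, 't, 'o, 'a, 'c, 'u) step \<Rightarrow> 'w \<Rightarrow> real" where
  "Lhat S \<omega> = Zhat S \<omega> *
     ((\<Sum>i<nF S. Vhat S True (Inl i) \<omega> - Vhat S False (Inl i) \<omega>) / real (nF S))"

definition DRhat :: "('w, 't, 'o, 'a, 'c, 'u) step \<Rightarrow> 'w \<Rightarrow> real" where
  "DRhat S \<omega> =
     (\<Sum>j\<in>SR S \<omega>. \<bar>Vhat S True (Inr j) \<omega> - Vhat S False (Inr j) \<omega>\<bar>) / real (card (SR S \<omega>))"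

definition DRhat_minus :: "('w, 't, 'o, 'a, 'c, 'u) step \<Rightarrow> 'w \<Rightarrow> real" where
  "DRhat_minus S \<omega> =
     (\<Sum>j\<in>SR S \<omega>. max 0 (Vhat S False (Inr j) \<omega> - Vhat S True (Inr j) \<omega>))
       / real (card (SR S \<omega>))"

definition epsL :: "('w, 't, 'o, 'a, 'c, 'u) step \<Rightarrow> 'w \<Rightarrow> real" where
  "epsL S \<omega> = epsZ S + (Zhat S \<omega> + epsZ S) * (2 * epsV S + epsF S \<omega>)"

definition epsD :: "('w, 't, 'o, 'a, 'c, 'u) step \<Rightarrow> 'w \<Rightarrow> real" where
  "epsD S \<omega> = (2 * epsV S + epsR S + epsZ S) / (1 - Zhat S \<omega>)"

definition Mhat :: "('w, 't, 'o, 'a, 'c, 'u) step \<Rightarrow> 'w \<Rightarrow> real" where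
  "Mhat S \<omega> = (if \<omega> \<in> Cand S \<inter> Ready S
     then Lhat S \<omega> - epsL S \<omega> - (1 - Zhat S \<omega> + epsZ S) * (DRhat_minus S \<omega> + epsD S \<omega>)
     else 0)"

definition Acc_margin :: "('w, 't, 'o, 'a, 'c, 'u) step \<Rightarrow> real \<Rightarrow> 'w set" where
  "Acc_margin S \<delta> = {\<omega> \<in> Cand S \<inter> Ready S. DRhat_minus S \<omega> \<le> \<delta> \<and> 0 < Mhat S \<omega>}"

definition Acc_two_gate :: "('w, 't, 'o, 'a, 'c, 'u) step \<Rightarrow> real \<Rightarrow> real \<Rightarrow> 'w set" where
  "Acc_two_gate S \<tau> \<delta> = {\<omega> \<in> Cand S \<inter> Ready S. \<tau> \<le> Lhat S \<omega> \<and> DRhat S \<omega> \<le> \<delta> \<and>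
     0 < \<tau> - epsL S \<omega> - (1 - Zhat S \<omega> + epsZ S) * (\<delta> + epsD S \<omega>)}"

definition next_agent :: "('w, 't, 'o, 'a, 'c, 'u) step \<Rightarrow> real \<Rightarrow> 'w \<Rightarrow> 'a" where
  "next_agent S \<delta> \<omega> = (if \<omega> \<in> Acc_margin S \<delta> then candidate S \<omega> else cur S \<omega>)"

definition improvement :: "('w, 't, 'o, 'a, 'c, 'u) step \<Rightarrow> real \<Rightarrow> 'w \<Rightarrow> real" where
  "improvement S \<delta> \<omega> = J_user S (next_agent S \<delta> \<omega>) - J_user S (cur S \<omega>)"

definition beta_step :: "('w, 't, 'o, 'a, 'c, 'u) step \<Rightarrow> real" where
  "beta_step S = 2 * betaZ S + betaF S + betaR S + 2 * (real (nF S) + real (nR S)) * betaV S"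

section \<open>The standard evaluation conditions\<close>

definition stream_law :: "('w, 't, 'o, 'a, 'c, 'u) step \<Rightarrow> (nat \<Rightarrow> 't) measure" where
  "stream_law S = distr (Pr S) (\<Pi>\<^sub>M n\<in>UNIV. taskS S) (\<lambda>\<omega> n. task S n \<omega>)"

definition stream_condition :: "('w, 't, 'o, 'a, 'c, 'u) step \<Rightarrow> bool" where
  "stream_condition S \<longleftrightarrow>
    \<comment> \<open>stationary\<close>
    distr (stream_law S) (\<Pi>\<^sub>M n\<in>UNIV. taskS S) (\<lambda>x n. x (Suc n)) = stream_law S \<and>
    \<comment> \<open>ergodic\<close>
    (\<forall>B\<in>sets (stream_law S). (\<lambda>x n. x (Suc n)) -` B \<inter> space (stream_law S) = B \<longrightarrow>
      measure (stream_law S) B = 0 \<or> measure (stream_law S) B = 1) \<and>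
    (\<forall>n. distr (Pr S) (taskS S) (task S n) = Duser S) \<and>
    beta_mix S \<longlonglongrightarrow> 0"

text \<open>
  Which tasks the rollouts are run at, and the candidate, depend on the marks and hence on the
  outputs \<open>O n\<close>. Independence of outputs and fresh rollouts is therefore stated conditionally on
  the frozen agents and records: given these, the rollouts have the same law when
  the whole stream of tasks and outputs is known in addition.
\<close>

definition output_condition :: "('w, 't, 'o, 'a, 'c, 'u) step \<Rightarrow> bool" where
  "output_condition S \<longleftrightarrow>
    (\<forall>n. \<forall>C\<in>sets (agentS S \<Otimes>\<^sub>M taskS S \<Otimes>\<^sub>M (\<Pi>\<^sub>M i\<in>UNIV - {n}. taskS S \<Otimes>\<^sub>M outS S)).
      \<forall>B\<in>sets (outS S).
      (let E = {\<omega> \<in> space (Pr S).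
          (cur S \<omega>, task S n \<omega>, (\<lambda>i\<in>UNIV - {n}. (task S i \<omega>, outp S i \<omega>))) \<in> C} in
        measure (Pr S) {\<omega> \<in> E. outp S n \<omega> \<in> B}
        = (\<integral>\<omega>. indicator E \<omega> * measure (runK S (cur S \<omega>) (task S n \<omega>)) B \<partial>Pr S))) \<and>
    fresh_rollouts S (\<lambda>\<omega>. (frozen S \<omega>, (\<lambda>n. (task S n \<omega>, outp S n \<omega>))))
      (frozenS S \<Otimes>\<^sub>M (\<Pi>\<^sub>M n\<in>UNIV. taskS S \<Otimes>\<^sub>M outS S))"

definition total_variation :: "'x measure \<Rightarrow> 'x measure \<Rightarrow> real" where
  "total_variation M N = (SUP B\<in>sets M. \<bar>measure M B - measure N B\<bar>)"

text \<open>Law of the stored records when the tasks are i.i.d. from \<open>Duser S\<close> and, given the tasks, the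
  labels are independent Bernoulli variables with the failure probabilities of agent \<open>a\<close>.\<close>

definition ref_records ::
  "('w, 't, 'o, 'a, 'c, 'u) step \<Rightarrow> 'a \<Rightarrow> (nat \<Rightarrow> 't \<times> bool) measure" where
  "ref_records S a = (\<Pi>\<^sub>M j\<in>{..<nR S}. Duser S) \<bind> (\<lambda>t.
     distr (\<Pi>\<^sub>M j\<in>{..<nR S}. measure_pmf (bernoulli_pmf (psi S a (t j)))) (recordS S)
       (\<lambda>y. \<lambda>j\<in>{..<nR S}. (t j, y j)))"

definition stored_condition :: "('w, 't, 'o, 'a, 'c, 'u) step \<Rightarrow> bool" where
  "stored_condition S \<longleftrightarrow>
    (\<forall>\<omega>\<in>gen_full S. \<forall>i<nF S.
      (\<omega> \<in> RetF S \<longrightarrow> (\<forall>i'<nF S. win_idx S i' \<omega> \<noteq> gen_idx S i \<omega>)) \<and>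
      (\<omega> \<in> valid_sample S \<longrightarrow> (\<forall>j<nR S. sched S (offset S \<omega>) j \<noteq> gen_idx S i \<omega>))) \<and>
    (\<exists>P0. prob_space P0 \<and> sets P0 = sets (infoS S \<Otimes>\<^sub>M recordS S) \<and>
      distr P0 (infoS S) fst = distr (Pr S) (infoS S) (info S) \<and>
      (\<forall>C\<in>sets (infoS S). \<forall>R\<in>sets (recordS S).
        emeasure P0 (C \<times> R)
        = (\<integral>\<^sup>+g\<in>C. emeasure (ref_records S (fst g)) R \<partial>distr P0 (infoS S) fst)) \<and>
      total_variation
        (distr (Pr S) (infoS S \<Otimes>\<^sub>M recordS S) (\<lambda>\<omega>. (info S \<omega>, records S \<omega>))) P0
        \<le> 2 * real (nR S) * beta_mix S (gap S))"

definition batch_condition :: "('w, 't, 'o, 'a, 'c, 'u) step \<Rightarrow> bool" where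
  "batch_condition S \<longleftrightarrow>
    measure (Pr S) {\<omega> \<in> Cand S \<inter> RetF S.
      let f = Adv S (cur S \<omega>) (candidate S \<omega>) in
      epsF S \<omega> < \<bar>(\<Sum>i<nF S. f (batch S i \<omega>)) / real (nF S)
                   - (\<integral>t. f t \<partial>D_fail S (cur S \<omega>))\<bar>} \<le> betaF S"

definition gap_condition :: "('w, 't, 'o, 'a, 'c, 'u) step \<Rightarrow> bool" where
  "gap_condition S \<longleftrightarrow> 2 * real (nR S) * beta_mix S (gap S) < min (betaZ S) (betaR S)"

definition standard_evaluation :: "('w, 't, 'o, 'a, 'c, 'u) step \<Rightarrow> bool" where
  "standard_evaluation S \<longleftrightarrow> stream_condition S \<and> output_condition S \<and> stored_condition S \<and>
    batch_condition S \<and> gap_condition S"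

end

theory Submission
  imports Defs
begin

text \<open>
  The exact improvement of an adopted candidate is the integral of its advantage, split into the
  part on failed tasks and the part on retained tasks; the latter is bounded below by minus the
  integral of the negative part of the advantage. Both integrals are compared with their
  estimates outside a union of exceptional events: Hoeffding's inequality for the stored labels and
  for the losses at retained stored tasks (first under the reference law, then transferred at
  the cost of the total variation distance), the assumed bound for the failure batch, and
  Hoeffding's inequality for the rollouts, conditionally on the frozen data.
\<close>

section \<open>Kernels and concentration\<close>

text \<open>The candidate is itself random, so a concentration bound for a fixed function does not
  apply to it. Each bound is proved for a function that may depend on the conditioning data, one
  section at a time, and then averaged. The hypotheses give joint laws on rectangles only, which is
  why they are first turned into compositions of a measure with a kernel.

  A second obstacle is that \<open>DRhat_minus\<close> is a mean over a set of random size.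
  Multiplied by \<open>1 - Zhat\<close>, which equals \<open>card SR / nR\<close>, it becomes a mean
  over all \<open>nR\<close> records in which failure-labelled ones count zero. This has a fixed
  denominator and i.i.d. summands under the reference law, with mean the integral of
  \<open>1 - psi\<close> times the loss. It also explains \<open>epsD\<close>: its error is divided
  by \<open>1 - Zhat\<close> because the margin multiplies by that weight again.

  The two acceptance rules are separated by a path on which \<open>Lhat\<close> stays below \<tau>
  while the measured margin is clearly positive. As the conditions must hold for the whole step, a
  complete instance is built around such a path, with samples large enough to make the radii
  small.\<close>

lemma emeasure_PiM_prob_space:
  assumes "finite I" and "\<And>i. i \<in> I \<Longrightarrow> prob_space (M i)" and "\<And>i. i \<in> I \<Longrightarrow> A i \<in> sets (M i)"
  shows "emeasure (PiM I M) (Pi\<^sub>E I A) = (\<Prod>i\<in>I. emeasure (M i) (A i))"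
proof -
  \<comment> \<open>The theory of product probability spaces asks for a probability space at every
    index. The factors outside \<open>I\<close> do not enter \<open>PiM I M\<close> and are replaced
    by point masses.\<close>
  define M' where "M' i = (if i \<in> I then M i else return (count_space UNIV) undefined)" for i
  have "prob_space (M' i)" for i
    using assms(2) by (auto simp: M'_def intro: prob_space_return)
  then interpret product_prob_space M' I
    by (rule product_prob_spaceI)
  have "emeasure (PiM I M') (Pi\<^sub>E I A) = (\<Prod>i\<in>I. emeasure (M' i) (A i))"
    using assms by (intro emeasure_PiM) (auto simp: M'_def)
  moreover have "PiM I M' = PiM I M"
    by (rule PiM_cong) (auto simp: M'_def)
  ultimately show ?thesis
    by (simp add: M'_def)
qed

text \<open>Measurability of a kernel need only be checked on an intersection-stable generator. On
  boxes the product measure is a finite product of functions that are measurable by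
  assumption.\<close>

lemma PiM_kernel:
  assumes "finite I" and K: "\<And>i. i \<in> I \<Longrightarrow> K i \<in> X \<rightarrow>\<^sub>M prob_algebra (Y i)"
  shows "(\<lambda>x. PiM I (\<lambda>i. K i x)) \<in> X \<rightarrow>\<^sub>M prob_algebra (PiM I Y)"
proof (rule measurable_prob_algebra_generated[OF sets_PiM Int_stable_prod_algebra prod_algebra_sets_into_space])
  fix x assume x: "x \<in> space X"
  have *: "sets (K i x) = sets (Y i) \<and> prob_space (K i x)" if "i \<in> I" for i
    using measurable_space[OF K[OF that] x] by (simp add: space_prob_algebra)
  then show "prob_space (PiM I (\<lambda>i. K i x))"
    by (intro prob_space_PiM) auto
  show "sets (PiM I (\<lambda>i. K i x)) = sets (PiM I Y)"
    using * by (intro sets_PiM_cong) auto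
next
  fix A assume "A \<in> prod_algebra I Y"
  then obtain E where A: "A = Pi\<^sub>E I E" and E: "\<And>i. i \<in> I \<Longrightarrow> E i \<in> sets (Y i)"
    using assms(1) by (auto simp: prod_algebra_eq_finite)
  have "(\<lambda>x. emeasure (PiM I (\<lambda>i. K i x)) A) \<in> borel_measurable X \<longleftrightarrow>
        (\<lambda>x. \<Prod>i\<in>I. emeasure (K i x) (E i)) \<in> borel_measurable X"
  proof (rule measurable_cong)
    fix x assume x: "x \<in> space X"
    have "sets (K i x) = sets (Y i) \<and> prob_space (K i x)" if "i \<in> I" for i
      using measurable_space[OF K[OF that] x] by (simp add: space_prob_algebra)
    then show "emeasure (PiM I (\<lambda>i. K i x)) A = (\<Prod>i\<in>I. emeasure (K i x) (E i))"
      unfolding A using assms(1) E by (intro emeasure_PiM_prob_space) auto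
  qed
  also have "(\<lambda>x. emeasure (K i x) (E i)) \<in> borel_measurable X" if "i \<in> I" for i
    using measurable_prob_algebraD[OF K[OF that]] E[OF that]
    by (rule measurable_emeasure_kernel)
  then have "(\<lambda>x. \<Prod>i\<in>I. emeasure (K i x) (E i)) \<in> borel_measurable X"
    by (intro borel_measurable_prod_ennreal) auto
  finally show "(\<lambda>x. emeasure (PiM I (\<lambda>i. K i x)) A) \<in> borel_measurable X" by simp
qed

text \<open>Turns a bound conditional on \<open>x\<close> into an unconditional one. Rectangles with
  right side in \<open>G\<close> generate the product and are intersection-stable, so
  \<open>Q\<close> is the composition of \<mu> with \<open>K\<close>, and \<open>Q\<close> of a set
  is the \<mu>-average of its section measures. A total mass below 1 is allowed because \<mu> will
  come from a probability restricted to an event.\<close>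

lemma emeasure_le_of_sections:
  assumes K: "K \<in> X \<rightarrow>\<^sub>M prob_algebra Y"
    and \<mu>: "sets \<mu> = sets X" "emeasure \<mu> (space \<mu>) \<le> 1" "space X \<noteq> {}"
    and Q: "sets Q = sets (X \<Otimes>\<^sub>M Y)"
    and G: "Int_stable G" "sets Y = sigma_sets (space Y) G" "space Y \<in> G"
    and eq: "\<And>C R. C \<in> sets X \<Longrightarrow> R \<in> G \<Longrightarrow>
      emeasure Q (C \<times> R) = (\<integral>\<^sup>+x\<in>C. emeasure (K x) R \<partial>\<mu>)"
    and B: "B \<in> sets (X \<Otimes>\<^sub>M Y)" "\<And>x. x \<in> space X \<Longrightarrow> emeasure (K x) (Pair x -` B) \<le> c"
  shows "emeasure Q B \<le> c"
proof -
  let ?K = "\<lambda>x. distr (K x) (X \<Otimes>\<^sub>M Y) (Pair x)"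
  have G_sub: "G \<subseteq> Pow (space Y)"
    using G(2) by (metis sets.space_closed sigma_sets_superset_generator subset_trans)
  have [measurable_cong]: "sets \<mu> = sets X" by fact
  have sp: "space \<mu> = space X" using \<mu>(1) by (rule sets_eq_imp_space_eq)
  have K': "?K \<in> X \<rightarrow>\<^sub>M prob_algebra (X \<Otimes>\<^sub>M Y)"
    by (rule measurable_distr_prob_space2[OF K]) simp
  have K'': "?K \<in> \<mu> \<rightarrow>\<^sub>M subprob_algebra (X \<Otimes>\<^sub>M Y)"
    using measurable_prob_algebraD[OF K'] \<mu>(1) by (simp cong: measurable_cong_sets)
  have Ks: "sets (K x) = sets Y" "space (K x) = space Y" "prob_space (K x)" if "x \<in> space X" for x
    using measurable_space[OF K that] by (auto simp: space_prob_algebra dest: sets_eq_imp_space_eq)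
  have em: "emeasure (\<mu> \<bind> ?K) A = (\<integral>\<^sup>+x. emeasure (K x) (Pair x -` A) \<partial>\<mu>)"
    if A: "A \<in> sets (X \<Otimes>\<^sub>M Y)" for A
  proof -
    have "emeasure (\<mu> \<bind> ?K) A = (\<integral>\<^sup>+x. emeasure (?K x) A \<partial>\<mu>)"
      using \<mu>(3) sp K'' A by (intro emeasure_bind) auto
    also have "\<dots> = (\<integral>\<^sup>+x. emeasure (K x) (Pair x -` A) \<partial>\<mu>)"
    proof (rule nn_integral_cong)
      fix x assume "x \<in> space \<mu>"
      then have x: "x \<in> space X" by (simp add: sp)
      have "Pair x \<in> K x \<rightarrow>\<^sub>M X \<Otimes>\<^sub>M Y"
        using Ks[OF x] x by (simp cong: measurable_cong_sets)
      then have "emeasure (?K x) A = emeasure (K x) (Pair x -` A \<inter> space (K x))"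
        using A by (rule emeasure_distr)
      also have "Pair x -` A \<inter> space (K x) = Pair x -` A"
        using sets.sets_into_space[OF A] Ks[OF x] by (auto simp: space_pair_measure)
      finally show "emeasure (?K x) A = emeasure (K x) (Pair x -` A)" .
    qed
    finally show ?thesis .
  qed
  have "Q = \<mu> \<bind> ?K"
  proof (rule measure_eqI_generator_eq)
    let ?E = "{C \<times> R | C R. C \<in> sets X \<and> R \<in> G}"
    show "Int_stable ?E"
    proof (rule Int_stableI)
      fix a b assume "a \<in> ?E" "b \<in> ?E"
      then obtain C R C' R' where "a = C \<times> R" "b = C' \<times> R'" "C \<in> sets X" "C' \<in> sets X" "R \<in> G" "R' \<in> G"
        by blast
      moreover from this have "R \<inter> R' \<in> G" using G(1) by (auto simp: Int_stable_def)
      ultimately show "a \<inter> b \<in> ?E"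
        by (auto simp: Times_Int_Times intro!: exI[of _ "C \<inter> C'"] exI[of _ "R \<inter> R'"])
    qed
    show "?E \<subseteq> Pow (space X \<times> space Y)"
      using G_sub sets.sets_into_space by fastforce
    show sets1: "sets Q = sigma_sets (space X \<times> space Y) ?E"
    proof -
      have "sets (X \<Otimes>\<^sub>M Y) = sets (sigma (space X \<times> space Y) {a \<times> b | a b. a \<in> sets X \<and> b \<in> G})"
        by (rule sets_pair_eq[where Ca="{space X}" and Cb="{space Y}"])
           (use G_sub G in \<open>auto simp: sets.space_closed sets.sigma_sets_eq\<close>)
      also have "\<dots> = sigma_sets (space X \<times> space Y) ?E"
        by (rule sets_measure_of) fact
      finally show ?thesis using Q by simp
    qed
    have "sets (\<mu> \<bind> ?K) = sets (X \<Otimes>\<^sub>M Y)"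
      by (rule sets_bind) (use \<mu>(3) sp Ks in auto)
    then show "sets (\<mu> \<bind> ?K) = sigma_sets (space X \<times> space Y) ?E"
      using sets1 Q by simp
    \<comment> \<open>The whole product is itself a generator rectangle, so this one set covers the
      space; its measure is shown to be finite below.\<close>
    show "range (\<lambda>_::nat. space X \<times> space Y) \<subseteq> ?E"
      using G(3) by auto
    fix A assume "A \<in> ?E"
    then obtain C R where A: "A = C \<times> R" "C \<in> sets X" "R \<in> G" by blast
    then have R: "R \<in> sets Y" using G(2) by auto
    have "emeasure (\<mu> \<bind> ?K) A = (\<integral>\<^sup>+x. emeasure (K x) (Pair x -` A) \<partial>\<mu>)"
      using A R by (intro em) auto
    also have "\<dots> = (\<integral>\<^sup>+x\<in>C. emeasure (K x) R \<partial>\<mu>)"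
      unfolding A by (intro nn_integral_cong) (auto simp: indicator_def)
    finally show "emeasure Q A = emeasure (\<mu> \<bind> ?K) A"
      using eq A by simp
  next
    have "emeasure Q (space X \<times> space Y) = (\<integral>\<^sup>+x\<in>space X. emeasure (K x) (space Y) \<partial>\<mu>)"
      by (rule eq) (use G(3) in auto)
    also have "\<dots> \<le> (\<integral>\<^sup>+x. 1 \<partial>\<mu>)"
      by (rule nn_integral_mono)
         (use Ks sp in \<open>auto simp: indicator_def intro!: subprob_space.subprob_emeasure_le_1 prob_space_imp_subprob_space\<close>)
    also have "\<dots> \<le> 1" using \<mu>(2) by simp
    finally show "emeasure Q (space X \<times> space Y) \<noteq> \<infinity>"
      by (auto simp: top_unique)
  qed auto
  then have "emeasure Q B = (\<integral>\<^sup>+x. emeasure (K x) (Pair x -` B) \<partial>\<mu>)"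
    using em[OF B(1)] by simp
  also have "\<dots> \<le> (\<integral>\<^sup>+x. c \<partial>\<mu>)"
    by (rule nn_integral_mono) (use B(2) sp in auto)
  also have "\<dots> = c * emeasure \<mu> (space \<mu>)" by simp
  also have "\<dots> \<le> c" using mult_left_mono[OF \<mu>(2), of c] by simp
  finally show ?thesis .
qed

text \<open>Independence says that the joint law is the product of the marginals, and here the joint
  map is the identity of the product space. That criterion asks for a nonempty index set, hence the
  case distinction.\<close>

lemma indep_vars_PiM_components:
  assumes M: "\<And>i. i \<in> I \<Longrightarrow> prob_space (M i)"
  shows "prob_space.indep_vars (PiM I M) M (\<lambda>i x. x i) I"
proof (cases "I = {}")
  case True
  interpret P: prob_space "PiM I M" by (rule prob_space_PiM) (rule M)
  show ?thesis unfolding P.indep_vars_def P.indep_sets_def using True by auto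
next
  case False
  interpret P: prob_space "PiM I M" by (rule prob_space_PiM) (rule M)
  have d: "distr (PiM I M) (M i) (\<lambda>x. x i) = M i" if "i \<in> I" for i
    by (rule distr_PiM_component) (use M that in auto)
  show ?thesis
  proof (subst P.indep_vars_iff_distr_eq_PiM'[OF False])
    have "distr (PiM I M) (PiM I M) (\<lambda>x. restrict x I) = distr (PiM I M) (PiM I M) (\<lambda>x. x)"
      by (rule distr_cong) (auto simp: space_PiM)
    also have "\<dots> = (\<Pi>\<^sub>M i\<in>I. distr (PiM I M) (M i) (\<lambda>x. x i))"
      unfolding distr_id by (intro PiM_cong) (simp_all add: d)
    finally show "distr (PiM I M) (PiM I M) (\<lambda>x. \<lambda>i\<in>I. x i) = (\<Pi>\<^sub>M i\<in>I. distr (PiM I M) (M i) (\<lambda>x. x i))" .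
  qed auto
qed

section \<open>Hoeffding's inequality for a prescribed risk\<close>

text \<open>The radius \<open>r\<close> for which the two-sided Hoeffding bound
  \<open>2 * exp (- 2 * n * r * r)\<close> equals \<beta>. \<open>epsV\<close>, \<open>epsZ\<close>
  and \<open>epsR\<close> are values of it, the latter two at risks reduced by the mixing
  term.\<close>

definition hoeffding_radius :: "real \<Rightarrow> nat \<Rightarrow> real" where
  "hoeffding_radius \<beta> n = sqrt (ln (2 / \<beta>) / (2 * real n))"

lemma hoeffding_radius_nonneg: "0 < \<beta> \<Longrightarrow> \<beta> \<le> 2 \<Longrightarrow> 0 \<le> hoeffding_radius \<beta> n"
  by (simp add: hoeffding_radius_def)

lemma hoeffding_mean:
  assumes "prob_space M" and f[measurable]: "f \<in> borel_measurable M"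
    and f01: "\<And>x. x \<in> space M \<Longrightarrow> 0 \<le> f x \<and> f x \<le> 1"
    and n: "0 < n" and \<beta>: "0 < \<beta>" "\<beta> \<le> 2"
  shows "measure (\<Pi>\<^sub>M i\<in>{..<n}. M) {x \<in> space (\<Pi>\<^sub>M i\<in>{..<n}. M).
    hoeffding_radius \<beta> n < \<bar>(\<Sum>i<n. f (x i)) / real n - (\<integral>x. f x \<partial>M)\<bar>} \<le> \<beta>"
proof -
  interpret prob_space M by fact
  let ?P = "\<Pi>\<^sub>M i\<in>{..<n}. M" and ?\<epsilon> = "hoeffding_radius \<beta> n"
  interpret PP: prob_space ?P by (rule prob_space_PiM) (rule assms(1))
  have d: "distr ?P M (\<lambda>x. x i) = M" if "i \<in> {..<n}" for i
    by (rule distr_PiM_component) (use assms(1) that in auto)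
  have ind: "PP.indep_vars (\<lambda>_. borel) (\<lambda>i x. f (x i)) {..<n}"
    by (rule PP.indep_vars_compose2[OF indep_vars_PiM_components]) (use assms(1) in auto)
  interpret H: Hoeffding_ineq ?P "{..<n}" "\<lambda>i x. f (x i)" "\<lambda>_. 0" "\<lambda>_. 1" "real n * (\<integral>x. f x \<partial>M)"
  proof unfold_locales
    show "AE x in ?P. f (x i) \<in> {0..1}" if "i \<in> {..<n}" for i
      using that f01 by (intro AE_I2) (auto simp: space_PiM)
    have "PP.expectation (\<lambda>x. f (x i)) = (\<integral>x. f x \<partial>M)" if "i \<in> {..<n}" for i
    proof -
      have "PP.expectation (\<lambda>x. f (x i)) = (\<integral>y. f y \<partial>distr ?P M (\<lambda>x. x i))"
        using that by (intro integral_distr[symmetric]) auto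
      then show ?thesis using d[OF that] by simp
    qed
    then show "real n * (\<integral>x. f x \<partial>M) \<equiv> \<Sum>i<n. PP.expectation (\<lambda>x. f (x i))"
      by (intro eq_reflection) (simp add: sum.cong)
  qed (use ind in auto)
  \<comment> \<open>Hoeffding's inequality is about sums and non-strict deviations; a mean that is
    off by more than the radius has a sum that is off by at least \<open>n\<close> times the
    radius.\<close>
  have "measure ?P {x \<in> space ?P. ?\<epsilon> < \<bar>(\<Sum>i<n. f (x i)) / real n - (\<integral>x. f x \<partial>M)\<bar>}
    \<le> measure ?P {x \<in> space ?P. real n * ?\<epsilon> \<le> \<bar>(\<Sum>i<n. f (x i)) - real n * (\<integral>x. f x \<partial>M)\<bar>}"
  proof (rule PP.finite_measure_mono)
    have "real n * ?\<epsilon> \<le> \<bar>s - real n * e\<bar>" if "?\<epsilon> < \<bar>s / real n - e\<bar>" for s e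
    proof -
      have "real n * ?\<epsilon> \<le> real n * \<bar>s / real n - e\<bar>"
        using that by (intro mult_left_mono) auto
      also have "\<dots> = \<bar>s - real n * e\<bar>"
        using n by (simp add: abs_mult[of "real n" "s / real n - e", simplified, symmetric] right_diff_distrib)
      finally show ?thesis .
    qed
    then show "{x \<in> space ?P. ?\<epsilon> < \<bar>(\<Sum>i<n. f (x i)) / real n - (\<integral>x. f x \<partial>M)\<bar>}
      \<subseteq> {x \<in> space ?P. real n * ?\<epsilon> \<le> \<bar>(\<Sum>i<n. f (x i)) - real n * (\<integral>x. f x \<partial>M)\<bar>}"
      by blast
    show "{x \<in> space ?P. real n * ?\<epsilon> \<le> \<bar>(\<Sum>i<n. f (x i)) - real n * (\<integral>x. f x \<partial>M)\<bar>} \<in> sets ?P"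
      by measurable
  qed
  also have "\<dots> \<le> 2 * exp (- 2 * (real n * ?\<epsilon>)\<^sup>2 / (\<Sum>i<n. (1 - 0)\<^sup>2))"
    using n \<beta> by (intro H.Hoeffding_ineq_abs_ge) (auto simp: hoeffding_radius_nonneg)
  also have "- 2 * (real n * ?\<epsilon>)\<^sup>2 / (\<Sum>i<n. (1 - 0)\<^sup>2) = - ln (2 / \<beta>)"
  proof -
    have "?\<epsilon>\<^sup>2 = ln (2 / \<beta>) / (2 * real n)"
      using \<beta> by (simp add: hoeffding_radius_def)
    then show ?thesis
      using n by (simp add: power_mult_distrib) (simp add: power2_eq_square)
  qed
  also have "2 * exp (- ln (2 / \<beta>)) = \<beta>"
    using \<beta> by (simp add: exp_minus)
  finally show ?thesis .
qed

text \<open>The integrand varies with \<open>x\<close> too. Pushing \<open>K x\<close> forward along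
  \<open>y\<close> to \<open>(x, y)\<close> gives a kernel into the product, against which one fixed
  function is integrated.\<close>

lemma kernel_integral_measurable:
  fixes f :: "'a \<Rightarrow> 'b \<Rightarrow> 'c::{banach, second_countable_topology}"
  assumes f: "(\<lambda>(x, y). f x y) \<in> borel_measurable (M \<Otimes>\<^sub>M N)"
    and K: "K \<in> M \<rightarrow>\<^sub>M prob_algebra N"
  shows "(\<lambda>x. integral\<^sup>L (K x) (f x)) \<in> borel_measurable M"
proof -
  have D: "(\<lambda>x. distr (K x) (M \<Otimes>\<^sub>M N) (\<lambda>y. (x, y))) \<in> M \<rightarrow>\<^sub>M subprob_algebra (M \<Otimes>\<^sub>M N)"
    by (intro measurable_prob_algebraD measurable_distr_prob_space2[OF K]) simp
  have "(\<lambda>x. integral\<^sup>L (distr (K x) (M \<Otimes>\<^sub>M N) (\<lambda>y. (x, y))) (\<lambda>(x, y). f x y)) \<in> borel_measurable M"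
    by (rule measurable_compose[OF D integral_measurable_subprob_algebra[OF f]])
  then show ?thesis
  proof (rule measurable_cong[THEN iffD1, rotated])
    fix x assume x: "x \<in> space M"
    have "sets (K x) = sets N"
      using measurable_space[OF K x] by (simp add: space_prob_algebra)
    then have "Pair x \<in> K x \<rightarrow>\<^sub>M M \<Otimes>\<^sub>M N"
      using x by (simp cong: measurable_cong_sets)
    then show "integral\<^sup>L (distr (K x) (M \<Otimes>\<^sub>M N) (\<lambda>y. (x, y))) (\<lambda>(x, y). f x y) = integral\<^sup>L (K x) (f x)"
      using f by (subst integral_distr) auto
  qed
qed

text \<open>A Boolean event is finite, so its measure is a finite sum of point masses; these are
  \<open>p x\<close> and \<open>1 - p x\<close> because \<open>p\<close> stays in the unit
  interval.\<close>

lemma bernoulli_kernel: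
  assumes p[measurable]: "p \<in> borel_measurable X" and p01: "\<And>x. x \<in> space X \<Longrightarrow> 0 \<le> p x \<and> p x \<le> 1"
  shows "(\<lambda>x. measure_pmf (bernoulli_pmf (p x))) \<in> X \<rightarrow>\<^sub>M prob_algebra (count_space UNIV)"
proof (rule measurable_prob_algebra_generated[where G=UNIV and \<Omega>=UNIV])
  fix A :: "bool set"
  have "(\<lambda>x. pmf (bernoulli_pmf (p x)) y) \<in> borel_measurable X" for y
  proof (cases y)
    case True
    have "(\<lambda>x. pmf (bernoulli_pmf (p x)) y) \<in> borel_measurable X \<longleftrightarrow> p \<in> borel_measurable X"
      using p01 True by (intro measurable_cong) auto
    then show ?thesis by simp
  next
    case False
    have "(\<lambda>x. pmf (bernoulli_pmf (p x)) y) \<in> borel_measurable X \<longleftrightarrow> (\<lambda>x. 1 - p x) \<in> borel_measurable X"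
      using p01 False by (intro measurable_cong) auto
    then show ?thesis by simp
  qed
  then have "(\<lambda>x. \<Sum>y\<in>A. ennreal (pmf (bernoulli_pmf (p x)) y)) \<in> borel_measurable X"
    by measurable
  then show "(\<lambda>x. emeasure (measure_pmf (bernoulli_pmf (p x))) A) \<in> borel_measurable X"
    by (simp add: emeasure_measure_pmf_finite)
qed (auto simp: Int_stable_def measure_pmf.prob_space_axioms intro: sigma_sets.Basic)

section \<open>Modifications together with the failed output\<close>

lemma with_bot_generator:
  "insert {None} ((\<lambda>B. Some ` B) ` sets M) \<subseteq> Pow (insert None (Some ` space M))"
  using sets.sets_into_space by fastforce

lemma space_with_bot: "space (with_bot M) = insert None (Some ` space M)"
  unfolding with_bot_def using with_bot_generator by (rule space_measure_of)

lemma sets_with_bot: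
  "sets (with_bot M)
    = sigma_sets (insert None (Some ` space M)) (insert {None} ((\<lambda>B. Some ` B) ` sets M))"
  unfolding with_bot_def using with_bot_generator by (rule sets_measure_of)

lemma None_in_sets_with_bot [measurable]: "{None} \<in> sets (with_bot M)"
  unfolding sets_with_bot by (intro sigma_sets.Basic) auto

lemma Some_in_sets_with_bot: "B \<in> sets M \<Longrightarrow> Some ` B \<in> sets (with_bot M)"
  unfolding sets_with_bot by (intro sigma_sets.Basic) auto

lemma measurable_case_with_bot:
  assumes f: "f \<in> X \<rightarrow>\<^sub>M Y" and g: "(\<lambda>(x, c). g x c) \<in> X \<Otimes>\<^sub>M M \<rightarrow>\<^sub>M Y"
  shows "(\<lambda>(x, m). case m of None \<Rightarrow> f x | Some c \<Rightarrow> g x c) \<in> X \<Otimes>\<^sub>M with_bot M \<rightarrow>\<^sub>M Y"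
proof -
  let ?A = "{p \<in> space (X \<Otimes>\<^sub>M with_bot M). snd p \<in> {None}}"
  let ?h = "\<lambda>(x, m). case m of None \<Rightarrow> f x | Some c \<Rightarrow> g x c"
  have A[measurable]: "?A \<in> sets (X \<Otimes>\<^sub>M with_bot M)" by measurable
  show ?thesis
  proof (rule measurable_piecewise_restrict[where C="{?A, space (X \<Otimes>\<^sub>M with_bot M) - ?A}"])
    fix \<Omega> assume "\<Omega> \<in> {?A, space (X \<Otimes>\<^sub>M with_bot M) - ?A}"
    then consider "\<Omega> = ?A" | "\<Omega> = space (X \<Otimes>\<^sub>M with_bot M) - ?A" by blast
    then show "?h \<in> restrict_space (X \<Otimes>\<^sub>M with_bot M) \<Omega> \<rightarrow>\<^sub>M Y"
    proof cases
      case 1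
      have "(\<lambda>p. f (fst p)) \<in> restrict_space (X \<Otimes>\<^sub>M with_bot M) \<Omega> \<rightarrow>\<^sub>M Y"
        by (intro measurable_restrict_space1 measurable_compose[OF measurable_fst f])
      then show ?thesis
        by (rule measurable_cong[THEN iffD1, rotated]) (auto simp: 1 space_restrict_space)
    next
      case 2
      let ?R = "restrict_space (X \<Otimes>\<^sub>M with_bot M) \<Omega>"
      have the: "(\<lambda>p. the (snd p)) \<in> ?R \<rightarrow>\<^sub>M M"
      proof (rule measurableI)
        fix p assume "p \<in> space ?R"
        then show "the (snd p) \<in> space M"
          by (auto simp: 2 space_restrict_space space_pair_measure space_with_bot)
      next
        fix B assume B: "B \<in> sets M"
        have "(\<lambda>p. the (snd p)) -` B \<inter> space ?R = snd -` (Some ` B) \<inter> space ?R"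
          using sets.sets_into_space[OF B]
          by (auto simp: 2 space_restrict_space space_pair_measure space_with_bot)
        also have "\<dots> \<in> sets ?R"
          using Some_in_sets_with_bot[OF B] by (intro measurable_sets[where A="with_bot M"] measurable_restrict_space1) auto
        finally show "(\<lambda>p. the (snd p)) -` B \<inter> space ?R \<in> sets ?R" .
      qed
      have "(\<lambda>p. (fst p, the (snd p))) \<in> ?R \<rightarrow>\<^sub>M X \<Otimes>\<^sub>M M"
        by (intro measurable_Pair the measurable_restrict_space1) auto
      from measurable_compose[OF this g]
      have "(\<lambda>p. g (fst p) (the (snd p))) \<in> ?R \<rightarrow>\<^sub>M Y" by simp
      then show ?thesis
        by (rule measurable_cong[THEN iffD1, rotated])
           (auto simp: 2 space_restrict_space space_pair_measure space_with_bot)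
    qed
  qed (use A in auto)
qed

section \<open>Measurability\<close>

text \<open>Kept apart from the protocol so that the coin instance below can use these results
  before its own protocol conditions are established.\<close>

locale evaluation_step =
  fixes S :: "('w, 't, 'o, 'a, 'c, 'u) step"
  assumes setting: "setting S"
begin

lemma
  shows prob_Pr: "prob_space (Pr S)" and prob_Duser: "prob_space (Duser S)"
    and sets_Duser [simp, measurable_cong]: "sets (Duser S) = sets (taskS S)"
    and runK_kernel: "(\<lambda>(a, t). runK S a t) \<in> agentS S \<Otimes>\<^sub>M taskS S \<rightarrow>\<^sub>M prob_algebra (outS S)"
    and oplus_measurable: "(\<lambda>(a, c). oplus S a c) \<in> agentS S \<Otimes>\<^sub>M modS S \<rightarrow>\<^sub>M agentS S"
    and rew_measurable: "(\<lambda>(t, x). rew S t x) \<in> borel_measurable (taskS S \<Otimes>\<^sub>M outS S)"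
    and rew_bounds: "t \<in> space (taskS S) \<Longrightarrow> x \<in> space (outS S) \<Longrightarrow> 0 \<le> rew S t x \<and> rew S t x \<le> 1"
    and fails_measurable: "(\<lambda>(t, x). fails S t x) \<in> taskS S \<Otimes>\<^sub>M outS S \<rightarrow>\<^sub>M count_space UNIV"
    and task_measurable [measurable]: "task S n \<in> Pr S \<rightarrow>\<^sub>M taskS S"
    and outp_measurable [measurable]: "outp S n \<in> Pr S \<rightarrow>\<^sub>M outS S"
    and cur_measurable [measurable]: "cur S \<in> Pr S \<rightarrow>\<^sub>M agentS S"
    and modif_measurable [measurable]: "modif S \<in> Pr S \<rightarrow>\<^sub>M with_bot (modS S)"
    and aux_measurable [measurable]: "aux S \<in> Pr S \<rightarrow>\<^sub>M auxS S"
    and offset_measurable [measurable]: "offset S \<in> Pr S \<rightarrow>\<^sub>M count_space UNIV"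
    and srec_task_measurable: "j < nR S \<Longrightarrow> srec_task S j \<in> Pr S \<rightarrow>\<^sub>M taskS S"
    and srec_lab_measurable: "j < nR S \<Longrightarrow> srec_lab S j \<in> Pr S \<rightarrow>\<^sub>M count_space UNIV"
    and valid_sample_sets [measurable]: "valid_sample S \<in> sets (Pr S)"
    and roll_measurable [measurable]: "roll S b e l \<in> Pr S \<rightarrow>\<^sub>M outS S"
    and fail_mass_bounds: "\<omega> \<in> space (Pr S) \<Longrightarrow> 0 < fail_mass S (cur S \<omega>) \<and> fail_mass S (cur S \<omega>) < 1"
    and sizes_pos: "0 < nF S" "0 < nR S" "0 < nroll S"
    and risks: "0 < betaV S" "betaV S < 1" "0 < betaZ S" "betaZ S < 1" "0 < betaR S" "betaR S < 1"
      "0 < betaF S" "betaF S < 1"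
  using setting by (auto simp: setting_def)

sublocale P: prob_space "Pr S" by (rule prob_Pr)

sublocale D: prob_space "Duser S" by (rule prob_Duser)

lemma space_Duser [simp]: "space (Duser S) = space (taskS S)"
  by (rule sets_eq_imp_space_eq) simp

lemma runK_simps:
  assumes "a \<in> space (agentS S)" "t \<in> space (taskS S)"
  shows "prob_space (runK S a t)" "sets (runK S a t) = sets (outS S)" "space (runK S a t) = space (outS S)"
  using measurable_space[OF runK_kernel, of "(a, t)"] assms
  by (auto simp: space_prob_algebra space_pair_measure dest: sets_eq_imp_space_eq)

lemma val_measurable [measurable (raw)]:
  assumes [measurable]: "f \<in> X \<rightarrow>\<^sub>M agentS S" "g \<in> X \<rightarrow>\<^sub>M taskS S"
  shows "(\<lambda>x. val S (f x) (g x)) \<in> borel_measurable X"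
  unfolding val_def
proof (rule kernel_integral_measurable)
  have "(\<lambda>(x, y). (g x, y)) \<in> X \<Otimes>\<^sub>M outS S \<rightarrow>\<^sub>M taskS S \<Otimes>\<^sub>M outS S" by measurable
  from measurable_compose[OF this rew_measurable]
  show "(\<lambda>(x, y). rew S (g x) y) \<in> borel_measurable (X \<Otimes>\<^sub>M outS S)" by (simp add: case_prod_beta')
  have "(\<lambda>x. (f x, g x)) \<in> X \<rightarrow>\<^sub>M agentS S \<Otimes>\<^sub>M taskS S" by measurable
  from measurable_compose[OF this runK_kernel]
  show "(\<lambda>x. runK S (f x) (g x)) \<in> X \<rightarrow>\<^sub>M prob_algebra (outS S)" by simp
qed

lemma psi_measurable [measurable (raw)]:
  assumes [measurable]: "f \<in> X \<rightarrow>\<^sub>M agentS S" "g \<in> X \<rightarrow>\<^sub>M taskS S"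
  shows "(\<lambda>x. psi S (f x) (g x)) \<in> borel_measurable X"
  unfolding psi_def
proof (rule kernel_integral_measurable)
  have "(\<lambda>(x, y). (g x, y)) \<in> X \<Otimes>\<^sub>M outS S \<rightarrow>\<^sub>M taskS S \<Otimes>\<^sub>M outS S" by measurable
  from measurable_compose[OF this fails_measurable]
  have [measurable]: "(\<lambda>p. fails S (g (fst p)) (snd p)) \<in> X \<Otimes>\<^sub>M outS S \<rightarrow>\<^sub>M count_space UNIV"
    by (simp add: case_prod_beta')
  show "(\<lambda>(x, y). of_bool (fails S (g x) y) :: real) \<in> borel_measurable (X \<Otimes>\<^sub>M outS S)"
    unfolding case_prod_beta' by measurable
  have "(\<lambda>x. (f x, g x)) \<in> X \<rightarrow>\<^sub>M agentS S \<Otimes>\<^sub>M taskS S" by measurable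
  from measurable_compose[OF this runK_kernel]
  show "(\<lambda>x. runK S (f x) (g x)) \<in> X \<rightarrow>\<^sub>M prob_algebra (outS S)" by simp
qed

lemma rew_section_measurable:
  assumes "a \<in> space (agentS S)" "t \<in> space (taskS S)"
  shows "rew S t \<in> borel_measurable (runK S a t)" "fails S t \<in> runK S a t \<rightarrow>\<^sub>M count_space UNIV"
  using measurable_Pair2[OF rew_measurable assms(2)] measurable_Pair2[OF fails_measurable assms(2)]
    runK_simps[OF assms]
  by (auto cong: measurable_cong_sets)

lemma val_bounds:
  assumes "a \<in> space (agentS S)" "t \<in> space (taskS S)"
  shows "0 \<le> val S a t" "val S a t \<le> 1"
proof -
  interpret prob_space "runK S a t" using runK_simps[OF assms] by simp
  note [measurable] = rew_section_measurable[OF assms]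
  show "0 \<le> val S a t" unfolding val_def
    using rew_bounds[OF assms(2)] runK_simps[OF assms] by (intro Bochner_Integration.integral_nonneg) auto
  show "val S a t \<le> 1" unfolding val_def
  proof (rule integral_le_const)
    show "integrable (runK S a t) (rew S t)"
      using rew_bounds[OF assms(2)] runK_simps[OF assms]
      by (intro integrable_const_bound[where B=1]) auto
    show "AE x in runK S a t. rew S t x \<le> 1"
      using rew_bounds[OF assms(2)] runK_simps[OF assms] by (intro AE_I2) auto
  qed
qed

lemma psi_bounds:
  assumes "a \<in> space (agentS S)" "t \<in> space (taskS S)"
  shows "0 \<le> psi S a t" "psi S a t \<le> 1"
proof -
  interpret prob_space "runK S a t" using runK_simps[OF assms] by simp
  note [measurable] = rew_section_measurable[OF assms]
  show "0 \<le> psi S a t" unfolding psi_def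
    by (intro Bochner_Integration.integral_nonneg) auto
  show "psi S a t \<le> 1" unfolding psi_def
    by (intro integral_le_const integrable_const_bound[where B=1] AE_I2) auto
qed

text \<open>Stated on pairs of agent and modification rather than on \<open>Pr S\<close>, because
  the retained loss must later be a function of \<open>info\<close> and a record alone.\<close>

lemma candidate_info_measurable:
  "(\<lambda>(a, m). case m of None \<Rightarrow> a | Some c \<Rightarrow> oplus S a c) \<in> agentS S \<Otimes>\<^sub>M with_bot (modS S) \<rightarrow>\<^sub>M agentS S"
  using measurable_case_with_bot[OF measurable_ident oplus_measurable, unfolded id_def] .

lemma candidate_measurable [measurable]: "candidate S \<in> Pr S \<rightarrow>\<^sub>M agentS S"
proof -
  have "(\<lambda>\<omega>. (cur S \<omega>, modif S \<omega>)) \<in> Pr S \<rightarrow>\<^sub>M agentS S \<Otimes>\<^sub>M with_bot (modS S)" by measurable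
  from measurable_compose[OF this candidate_info_measurable] show ?thesis
    by (simp add: candidate_def[abs_def])
qed

lemma mark_measurable [measurable]:
  "(\<lambda>\<omega>. fails S (task S n \<omega>) (outp S n \<omega>)) \<in> Pr S \<rightarrow>\<^sub>M count_space UNIV"
proof -
  have "(\<lambda>\<omega>. (task S n \<omega>, outp S n \<omega>)) \<in> Pr S \<rightarrow>\<^sub>M taskS S \<Otimes>\<^sub>M outS S" by measurable
  from measurable_compose[OF this fails_measurable] show ?thesis by simp
qed

text \<open>Lengthening the window by one arrival appends at most one entry, decided by a measurable
  mark.\<close>

lemma marked_measurable [measurable]: "marked S s h \<in> Pr S \<rightarrow>\<^sub>M count_space UNIV"
proof (induction h)
  case 0
  then show ?case by (simp add: marked_def[abs_def])
next
  case (Suc h)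
  note [measurable] = Suc
  have "marked S s (Suc h) = (\<lambda>\<omega>. marked S s h \<omega> @
      (if fails S (task S (s + h) \<omega>) (outp S (s + h) \<omega>) then [s + h] else []))"
    by (simp add: marked_def fun_eq_iff)
  then show ?case by simp
qed

lemma pick_measurable [measurable]: "pick S s h i \<in> Pr S \<rightarrow>\<^sub>M count_space UNIV"
proof -
  have "pick S s h i = (\<lambda>\<omega>. (\<lambda>xs. if i < length xs then xs ! i else s) (marked S s h \<omega>))"
    by (simp add: pick_def fun_eq_iff)
  also have "\<dots> \<in> Pr S \<rightarrow>\<^sub>M count_space UNIV"
    by (rule measurable_compose[OF marked_measurable]) simp
  finally show ?thesis .
qed

text \<open>A random arrival time is handled by splitting over its countably many values.\<close>

lemma task_at_measurable:
  assumes [measurable]: "N \<in> Pr S \<rightarrow>\<^sub>M count_space UNIV"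
  shows "(\<lambda>\<omega>. task S (N \<omega>) \<omega>) \<in> Pr S \<rightarrow>\<^sub>M taskS S"
  by (rule measurable_compose_countable[OF task_measurable assms])

lemma material_measurable [measurable]: "material S \<in> Pr S \<rightarrow>\<^sub>M materialS S"
  unfolding material_def[abs_def] materialS_def gen_idx_def[abs_def]
  by (intro measurable_restrict task_at_measurable) measurable

lemma records_measurable [measurable]: "records S \<in> Pr S \<rightarrow>\<^sub>M recordS S"
  unfolding records_def[abs_def] recordS_def
  by (intro measurable_restrict measurable_Pair srec_task_measurable srec_lab_measurable) auto

lemma info_measurable [measurable]: "info S \<in> Pr S \<rightarrow>\<^sub>M infoS S"
  unfolding info_def[abs_def] infoS_def by measurable

lemma Cand_sets [measurable]: "Cand S \<in> sets (Pr S)"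
proof -
  have "Cand S = {\<omega> \<in> space (Pr S). modif S \<omega> \<notin> {None}}" by (auto simp: Cand_def)
  also have "\<dots> \<in> sets (Pr S)" by measurable
  finally show ?thesis .
qed

lemma SR_measurable [measurable]: "Measurable.pred (Pr S) (\<lambda>\<omega>. j \<in> SR S \<omega>)"
proof (cases "j < nR S")
  case True
  note [measurable] = srec_lab_measurable[OF True]
  show ?thesis using True by (simp add: SR_def)
qed (simp add: SR_def)

lemma ReadyR_sets [measurable]: "ReadyR S \<in> sets (Pr S)"
proof -
  have "1 \<le> card (SR S \<omega>) \<longleftrightarrow> (\<exists>j<nR S. j \<in> SR S \<omega>)" for \<omega>
  proof -
    have "finite (SR S \<omega>)" by (simp add: SR_def)
    then show ?thesis by (auto simp: Suc_le_eq card_gt_0_iff) (auto simp: SR_def)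
  qed
  then have "ReadyR S = {\<omega> \<in> space (Pr S). \<exists>j<nR S. j \<in> SR S \<omega>} \<inter> valid_sample S"
    using sets.sets_into_space[OF valid_sample_sets] by (auto simp: ReadyR_def)
  also have "\<dots> \<in> sets (Pr S)" by measurable
  finally show ?thesis .
qed

end

section \<open>Concentration of the estimates\<close>

text \<open>The law of a single record. \<open>ref_records\<close> draws all tasks first and then
  all labels; \<open>ref_records_eq\<close> recognises it as the i.i.d. power of this law.\<close>

definition record_law :: "('w, 't, 'o, 'a, 'c, 'u) step \<Rightarrow> 'a \<Rightarrow> ('t \<times> bool) measure" where
  "record_law S a = Duser S \<bind> (\<lambda>t.
     distr (measure_pmf (bernoulli_pmf (psi S a t))) (taskS S \<Otimes>\<^sub>M count_space UNIV) (Pair t))"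

lemma beta_mix_nonneg: "0 \<le> beta_mix S j"
  by (simp add: beta_mix_def)

context evaluation_step
begin

abbreviation "recS \<equiv> taskS S \<Otimes>\<^sub>M count_space (UNIV :: bool set)"

lemma Duser_in_prob_algebra: "Duser S \<in> space (prob_algebra (taskS S))"
  by (simp add: space_prob_algebra prob_Duser)

lemma label_kernel:
  assumes f: "f \<in> X \<rightarrow>\<^sub>M agentS S" and g: "g \<in> X \<rightarrow>\<^sub>M taskS S"
  shows "(\<lambda>x. distr (measure_pmf (bernoulli_pmf (psi S (f x) (g x)))) recS (Pair (g x)))
    \<in> X \<rightarrow>\<^sub>M prob_algebra recS"
proof (rule measurable_distr_prob_space2)
  note [measurable] = f g
  show "(\<lambda>x. measure_pmf (bernoulli_pmf (psi S (f x) (g x)))) \<in> X \<rightarrow>\<^sub>M prob_algebra (count_space UNIV)"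
    by (rule bernoulli_kernel)
       (use psi_bounds measurable_space[OF f] measurable_space[OF g] in auto)
  show "(\<lambda>(x, y). (g x, y)) \<in> X \<Otimes>\<^sub>M count_space UNIV \<rightarrow>\<^sub>M recS" by measurable
qed

lemma record_law_kernel:
  assumes f: "f \<in> X \<rightarrow>\<^sub>M agentS S"
  shows "(\<lambda>x. record_law S (f x)) \<in> X \<rightarrow>\<^sub>M prob_algebra recS"
  unfolding record_law_def
proof (rule measurable_bind_prob_space2)
  show "(\<lambda>x. Duser S) \<in> X \<rightarrow>\<^sub>M prob_algebra (taskS S)"
    using Duser_in_prob_algebra by simp
  show "(\<lambda>(x, t). distr (measure_pmf (bernoulli_pmf (psi S (f x) t))) recS (Pair t)) \<in> X \<Otimes>\<^sub>M taskS S \<rightarrow>\<^sub>M prob_algebra recS"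
    unfolding case_prod_beta'
    by (intro label_kernel measurable_compose[OF measurable_fst f] measurable_snd)
qed

lemma label_kernel':
  assumes "a \<in> space (agentS S)"
  shows "(\<lambda>t. distr (measure_pmf (bernoulli_pmf (psi S a t))) recS (Pair t)) \<in> taskS S \<rightarrow>\<^sub>M prob_algebra recS"
  using assms by (intro label_kernel) auto

lemma record_law_simps:
  assumes "a \<in> space (agentS S)"
  shows "prob_space (record_law S a)" "sets (record_law S a) = sets recS"
  using measurable_space[OF record_law_kernel[OF measurable_ident] assms]
  by (auto simp: space_prob_algebra)

lemma emeasure_record_law:
  assumes "a \<in> space (agentS S)" "A \<in> sets recS"
  shows "emeasure (record_law S a) A
    = (\<integral>\<^sup>+t. emeasure (distr (measure_pmf (bernoulli_pmf (psi S a t))) recS (Pair t)) A \<partial>Duser S)"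
  unfolding record_law_def
  by (rule emeasure_bind_prob_algebra[OF Duser_in_prob_algebra label_kernel'[OF assms(1)] assms(2)])

text \<open>Integrating out the label leaves a mixture of two sections with weights
  \<open>psi\<close> and \<open>1 - psi\<close>. For the failure indicator this gives
  \<open>fail_mass\<close>, for a loss that vanishes on failure labels it gives the integral of
  \<open>1 - psi\<close> times the loss.\<close>

lemma integral_record_law:
  fixes h :: "'t \<times> bool \<Rightarrow> real"
  assumes a: "a \<in> space (agentS S)" and h[measurable]: "h \<in> borel_measurable recS"
    and h0: "\<And>p. p \<in> space recS \<Longrightarrow> 0 \<le> h p"
  shows "(\<integral>p. h p \<partial>record_law S a)
    = (\<integral>t. psi S a t * h (t, True) + (1 - psi S a t) * h (t, False) \<partial>Duser S)"
proof -
  have sp: "space (record_law S a) = space recS"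
    using record_law_simps[OF a] by (intro sets_eq_imp_space_eq) simp
  have "(\<integral>p. h p \<partial>record_law S a) = enn2real (\<integral>\<^sup>+p. h p \<partial>record_law S a)"
    using h0 record_law_simps[OF a] sp
    by (intro integral_eq_nn_integral AE_I2) (auto cong: measurable_cong_sets)
  also have "(\<integral>\<^sup>+p. h p \<partial>record_law S a) = (\<integral>\<^sup>+t. \<integral>\<^sup>+p. h p \<partial>distr (measure_pmf (bernoulli_pmf (psi S a t))) recS (Pair t) \<partial>Duser S)"
    unfolding record_law_def
    using measurable_prob_algebraD[OF label_kernel'[OF a]]
    by (intro nn_integral_bind[where B=recS]) (auto cong: measurable_cong_sets)
  also have "\<dots> = (\<integral>\<^sup>+t. ennreal (psi S a t * h (t, True) + (1 - psi S a t) * h (t, False)) \<partial>Duser S)"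
  proof (rule nn_integral_cong)
    fix t assume "t \<in> space (Duser S)"
    then have t: "t \<in> space (taskS S)" by simp
    have h0': "0 \<le> h (t, y)" for y using h0 t by (simp add: space_pair_measure)
    have "(\<integral>\<^sup>+p. h p \<partial>distr (measure_pmf (bernoulli_pmf (psi S a t))) recS (Pair t))
      = (\<integral>\<^sup>+y. h (t, y) \<partial>measure_pmf (bernoulli_pmf (psi S a t)))"
      using t by (subst nn_integral_distr) (auto simp: space_pair_measure)
    also have "\<dots> = ennreal (psi S a t * h (t, True) + (1 - psi S a t) * h (t, False))"
      using h0' psi_bounds[OF a t]
      by (simp add: nn_integral_measure_pmf nn_integral_count_space_finite UNIV_bool add.commute
          flip: ennreal_plus ennreal_mult')
    finally show "(\<integral>\<^sup>+p. h p \<partial>distr (measure_pmf (bernoulli_pmf (psi S a t))) recS (Pair t)) = \<dots>" .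
  qed
  also have "enn2real \<dots> = (\<integral>t. psi S a t * h (t, True) + (1 - psi S a t) * h (t, False) \<partial>Duser S)"
    using a h0 psi_bounds[OF a]
    by (intro integral_eq_nn_integral[symmetric] AE_I2)
       (auto simp: space_pair_measure intro!: add_nonneg_nonneg mult_nonneg_nonneg)
  finally show ?thesis .
qed

text \<open>Compare both measures on boxes. Given the tasks, the labels contribute a product whose
  \<open>j\<close>-th factor depends on \<open>t j\<close> only, and the integral of such a product
  over i.i.d. tasks factors.\<close>

lemma ref_records_eq:
  assumes a: "a \<in> space (agentS S)"
  shows "ref_records S a = (\<Pi>\<^sub>M j\<in>{..<nR S}. record_law S a)"
proof -
  interpret R: prob_space "record_law S a" by (rule record_law_simps[OF a])
  interpret RP: product_sigma_finite "\<lambda>_::nat. record_law S a" by unfold_locales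
  interpret DP: product_sigma_finite "\<lambda>_::nat. Duser S" by unfold_locales
  let ?I = "{..<nR S}"
  let ?B = "\<lambda>t. \<Pi>\<^sub>M j\<in>?I. measure_pmf (bernoulli_pmf (psi S a (t j)))"
  let ?T = "\<Pi>\<^sub>M j\<in>?I. Duser S"
  have T: "?T \<in> space (prob_algebra (\<Pi>\<^sub>M j\<in>?I. taskS S))"
    by (auto simp: space_prob_algebra intro!: prob_space_PiM prob_Duser sets_PiM_cong)
  have K: "(\<lambda>t. distr (?B t) (recordS S) (\<lambda>y. \<lambda>j\<in>?I. (t j, y j)))
    \<in> (\<Pi>\<^sub>M j\<in>?I. taskS S) \<rightarrow>\<^sub>M prob_algebra (recordS S)"
  proof (rule measurable_distr_prob_space2)
    show "?B \<in> (\<Pi>\<^sub>M j\<in>?I. taskS S) \<rightarrow>\<^sub>M prob_algebra (\<Pi>\<^sub>M j\<in>?I. count_space UNIV)"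
    proof (rule PiM_kernel)
      fix j assume j: "j \<in> ?I"
      show "(\<lambda>t. measure_pmf (bernoulli_pmf (psi S a (t j)))) \<in> (\<Pi>\<^sub>M j\<in>?I. taskS S) \<rightarrow>\<^sub>M prob_algebra (count_space UNIV)"
        using j a psi_bounds[OF a] by (intro bernoulli_kernel) (auto simp: space_PiM)
    qed auto
    show "(\<lambda>(t, y). \<lambda>j\<in>?I. (t j, y j)) \<in> (\<Pi>\<^sub>M j\<in>?I. taskS S) \<Otimes>\<^sub>M (\<Pi>\<^sub>M j\<in>?I. count_space UNIV) \<rightarrow>\<^sub>M recordS S"
      unfolding recordS_def case_prod_beta' by measurable
  qed
  have sets: "sets (ref_records S a) = sets (recordS S)"
    unfolding ref_records_def
    using measurable_space[OF K] T prob_space.not_empty[of ?T]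
    by (intro sets_bind) (auto simp: space_prob_algebra dest!: sets_eq_imp_space_eq)
  have setsR: "sets (recordS S) = sets (\<Pi>\<^sub>M j\<in>?I. record_law S a)"
    unfolding recordS_def using record_law_simps[OF a] by (intro sets_PiM_cong) auto
  show ?thesis
  proof (rule RP.PiM_eqI)
    show "sets (ref_records S a) = sets (\<Pi>\<^sub>M j\<in>?I. record_law S a)"
      using sets setsR by simp
    fix A assume "\<And>j. j \<in> ?I \<Longrightarrow> A j \<in> sets (record_law S a)"
    then have A: "\<And>j. j \<in> ?I \<Longrightarrow> A j \<in> sets recS"
      using record_law_simps[OF a] by simp
    then have PA: "Pi\<^sub>E ?I A \<in> sets (recordS S)" unfolding recordS_def by (intro sets_PiM_I_finite) auto
    let ?f = "\<lambda>j t. emeasure (distr (measure_pmf (bernoulli_pmf (psi S a t))) recS (Pair t)) (A j)"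
    have "emeasure (ref_records S a) (Pi\<^sub>E ?I A)
      = (\<integral>\<^sup>+t. emeasure (distr (?B t) (recordS S) (\<lambda>y. \<lambda>j\<in>?I. (t j, y j))) (Pi\<^sub>E ?I A) \<partial>?T)"
      unfolding ref_records_def by (rule emeasure_bind_prob_algebra[OF T K PA])
    also have "\<dots> = (\<integral>\<^sup>+t. (\<Prod>j\<in>?I. ?f j (t j)) \<partial>?T)"
    proof (rule nn_integral_cong)
      fix t assume "t \<in> space ?T"
      then have t: "t j \<in> space (taskS S)" if "j \<in> ?I" for j using that by (auto simp: space_PiM)
      have m: "(\<lambda>y. \<lambda>j\<in>?I. (t j, y j)) \<in> ?B t \<rightarrow>\<^sub>M recordS S"
        unfolding recordS_def using t
        by (intro measurable_restrict measurable_Pair) auto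
      have "emeasure (distr (?B t) (recordS S) (\<lambda>y. \<lambda>j\<in>?I. (t j, y j))) (Pi\<^sub>E ?I A)
        = emeasure (?B t) ((\<lambda>y. \<lambda>j\<in>?I. (t j, y j)) -` Pi\<^sub>E ?I A \<inter> space (?B t))"
        by (rule emeasure_distr[OF m PA])
      also have "(\<lambda>y. \<lambda>j\<in>?I. (t j, y j)) -` Pi\<^sub>E ?I A \<inter> space (?B t) = Pi\<^sub>E ?I (\<lambda>j. Pair (t j) -` A j)"
        by (auto simp: space_PiM PiE_iff)
      also have "emeasure (?B t) \<dots> = (\<Prod>j\<in>?I. emeasure (measure_pmf (bernoulli_pmf (psi S a (t j)))) (Pair (t j) -` A j))"
        by (rule emeasure_PiM_prob_space) (auto simp: measure_pmf.prob_space_axioms)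
      also have "\<dots> = (\<Prod>j\<in>?I. ?f j (t j))"
        using A t by (intro prod.cong refl) (subst emeasure_distr, auto simp: space_pair_measure)
      finally show "emeasure (distr (?B t) (recordS S) (\<lambda>y. \<lambda>j\<in>?I. (t j, y j))) (Pi\<^sub>E ?I A) = \<dots>" .
    qed
    also have "\<dots> = (\<Prod>j\<in>?I. \<integral>\<^sup>+t. ?f j t \<partial>Duser S)"
      using A measurable_prob_algebraD[OF label_kernel'[OF a]]
      by (intro DP.product_nn_integral_prod)
         (auto intro!: measurable_emeasure_kernel cong: measurable_cong_sets)
    also have "\<dots> = (\<Prod>j\<in>?I. emeasure (record_law S a) (A j))"
      using A by (intro prod.cong refl) (simp add: emeasure_record_law[OF a])
    finally show "emeasure (ref_records S a) (Pi\<^sub>E ?I A) = (\<Prod>j\<in>?I. emeasure (record_law S a) (A j))" .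
  qed auto
qed

text \<open>The summand may depend on \<open>info\<close>, hence on the candidate. Under the
  reference law and given \<open>info\<close>, the records are i.i.d., so every section obeys
  Hoeffding's inequality with the reduced risk; returning to the true law costs at most what was
  taken off \<beta>.\<close>

lemma stored_concentration:
  assumes stored: "stored_condition S"
    and h: "h \<in> borel_measurable (infoS S \<Otimes>\<^sub>M recS)"
    and h01: "\<And>g p. g \<in> space (infoS S) \<Longrightarrow> p \<in> space recS \<Longrightarrow> 0 \<le> h (g, p) \<and> h (g, p) \<le> 1"
    and \<beta>: "2 * real (nR S) * beta_mix S (gap S) < \<beta>" "\<beta> \<le> 1"
  defines "bad \<equiv> {\<omega> \<in> space (Pr S).
      hoeffding_radius (\<beta> - 2 * real (nR S) * beta_mix S (gap S)) (nR S)
      < \<bar>(\<Sum>j<nR S. h (info S \<omega>, (srec_task S j \<omega>, srec_lab S j \<omega>))) / real (nR S)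
          - (\<integral>p. h (info S \<omega>, p) \<partial>record_law S (cur S \<omega>))\<bar>}"
  shows "bad \<in> sets (Pr S)" and "measure (Pr S) bad \<le> \<beta>"
proof -
  note h[measurable]
  let ?\<gamma> = "\<beta> - 2 * real (nR S) * beta_mix S (gap S)"
  let ?I = "{..<nR S}"
  obtain P0 where P0: "prob_space P0" and s0: "sets P0 = sets (infoS S \<Otimes>\<^sub>M recordS S)"
    and rect: "\<forall>C\<in>sets (infoS S). \<forall>R\<in>sets (recordS S).
        emeasure P0 (C \<times> R)
        = (\<integral>\<^sup>+g\<in>C. emeasure (ref_records S (fst g)) R \<partial>distr P0 (infoS S) fst)"
    and tv: "total_variation
        (distr (Pr S) (infoS S \<Otimes>\<^sub>M recordS S) (\<lambda>\<omega>. (info S \<omega>, records S \<omega>))) P0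
        \<le> 2 * real (nR S) * beta_mix S (gap S)"
    using stored unfolding stored_condition_def by blast
  interpret P0: prob_space P0 by fact
  let ?Q = "distr (Pr S) (infoS S \<Otimes>\<^sub>M recordS S) (\<lambda>\<omega>. (info S \<omega>, records S \<omega>))"
  interpret Q: prob_space ?Q by (rule P.prob_space_distr) measurable
  \<comment> \<open>Positive by the assumption on \<beta>, and at most 2 because the mixing
    coefficient is nonnegative.\<close>
  have \<gamma>: "0 < ?\<gamma>" "?\<gamma> \<le> 2"
    using \<beta> mult_nonneg_nonneg[OF _ beta_mix_nonneg, of "2 * real (nR S)" S "gap S"] by auto
  have fst_info: "fst \<in> infoS S \<rightarrow>\<^sub>M agentS S" unfolding infoS_def by simp
  \<comment> \<open>The bad event as a set of values of \<open>info\<close> and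
    \<open>records\<close>, so that the true and the reference law can both measure it.\<close>
  let ?B = "{x \<in> space (infoS S \<Otimes>\<^sub>M recordS S). hoeffding_radius ?\<gamma> (nR S) <
    \<bar>(\<Sum>j<nR S. h (fst x, snd x j)) / real (nR S) - (\<integral>p. h (fst x, p) \<partial>record_law S (fst (fst x)))\<bar>}"
  have [measurable]: "(\<lambda>x. \<integral>p. h (fst x, p) \<partial>record_law S (fst (fst x))) \<in> borel_measurable (infoS S \<Otimes>\<^sub>M recordS S)"
  proof (rule kernel_integral_measurable)
    show "(\<lambda>(x, p). h (fst x, p)) \<in> borel_measurable ((infoS S \<Otimes>\<^sub>M recordS S) \<Otimes>\<^sub>M recS)"
      by measurable
    show "(\<lambda>x. record_law S (fst (fst x))) \<in> infoS S \<Otimes>\<^sub>M recordS S \<rightarrow>\<^sub>M prob_algebra recS"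
      by (intro record_law_kernel measurable_compose[OF measurable_fst fst_info])
  qed
  have [measurable]: "(\<lambda>x. h (fst x, snd x j)) \<in> borel_measurable (infoS S \<Otimes>\<^sub>M recordS S)" if "j < nR S" for j
  proof -
    have "(\<lambda>x. snd x j) \<in> infoS S \<Otimes>\<^sub>M recordS S \<rightarrow>\<^sub>M recS"
      using that unfolding recordS_def by (intro measurable_compose[OF measurable_snd]) auto
    then have "(\<lambda>x. (fst x, snd x j)) \<in> infoS S \<Otimes>\<^sub>M recordS S \<rightarrow>\<^sub>M infoS S \<Otimes>\<^sub>M recS" by measurable
    from measurable_compose[OF this h] show ?thesis .
  qed
  have sum_m[measurable]: "(\<lambda>x. \<Sum>j<nR S. h (fst x, snd x j)) \<in> borel_measurable (infoS S \<Otimes>\<^sub>M recordS S)"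
    by (intro borel_measurable_sum) auto
  have B: "?B \<in> sets (infoS S \<Otimes>\<^sub>M recordS S)"
    by measurable
  have bad_eq: "bad = (\<lambda>\<omega>. (info S \<omega>, records S \<omega>)) -` ?B \<inter> space (Pr S)"
  proof -
    have "(\<lambda>\<omega>. (info S \<omega>, records S \<omega>)) \<in> Pr S \<rightarrow>\<^sub>M infoS S \<Otimes>\<^sub>M recordS S" by measurable
    from measurable_space[OF this]
    have "(info S \<omega>, records S \<omega>) \<in> space (infoS S \<Otimes>\<^sub>M recordS S)" if "\<omega> \<in> space (Pr S)" for \<omega>
      using that .
    moreover have "fst (info S \<omega>) = cur S \<omega>" for \<omega> by (simp add: info_def)
    moreover have "(\<Sum>j<nR S. h (info S \<omega>, records S \<omega> j)) = (\<Sum>j<nR S. h (info S \<omega>, (srec_task S j \<omega>, srec_lab S j \<omega>)))" for \<omega>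
      by (simp add: records_def)
    ultimately show ?thesis unfolding bad_def by auto
  qed
  show "bad \<in> sets (Pr S)" unfolding bad_eq using B by measurable
  have "emeasure P0 ?B \<le> ennreal ?\<gamma>"
  proof (rule emeasure_le_of_sections[where K="\<lambda>g. ref_records S (fst g)" and X="infoS S" and Y="recordS S"
        and \<mu>="distr P0 (infoS S) fst" and G="sets (recordS S)"])
    have fst0: "fst \<in> P0 \<rightarrow>\<^sub>M infoS S" using s0 by (simp cong: measurable_cong_sets)
    have "(\<lambda>g. \<Pi>\<^sub>M j\<in>?I. record_law S (fst g)) \<in> infoS S \<rightarrow>\<^sub>M prob_algebra (recordS S)"
      unfolding recordS_def by (intro PiM_kernel record_law_kernel fst_info) auto
    then show "(\<lambda>g. ref_records S (fst g)) \<in> infoS S \<rightarrow>\<^sub>M prob_algebra (recordS S)"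
      by (rule measurable_cong[THEN iffD1, rotated])
         (use measurable_space[OF fst_info] in \<open>auto simp: ref_records_eq\<close>)
    show "emeasure (distr P0 (infoS S) fst) (space (distr P0 (infoS S) fst)) \<le> 1"
      using prob_space.emeasure_space_1[OF P0.prob_space_distr[OF fst0]] by (rule order.eq_iff[THEN iffD1, THEN conjunct1])
    show "space (infoS S) \<noteq> {}"
      using P.not_empty measurable_space[OF info_measurable] by auto
    show "Int_stable (sets (recordS S))" by (rule sets.Int_stable)
    show "sets (recordS S) = sigma_sets (space (recordS S)) (sets (recordS S))"
      by (simp add: sets.sigma_sets_eq)
    show "emeasure P0 (C \<times> R) = (\<integral>\<^sup>+g\<in>C. emeasure (ref_records S (fst g)) R \<partial>distr P0 (infoS S) fst)"
      if "C \<in> sets (infoS S)" "R \<in> sets (recordS S)" for C R using rect that by blast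
    fix g assume g: "g \<in> space (infoS S)"
    then have a: "fst g \<in> space (agentS S)" using measurable_space[OF fst_info] by auto
    interpret R: prob_space "record_law S (fst g)" by (rule record_law_simps[OF a])
    have spR: "space (record_law S (fst g)) = space recS"
      using record_law_simps[OF a] by (intro sets_eq_imp_space_eq) simp
    let ?M = "\<Pi>\<^sub>M j\<in>?I. record_law S (fst g)"
    interpret M: prob_space ?M by (rule prob_space_PiM) (rule R.prob_space_axioms)
    have hg: "(\<lambda>p. h (g, p)) \<in> borel_measurable (record_law S (fst g))"
      using measurable_Pair2[OF h g] record_law_simps[OF a] by (simp cong: measurable_cong_sets)
    have spM: "space ?M = space (recordS S)"
      unfolding recordS_def using record_law_simps[OF a] by (intro sets_eq_imp_space_eq sets_PiM_cong) auto
    have "Pair g -` ?B = {x \<in> space ?M. hoeffding_radius ?\<gamma> (nR S)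
      < \<bar>(\<Sum>j<nR S. h (g, x j)) / real (nR S) - (\<integral>p. h (g, p) \<partial>record_law S (fst g))\<bar>}"
      using g spM by (auto simp: space_pair_measure)
    then show "emeasure (ref_records S (fst g)) (Pair g -` ?B) \<le> ennreal ?\<gamma>"
      using hoeffding_mean[OF R.prob_space_axioms hg _ sizes_pos(2) \<gamma>] h01[OF g] spR
      by (simp add: ref_records_eq[OF a] M.emeasure_eq_measure ennreal_leI)
  qed (use s0 B in auto)
  then have p0: "measure P0 ?B \<le> ?\<gamma>"
    using \<gamma> by (simp add: P0.emeasure_eq_measure)
  have "measure (Pr S) bad = measure ?Q ?B"
    unfolding bad_eq by (rule measure_distr[symmetric]) (use B in measurable)
  also have "\<dots> \<le> measure P0 ?B + \<bar>measure ?Q ?B - measure P0 ?B\<bar>" by simp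
  \<comment> \<open>\<open>total_variation\<close> is a real supremum, so the family must be seen to
    be bounded: differences of probabilities are at most 1.\<close>
  also have "\<bar>measure ?Q ?B - measure P0 ?B\<bar> \<le> total_variation ?Q P0"
    unfolding total_variation_def
  proof (rule cSUP_upper)
    show "?B \<in> sets ?Q" using B by simp
    show "bdd_above ((\<lambda>B. \<bar>measure ?Q B - measure P0 B\<bar>) ` sets ?Q)"
    proof (intro bdd_aboveI2[where M=1])
      fix B
      show "\<bar>measure ?Q B - measure P0 B\<bar> \<le> 1"
        using Q.prob_le_1[of B] P0.prob_le_1[of B] measure_nonneg[of ?Q B] measure_nonneg[of P0 B]
        by linarith
    qed
  qed
  finally show "measure (Pr S) bad \<le> \<beta>" using p0 tv by simp
qed

end

section \<open>Rollouts at frozen agents and tasks\<close>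

locale protocol_step = evaluation_step S for S :: "('w, 't, 'o, 'a, 'c, 'u) step" +
  assumes protocol: "one_candidate_protocol S"
begin

lemma pre_window_measurable:
  assumes "f \<in> pre_window S \<rightarrow>\<^sub>M M"
  shows "f \<in> Pr S \<rightarrow>\<^sub>M M"
proof (rule measurable_from_subalg[OF _ assms])
  have m: "(\<lambda>\<omega>. (info S \<omega>, records S \<omega>)) \<in> Pr S \<rightarrow>\<^sub>M infoS S \<Otimes>\<^sub>M recordS S" by measurable
  show "subalgebra (Pr S) (pre_window S)"
    unfolding subalgebra_def pre_window_def
    using sets_image_in_sets[OF refl m] by simp
qed

lemma win_start_measurable [measurable]: "win_start S \<in> Pr S \<rightarrow>\<^sub>M count_space UNIV"
  and win_len_measurable [measurable]: "win_len S \<in> Pr S \<rightarrow>\<^sub>M count_space UNIV"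
  and epsF_measurable [measurable]: "epsF S \<in> borel_measurable (Pr S)"
  using protocol by (auto simp: one_candidate_protocol_def intro: pre_window_measurable)

lemma win_idx_measurable [measurable]: "win_idx S i \<in> Pr S \<rightarrow>\<^sub>M count_space UNIV"
proof -
  have "(\<lambda>\<omega>. pick S s (win_len S \<omega>) i \<omega>) \<in> Pr S \<rightarrow>\<^sub>M count_space UNIV" for s
    by (rule measurable_compose_countable[OF pick_measurable win_len_measurable])
  from measurable_compose_countable[OF this win_start_measurable] show ?thesis
    by (simp add: win_idx_def[abs_def])
qed

lemma batch_measurable [measurable]: "batch S i \<in> Pr S \<rightarrow>\<^sub>M taskS S"
  unfolding batch_def[abs_def] by (rule task_at_measurable) measurable

lemma RetF_sets [measurable]: "RetF S \<in> sets (Pr S)"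
proof -
  have "(\<lambda>\<omega>. marked S s (win_len S \<omega>) \<omega>) \<in> Pr S \<rightarrow>\<^sub>M count_space UNIV" for s
    by (rule measurable_compose_countable[OF marked_measurable win_len_measurable])
  from measurable_compose_countable[OF this win_start_measurable]
  have [measurable]: "(\<lambda>\<omega>. marked S (win_start S \<omega>) (win_len S \<omega>) \<omega>) \<in> Pr S \<rightarrow>\<^sub>M count_space UNIV" .
  show ?thesis unfolding RetF_def by measurable
qed

lemma Ready_sets [measurable]: "Ready S \<in> sets (Pr S)"
  unfolding Ready_def by measurable

lemma frozen_measurable [measurable]: "frozen S \<in> Pr S \<rightarrow>\<^sub>M frozenS S"
proof -
  have "(\<lambda>\<omega>. \<lambda>i\<in>{..<nF S}. batch S i \<omega>) \<in> Pr S \<rightarrow>\<^sub>M materialS S"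
    unfolding materialS_def by (intro measurable_restrict) measurable
  then show ?thesis unfolding frozen_def[abs_def] frozenS_def by measurable
qed

text \<open>The set \<open>evaluated S \<omega>\<close> varies with the stored labels; the union
  bound needs a fixed finite index set that contains it on every path.\<close>

definition eval_idx :: "(nat + nat) set" where
  "eval_idx = Inl ` {..<nF S} \<union> Inr ` {..<nR S}"

lemma evaluated_subset: "evaluated S \<omega> \<subseteq> eval_idx"
  by (auto simp: evaluated_def eval_idx_def SR_def)

lemma eval_task_measurable:
  "e \<in> eval_idx \<Longrightarrow> eval_task S e \<in> Pr S \<rightarrow>\<^sub>M taskS S"
  by (auto simp: eval_idx_def eval_task_def[abs_def] srec_task_measurable)

lemma eval_agent_measurable [measurable]: "eval_agent S b \<in> Pr S \<rightarrow>\<^sub>M agentS S"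
  by (cases b) (simp_all add: eval_agent_def[abs_def])

lemma evaluated_measurable [measurable]: "Measurable.pred (Pr S) (\<lambda>\<omega>. e \<in> evaluated S \<omega>)"
proof (cases e)
  case (Inl i)
  then have "(\<lambda>\<omega>. e \<in> evaluated S \<omega>) = (\<lambda>\<omega>. i < nF S)" by (auto simp: evaluated_def)
  then show ?thesis by simp
next
  case (Inr j)
  then have "(\<lambda>\<omega>. e \<in> evaluated S \<omega>) = (\<lambda>\<omega>. j \<in> SR S \<omega>)" by (auto simp: evaluated_def)
  then show ?thesis by simp
qed

definition frozen_agent :: "bool \<Rightarrow> 'a \<times> 'a \<times> (nat \<Rightarrow> 't) \<times> (nat \<Rightarrow> 't \<times> bool) \<Rightarrow> 'a" where
  "frozen_agent b g = (if b then fst (snd g) else fst g)"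

definition frozen_task :: "nat + nat \<Rightarrow> 'a \<times> 'a \<times> (nat \<Rightarrow> 't) \<times> (nat \<Rightarrow> 't \<times> bool) \<Rightarrow> 't" where
  "frozen_task e g = (case e of Inl i \<Rightarrow> fst (snd (snd g)) i | Inr j \<Rightarrow> fst (snd (snd (snd g)) j))"

lemma frozen_agent_measurable [measurable]: "frozen_agent b \<in> frozenS S \<rightarrow>\<^sub>M agentS S"
  by (cases b) (simp_all add: frozen_agent_def[abs_def] frozenS_def)

lemma frozen_task_measurable: "e \<in> eval_idx \<Longrightarrow> frozen_task e \<in> frozenS S \<rightarrow>\<^sub>M taskS S"
  unfolding frozen_task_def[abs_def] eval_idx_def frozenS_def materialS_def recordS_def
  by (auto intro!: measurable_compose[OF measurable_snd] measurable_compose[OF _ measurable_fst])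

lemma frozen_simps:
  "frozen_agent b (frozen S \<omega>) = eval_agent S b \<omega>"
  "e \<in> eval_idx \<Longrightarrow> frozen_task e (frozen S \<omega>) = eval_task S e \<omega>"
  by (auto simp: frozen_agent_def frozen_task_def frozen_def eval_agent_def eval_task_def eval_idx_def records_def)

text \<open>Confined to paths on which \<open>e\<close> is evaluated, because the law of the
  rollouts is prescribed only there.\<close>

definition rollout_dev :: "bool \<Rightarrow> nat + nat \<Rightarrow> 'w set" where
  "rollout_dev b e = {\<omega> \<in> Cand S \<inter> Ready S. e \<in> evaluated S \<omega> \<and>
     epsV S < \<bar>Vhat S b e \<omega> - val S (eval_agent S b \<omega>) (eval_task S e \<omega>)\<bar>}"

lemma rollout_rew_measurable:
  assumes "e \<in> eval_idx"
  shows "(\<lambda>\<omega>. rew S (eval_task S e \<omega>) (roll S b e l \<omega>)) \<in> borel_measurable (Pr S)"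
proof -
  note [measurable] = eval_task_measurable[OF assms]
  have "(\<lambda>\<omega>. (eval_task S e \<omega>, roll S b e l \<omega>)) \<in> Pr S \<rightarrow>\<^sub>M taskS S \<Otimes>\<^sub>M outS S" by measurable
  from measurable_compose[OF this rew_measurable] show ?thesis by simp
qed

lemma Vhat_measurable:
  assumes "e \<in> eval_idx"
  shows "Vhat S b e \<in> borel_measurable (Pr S)"
  unfolding Vhat_def[abs_def]
  by (intro borel_measurable_divide borel_measurable_sum rollout_rew_measurable[OF assms]) auto

lemma rollout_dev_sets:
  assumes "e \<in> eval_idx"
  shows "rollout_dev b e \<in> sets (Pr S)"
proof -
  note [measurable] = eval_task_measurable[OF assms] Vhat_measurable[OF assms]
  have "rollout_dev b e = (Cand S \<inter> Ready S) \<inter> {\<omega> \<in> space (Pr S). e \<in> evaluated S \<omega> \<and>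
     epsV S < \<bar>Vhat S b e \<omega> - val S (eval_agent S b \<omega>) (eval_task S e \<omega>)\<bar>}"
    unfolding rollout_dev_def Cand_def by blast
  also have "\<dots> \<in> sets (Pr S)" by measurable
  finally show ?thesis .
qed

lemma rollout_concentration:
  assumes e: "e \<in> eval_idx"
  shows "measure (Pr S) (rollout_dev b e) \<le> betaV S"
proof -
  note [measurable] = eval_task_measurable[OF e] frozen_task_measurable[OF e]
  let ?I = "{..<nroll S}"
  let ?Y = "\<Pi>\<^sub>M l\<in>?I. outS S"
  define E where "E = {\<omega> \<in> Cand S \<inter> Ready S. e \<in> evaluated S \<omega>}"
  have "E = (Cand S \<inter> Ready S) \<inter> {\<omega> \<in> space (Pr S). e \<in> evaluated S \<omega>}"
    unfolding E_def Cand_def by blast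
  then have E[measurable]: "E \<in> sets (Pr S)" by simp
  define rolls where "rolls = (\<lambda>\<omega>. \<lambda>l\<in>?I. roll S b e l \<omega>)"
  have rolls[measurable]: "rolls \<in> Pr S \<rightarrow>\<^sub>M ?Y" unfolding rolls_def by (intro measurable_restrict) measurable
  let ?PE = "density (Pr S) (indicator E)"
  let ?\<mu> = "distr ?PE (frozenS S) (frozen S)"
  let ?Q = "distr ?PE (frozenS S \<Otimes>\<^sub>M ?Y) (\<lambda>\<omega>. (frozen S \<omega>, rolls \<omega>))"
  let ?k = "\<lambda>b g. runK S (frozen_agent b g) (frozen_task e g)"
  let ?K = "\<lambda>g. \<Pi>\<^sub>M l\<in>?I. ?k b g"
  have k[measurable]: "?k b' \<in> frozenS S \<rightarrow>\<^sub>M prob_algebra (outS S)" for b'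
  proof -
    have "(\<lambda>g. (frozen_agent b' g, frozen_task e g)) \<in> frozenS S \<rightarrow>\<^sub>M agentS S \<Otimes>\<^sub>M taskS S" by measurable
    from measurable_compose[OF this runK_kernel] show ?thesis by simp
  qed
  have k_simps: "prob_space (?k b' g)" "sets (?k b' g) = sets (outS S)" "space (?k b' g) = space (outS S)"
    if "g \<in> space (frozenS S)" for b' g
    using runK_simps[OF measurable_space[OF frozen_agent_measurable that]
        measurable_space[OF frozen_task_measurable[OF e] that]] by auto
  let ?B = "{x \<in> space (frozenS S \<Otimes>\<^sub>M ?Y). hoeffding_radius (betaV S) (nroll S) <
    \<bar>(\<Sum>l<nroll S. rew S (frozen_task e (fst x)) (snd x l)) / real (nroll S)
      - val S (frozen_agent b (fst x)) (frozen_task e (fst x))\<bar>}"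
  have [measurable]: "(\<lambda>x. rew S (frozen_task e (fst x)) (snd x l)) \<in> borel_measurable (frozenS S \<Otimes>\<^sub>M ?Y)"
    if "l < nroll S" for l
  proof -
    have "(\<lambda>x. (frozen_task e (fst x), snd x l)) \<in> frozenS S \<Otimes>\<^sub>M ?Y \<rightarrow>\<^sub>M taskS S \<Otimes>\<^sub>M outS S"
      using that
      by (intro measurable_Pair measurable_compose[OF measurable_fst frozen_task_measurable[OF e]]
          measurable_compose[OF measurable_snd measurable_component_singleton]) auto
    from measurable_compose[OF this rew_measurable] show ?thesis by simp
  qed
  have [measurable]: "(\<lambda>x. \<Sum>l<nroll S. rew S (frozen_task e (fst x)) (snd x l)) \<in> borel_measurable (frozenS S \<Otimes>\<^sub>M ?Y)"
    by (intro borel_measurable_sum) auto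
  have B: "?B \<in> sets (frozenS S \<Otimes>\<^sub>M ?Y)" by measurable
  have fresh: "measure (Pr S) {\<omega> \<in> E. frozen S \<omega> \<in> C \<and> (\<forall>b. \<forall>l<nroll S. roll S b e l \<omega> \<in> R b l)}
      = (\<integral>\<omega>. indicator (E \<inter> (frozen S -` C \<inter> space (Pr S))) \<omega> * (\<Prod>b\<in>UNIV. \<Prod>l<nroll S.
              measure (?k b (frozen S \<omega>)) (R b l)) \<partial>Pr S)"
    if "C \<in> sets (frozenS S)" "\<And>b l. R b l \<in> sets (outS S)" for C and R :: "bool \<Rightarrow> nat \<Rightarrow> 'o set"
  proof -
    let ?E = "{\<omega> \<in> Cand S \<inter> Ready S. e \<in> evaluated S \<omega> \<and> frozen S \<omega> \<in> C}"
    have E_eq: "?E = E \<inter> (frozen S -` C \<inter> space (Pr S))"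
      by (auto simp: E_def Cand_def)
    have "fresh_rollouts S (frozen S) (frozenS S)"
      using protocol by (simp add: one_candidate_protocol_def)
    then have "measure (Pr S) {\<omega> \<in> ?E. \<forall>b. \<forall>l<nroll S. roll S b e l \<omega> \<in> R b l}
        = (\<integral>\<omega>. indicator ?E \<omega> * (\<Prod>b\<in>UNIV. \<Prod>l<nroll S.
              measure (runK S (eval_agent S b \<omega>) (eval_task S e \<omega>)) (R b l)) \<partial>Pr S)"
      unfolding fresh_rollouts_def Let_def using that by blast
    moreover have "{\<omega> \<in> E. frozen S \<omega> \<in> C \<and> (\<forall>b. \<forall>l<nroll S. roll S b e l \<omega> \<in> R b l)}
      = {\<omega> \<in> ?E. \<forall>b. \<forall>l<nroll S. roll S b e l \<omega> \<in> R b l}"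
      by (auto simp: E_def)
    ultimately show ?thesis
      unfolding E_eq by (simp only: frozen_simps(1) frozen_simps(2)[OF e])
  qed
  \<comment> \<open>The freshness condition fixes probabilities of boxes of outputs, so boxes serve
    as the generator.\<close>
  have "emeasure ?Q ?B \<le> ennreal (betaV S)"
  proof (rule emeasure_le_of_sections[where K="?K" and X="frozenS S" and Y="?Y"
        and \<mu>="?\<mu>" and G="prod_algebra ?I (\<lambda>_. outS S)"])
    show "?K \<in> frozenS S \<rightarrow>\<^sub>M prob_algebra ?Y"
      by (intro PiM_kernel k) auto
    have "emeasure ?\<mu> (space ?\<mu>) = emeasure ?PE (space (Pr S))"
      by (subst emeasure_distr) (auto intro!: arg_cong2[where f=emeasure] dest: measurable_space[OF frozen_measurable])
    also have "\<dots> = emeasure (Pr S) (E \<inter> space (Pr S))"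
      by (rule emeasure_restricted) auto
    also have "\<dots> \<le> 1" by (rule P.measure_le_1)
    finally show "emeasure ?\<mu> (space ?\<mu>) \<le> 1" .
    show "space (frozenS S) \<noteq> {}"
      using P.not_empty measurable_space[OF frozen_measurable] by auto
    show "Int_stable (prod_algebra ?I (\<lambda>_. outS S))" by (rule Int_stable_prod_algebra)
    show "sets ?Y = sigma_sets (space ?Y) (prod_algebra ?I (\<lambda>_. outS S))"
      by (simp add: sets_PiM space_PiM)
    show "space ?Y \<in> prod_algebra ?I (\<lambda>_. outS S)"
      by (auto simp: prod_algebra_eq_finite space_PiM)
  next
    fix C A assume C: "C \<in> sets (frozenS S)" and "A \<in> prod_algebra ?I (\<lambda>_. outS S)"
    then obtain R where A: "A = Pi\<^sub>E ?I R" and R: "\<And>l. l \<in> ?I \<Longrightarrow> R l \<in> sets (outS S)"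
      by (auto simp: prod_algebra_eq_finite)
    note C[measurable]
    have A_sets: "A \<in> sets ?Y" unfolding A using R by (intro sets_PiM_I_finite) auto
    \<comment> \<open>The condition prescribes sets for both agents. The other agent gets the whole
      output space, whose factors are 1, so that only the group \<open>b\<close> remains.\<close>
    define R' where "R' = (\<lambda>b' l. if b' = b \<and> l < nroll S then R l else space (outS S))"
    have R': "R' b' l \<in> sets (outS S)" for b' l using R by (auto simp: R'_def)
    have "emeasure ?Q (C \<times> A) = emeasure ?PE ((\<lambda>\<omega>. (frozen S \<omega>, rolls \<omega>)) -` (C \<times> A) \<inter> space ?PE)"
      using C A_sets by (intro emeasure_distr) auto
    also have "\<dots> = emeasure (Pr S) (E \<inter> ((\<lambda>\<omega>. (frozen S \<omega>, rolls \<omega>)) -` (C \<times> A) \<inter> space (Pr S)))"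
      using C A_sets by (subst emeasure_restricted) (auto intro!: measurable_sets)
    also have "E \<inter> ((\<lambda>\<omega>. (frozen S \<omega>, rolls \<omega>)) -` (C \<times> A) \<inter> space (Pr S))
      = {\<omega> \<in> E. frozen S \<omega> \<in> C \<and> (\<forall>b. \<forall>l<nroll S. roll S b e l \<omega> \<in> R' b l)}"
      using measurable_space[OF roll_measurable]
      by (auto simp: A rolls_def R'_def E_def Cand_def PiE_iff split: if_splits)
    also have "emeasure (Pr S) \<dots> = ennreal (\<integral>\<omega>. indicator (E \<inter> (frozen S -` C \<inter> space (Pr S))) \<omega> *
         (\<Prod>b\<in>UNIV. \<Prod>l<nroll S. measure (?k b (frozen S \<omega>)) (R' b l)) \<partial>Pr S)"
      by (simp add: P.emeasure_eq_measure fresh[OF C R'])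
    also have "\<dots> = (\<integral>\<^sup>+\<omega>. ennreal (indicator (E \<inter> (frozen S -` C \<inter> space (Pr S))) \<omega> *
         (\<Prod>b\<in>UNIV. \<Prod>l<nroll S. measure (?k b (frozen S \<omega>)) (R' b l))) \<partial>Pr S)"
    proof (rule nn_integral_eq_integral[symmetric])
      have "(\<lambda>\<omega>. measure (?k b' (frozen S \<omega>)) (R' b' l)) \<in> borel_measurable (Pr S)" for b' l
        using R' by (intro measurable_compose[OF measurable_compose[OF frozen_measurable k] measurable_measure_prob_algebra])
      note [measurable] = this
      show "integrable (Pr S) (\<lambda>\<omega>. indicator (E \<inter> (frozen S -` C \<inter> space (Pr S))) \<omega> *
         (\<Prod>b\<in>UNIV. \<Prod>l<nroll S. measure (?k b (frozen S \<omega>)) (R' b l)))"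
      proof (rule P.integrable_const_bound[where B=1])
        show "(\<lambda>\<omega>. indicator (E \<inter> (frozen S -` C \<inter> space (Pr S))) \<omega> *
         (\<Prod>b\<in>UNIV. \<Prod>l<nroll S. measure (?k b (frozen S \<omega>)) (R' b l))) \<in> borel_measurable (Pr S)"
          by measurable
        show "AE \<omega> in Pr S. norm (indicator (E \<inter> (frozen S -` C \<inter> space (Pr S))) \<omega> *
         (\<Prod>b\<in>UNIV. \<Prod>l<nroll S. measure (?k b (frozen S \<omega>)) (R' b l))) \<le> 1"
        proof (rule AE_I2)
          fix \<omega> assume "\<omega> \<in> space (Pr S)"
          then have g: "frozen S \<omega> \<in> space (frozenS S)" using measurable_space[OF frozen_measurable] by auto
          have "0 \<le> measure (?k b' (frozen S \<omega>)) (R' b' l) \<and> measure (?k b' (frozen S \<omega>)) (R' b' l) \<le> 1" for b' l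
            using prob_space.prob_le_1[OF k_simps(1)[OF g]] by simp
          then have "0 \<le> (\<Prod>b\<in>UNIV. \<Prod>l<nroll S. measure (?k b (frozen S \<omega>)) (R' b l)) \<and>
            (\<Prod>b\<in>UNIV. \<Prod>l<nroll S. measure (?k b (frozen S \<omega>)) (R' b l)) \<le> 1"
            by (intro conjI prod_le_1 prod_nonneg) (auto intro!: prod_le_1 prod_nonneg)
          then show "norm (indicator (E \<inter> (frozen S -` C \<inter> space (Pr S))) \<omega> *
             (\<Prod>b\<in>UNIV. \<Prod>l<nroll S. measure (?k b (frozen S \<omega>)) (R' b l))) \<le> 1"
            by (auto simp: indicator_def)
        qed
      qed
    qed (intro AE_I2 mult_nonneg_nonneg prod_nonneg; simp)
    also have "\<dots> = (\<integral>\<^sup>+\<omega>. indicator E \<omega> * (emeasure (?K (frozen S \<omega>)) A * indicator C (frozen S \<omega>)) \<partial>Pr S)"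
    proof (rule nn_integral_cong)
      fix \<omega> assume \<omega>: "\<omega> \<in> space (Pr S)"
      then have g: "frozen S \<omega> \<in> space (frozenS S)" using measurable_space[OF frozen_measurable] by auto
      interpret k: prob_space "?k b' (frozen S \<omega>)" for b' by (rule k_simps[OF g])
      have "emeasure (?K (frozen S \<omega>)) A = (\<Prod>l\<in>?I. emeasure (?k b (frozen S \<omega>)) (R l))"
        unfolding A using R k_simps[OF g] by (intro emeasure_PiM_prob_space) auto
      also have "\<dots> = ennreal (\<Prod>l<nroll S. measure (?k b (frozen S \<omega>)) (R l))"
        by (simp add: k.emeasure_eq_measure prod_ennreal)
      also have "(\<Prod>l<nroll S. measure (?k b (frozen S \<omega>)) (R l))
        = (\<Prod>b\<in>UNIV. \<Prod>l<nroll S. measure (?k b (frozen S \<omega>)) (R' b l))"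
      proof -
        have "(\<Prod>l<nroll S. measure (?k (\<not> b) (frozen S \<omega>)) (R' (\<not> b) l)) = 1"
          using k.prob_space[of "\<not> b"] k_simps(3)[OF g] by (intro prod.neutral) (simp add: R'_def)
        moreover have "(\<Prod>l<nroll S. measure (?k b (frozen S \<omega>)) (R' b l)) = (\<Prod>l<nroll S. measure (?k b (frozen S \<omega>)) (R l))"
          by (intro prod.cong) (auto simp: R'_def)
        ultimately show ?thesis by (cases b) (simp_all add: UNIV_bool mult.commute)
      qed
      finally show "ennreal (indicator (E \<inter> (frozen S -` C \<inter> space (Pr S))) \<omega> *
         (\<Prod>b\<in>UNIV. \<Prod>l<nroll S. measure (?k b (frozen S \<omega>)) (R' b l)))
        = indicator E \<omega> * (emeasure (?K (frozen S \<omega>)) A * indicator C (frozen S \<omega>))"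
        using \<omega> by (auto simp: indicator_def)
    qed
    also have "\<dots> = (\<integral>\<^sup>+g\<in>C. emeasure (?K g) A \<partial>?\<mu>)"
    proof -
      have KA[measurable]: "(\<lambda>g. emeasure (?K g) A) \<in> borel_measurable (frozenS S)"
        by (rule measurable_emeasure_kernel[OF measurable_prob_algebraD A_sets]) (intro PiM_kernel k, auto)
      have "(\<integral>\<^sup>+g\<in>C. emeasure (?K g) A \<partial>?\<mu>) = (\<integral>\<^sup>+\<omega>. emeasure (?K (frozen S \<omega>)) A * indicator C (frozen S \<omega>) \<partial>?PE)"
        by (rule nn_integral_distr) measurable
      also have "\<dots> = (\<integral>\<^sup>+\<omega>. indicator E \<omega> * (emeasure (?K (frozen S \<omega>)) A * indicator C (frozen S \<omega>)) \<partial>Pr S)"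
        by (rule nn_integral_density) (use measurable_compose[OF frozen_measurable KA] in measurable)
      finally show ?thesis by simp
    qed
    finally show "emeasure ?Q (C \<times> A) = (\<integral>\<^sup>+g\<in>C. emeasure (?K g) A \<partial>?\<mu>)" .
  next
    fix g assume g: "g \<in> space (frozenS S)"
    interpret k: prob_space "?k b g" by (rule k_simps[OF g])
    interpret M: prob_space "?K g" by (rule prob_space_PiM) (rule k.prob_space_axioms)
    have ag: "frozen_agent b g \<in> space (agentS S)" using measurable_space[OF frozen_agent_measurable g] .
    have tk: "frozen_task e g \<in> space (taskS S)" using measurable_space[OF frozen_task_measurable[OF e] g] .
    have spM: "space (?K g) = space ?Y"
      using k_simps[OF g] by (intro sets_eq_imp_space_eq sets_PiM_cong) auto
    have "Pair g -` ?B = {x \<in> space (?K g). hoeffding_radius (betaV S) (nroll S)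
      < \<bar>(\<Sum>l<nroll S. rew S (frozen_task e g) (x l)) / real (nroll S)
          - (\<integral>x. rew S (frozen_task e g) x \<partial>?k b g)\<bar>}"
      using g spM by (auto simp: space_pair_measure val_def)
    then show "emeasure (?K g) (Pair g -` ?B) \<le> ennreal (betaV S)"
      using hoeffding_mean[OF k.prob_space_axioms rew_section_measurable(1)[OF ag tk] _ sizes_pos(3) risks(1)]
        risks(2) rew_bounds[OF tk] k_simps(3)[OF g, of b]
      by (simp add: M.emeasure_eq_measure ennreal_leI)
  qed (use B in auto)
  moreover have "emeasure ?Q ?B = emeasure (Pr S) (rollout_dev b e)"
  proof -
    have m: "(\<lambda>\<omega>. (frozen S \<omega>, rolls \<omega>)) \<in> Pr S \<rightarrow>\<^sub>M frozenS S \<Otimes>\<^sub>M ?Y" by measurable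
    have "emeasure ?Q ?B = emeasure ?PE ((\<lambda>\<omega>. (frozen S \<omega>, rolls \<omega>)) -` ?B \<inter> space ?PE)"
      using m B by (intro emeasure_distr) auto
    also have "\<dots> = emeasure (Pr S) (E \<inter> ((\<lambda>\<omega>. (frozen S \<omega>, rolls \<omega>)) -` ?B \<inter> space (Pr S)))"
      using measurable_sets[OF m B] by (subst emeasure_restricted) auto
    also have "E \<inter> ((\<lambda>\<omega>. (frozen S \<omega>, rolls \<omega>)) -` ?B \<inter> space (Pr S)) = rollout_dev b e"
    proof -
      have "(\<Sum>l<nroll S. rew S t (rolls \<omega> l)) = (\<Sum>l<nroll S. rew S t (roll S b e l \<omega>))" for t \<omega>
        by (simp add: rolls_def)
      then show ?thesis
        using measurable_space[OF m]
        by (auto simp: rollout_dev_def E_def Cand_def frozen_simps e Vhat_def hoeffding_radius_def epsV_def)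
    qed
    finally show ?thesis .
  qed
  ultimately show ?thesis
    using risks(1) by (simp add: P.emeasure_eq_measure)
qed

end

section \<open>The margin bound\<close>

text \<open>\<open>Z\<close> and \<open>Zh\<close> are the failure mass and its estimate,
  \<open>F\<close> and \<open>L\<close> the batch means of true and estimated advantages,
  \<open>W\<close> the integral of \<open>psi\<close> times the advantage. \<open>U\<close> is the
  integral of the retained loss, \<open>X\<close> its mean over all stored records and
  \<open>D\<close> the measured decrease. The failure part gives a lower bound for \<open>W\<close>
  and the retained part an upper bound for \<open>U\<close>.\<close>

lemma margin_lower_bound:
  fixes Z :: real
  assumes Z: "0 < Z" "\<bar>Zh - Z\<bar> \<le> eZ"
    and F: "\<bar>F - W / Z\<bar> \<le> eF" "\<bar>F - L\<bar> \<le> 2 * eV" "\<bar>L\<bar> \<le> 1"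
    and Zh: "0 \<le> Zh" "Zh < 1" and D: "0 \<le> D"
    and X: "X \<le> (1 - Zh) * (D + 2 * eV)" "\<bar>X - U\<bar> \<le> eR"
    and eV: "0 \<le> eV" and I: "W - U \<le> I"
  shows "Zh * L - (eZ + (Zh + eZ) * (2 * eV + eF))
    - (1 - Zh + eZ) * (D + (2 * eV + eR + eZ) / (1 - Zh)) \<le> I"
proof -
  have pos: "0 \<le> eZ" "0 \<le> eF" "0 \<le> eR" using assms by linarith+
  have "Zh * L - eZ \<le> Z * L"
  proof -
    have "(Zh - Z) * L \<le> \<bar>(Zh - Z) * L\<bar>" by simp
    also have "\<dots> = \<bar>Zh - Z\<bar> * \<bar>L\<bar>" by (rule abs_mult)
    also have "\<dots> \<le> eZ * 1" using Z F pos by (intro mult_mono) auto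
    finally show ?thesis by (simp add: algebra_simps)
  qed
  moreover have "Z * (2 * eV + eF) \<le> (Zh + eZ) * (2 * eV + eF)"
    using Z eV pos by (intro mult_right_mono) linarith+
  \<comment> \<open>The two deviations of \<open>F\<close> combine to \<open>W / Z\<close> being at
    least \<open>L - (2 * eV + eF)\<close>; the factor \<open>Z\<close> then removes the
    normalisation of the failure distribution.\<close>
  moreover have "Z * (L - (2 * eV + eF)) \<le> Z * (W / Z)"
    using Z F by (intro mult_left_mono) linarith+
  moreover have "Z * (W / Z) = W" using Z by simp
  ultimately have W: "Zh * L - (eZ + (Zh + eZ) * (2 * eV + eF)) \<le> W"
    by (simp add: algebra_simps)
  let ?d = "(2 * eV + eR + eZ) / (1 - Zh)"
  have "0 \<le> ?d" using Zh eV pos by simp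
  then have "(1 - Zh) * (D + ?d) \<le> (1 - Zh + eZ) * (D + ?d)"
    using D pos by (intro mult_right_mono) auto
  \<comment> \<open>The weight cancels the denominator of \<open>?d\<close>, so the three errors
    appear undivided and cover those in \<open>U\<close>.\<close>
  moreover have "(1 - Zh) * (D + ?d) = (1 - Zh) * D + (2 * eV + eR + eZ)"
    using Zh by (simp add: field_simps)
  moreover have "(1 - Zh) * (2 * eV) \<le> 1 * (2 * eV)"
    using Zh eV by (intro mult_right_mono) auto
  moreover have "X \<le> (1 - Zh) * D + (1 - Zh) * (2 * eV)"
    using X(1) by (simp add: distrib_left)
  ultimately have "U \<le> (1 - Zh + eZ) * (D + ?d)"
    using X(2) pos by linarith
  then show ?thesis using W I by linarith
qed

lemma abs_mean_diff_le:
  fixes f g :: "nat \<Rightarrow> real"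
  assumes "0 < n" "\<And>i. i < n \<Longrightarrow> \<bar>f i - g i\<bar> \<le> c"
  shows "\<bar>(\<Sum>i<n. f i) / real n - (\<Sum>i<n. g i) / real n\<bar> \<le> c"
proof -
  have "\<bar>\<Sum>i<n. f i - g i\<bar> \<le> (\<Sum>i<n. \<bar>f i - g i\<bar>)" by (rule sum_abs)
  also have "\<dots> \<le> (\<Sum>i<n. c)" using assms(2) by (intro sum_mono) auto
  finally have "\<bar>\<Sum>i<n. f i - g i\<bar> \<le> real n * c" by simp
  moreover have "(\<Sum>i<n. f i) / real n - (\<Sum>i<n. g i) / real n = (\<Sum>i<n. f i - g i) / real n"
    by (simp add: sum_subtractf diff_divide_distrib)
  ultimately show ?thesis
    using assms(1) by (simp add: abs_divide divide_le_eq mult.commute)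
qed

section \<open>Pathwise facts and comparison with the Two-Gate rule\<close>

context evaluation_step
begin

lemma Zhat_bounds: "0 \<le> Zhat S \<omega>" "Zhat S \<omega> \<le> 1"
proof -
  have "(\<Sum>j<nR S. of_bool (srec_lab S j \<omega>)) \<le> (\<Sum>j<nR S. 1 :: real)" by (intro sum_mono) auto
  then show "Zhat S \<omega> \<le> 1" using sizes_pos by (simp add: Zhat_def)
  show "0 \<le> Zhat S \<omega>" by (auto simp: Zhat_def intro!: divide_nonneg_nonneg sum_nonneg)
qed

text \<open>Ties the random number of retained records to \<open>Zhat\<close>, so that a mean over
  \<open>SR\<close> can be exchanged for one over all records.\<close>

lemma card_SR: "real (card (SR S \<omega>)) = real (nR S) * (1 - Zhat S \<omega>)"
proof -
  have "real (card (SR S \<omega>)) = (\<Sum>j<nR S. if j \<in> SR S \<omega> then 1 else 0)"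
    by (subst sum.inter_restrict[symmetric]) (auto simp: SR_def intro!: arg_cong[where f=card])
  also have "\<dots> = (\<Sum>j<nR S. 1 - of_bool (srec_lab S j \<omega>))"
    by (intro sum.cong) (auto simp: SR_def)
  also have "\<dots> = real (nR S) * (1 - Zhat S \<omega>)"
    using sizes_pos by (simp add: Zhat_def sum_subtractf field_simps)
  finally show ?thesis .
qed

lemma Zhat_less_1: "\<omega> \<in> ReadyR S \<Longrightarrow> Zhat S \<omega> < 1"
  using card_SR[of \<omega>] sizes_pos(2) Zhat_bounds(2)[of \<omega>] by (cases "Zhat S \<omega> = 1") (auto simp: ReadyR_def)

lemma integrable_bounded:
  fixes f :: "'t \<Rightarrow> real"
  assumes "f \<in> borel_measurable (taskS S)" "\<And>t. t \<in> space (taskS S) \<Longrightarrow> \<bar>f t\<bar> \<le> B"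
  shows "integrable (Duser S) f"
  using assms by (intro D.integrable_const_bound[where B=B] AE_I2) auto

lemma integral_D_fail:
  assumes a: "a \<in> space (agentS S)" and b: "b \<in> space (agentS S)" and Z: "0 < fail_mass S a"
  shows "(\<integral>t. Adv S a b t \<partial>D_fail S a) = (\<integral>t. psi S a t * Adv S a b t \<partial>Duser S) / fail_mass S a"
proof -
  have "(\<integral>t. Adv S a b t \<partial>D_fail S a) = (\<integral>t. (psi S a t / fail_mass S a) *\<^sub>R Adv S a b t \<partial>Duser S)"
    unfolding D_fail_def
    using a b Z psi_bounds[OF a] by (intro integral_density) (auto simp: Adv_def)
  then show ?thesis by simp
qed

lemma J_user_diff_ge:
  assumes a: "a \<in> space (agentS S)" and b: "b \<in> space (agentS S)"
  shows "(\<integral>t. psi S a t * Adv S a b t \<partial>Duser S) - (\<integral>t. (1 - psi S a t) * max 0 (- Adv S a b t) \<partial>Duser S)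
    \<le> J_user S b - J_user S a"
proof -
  note bnds = val_bounds[OF a] val_bounds[OF b] psi_bounds[OF a]
  have Adv_le: "\<bar>Adv S a b t\<bar> \<le> 1" if "t \<in> space (taskS S)" for t
    using bnds[OF that] by (auto simp: Adv_def)
  have i1: "integrable (Duser S) (val S a)" "integrable (Duser S) (val S b)"
    using a b bnds by (auto intro!: integrable_bounded[where B=1])
  have i2: "integrable (Duser S) (\<lambda>t. psi S a t * Adv S a b t)"
    using a b bnds Adv_le by (intro integrable_bounded[where B=1]) (auto simp: Adv_def abs_mult intro!: mult_le_one)
  have i3: "integrable (Duser S) (\<lambda>t. (1 - psi S a t) * max 0 (- Adv S a b t))"
  proof (rule integrable_bounded[where B=1])
    fix t assume t: "t \<in> space (taskS S)"
    show "\<bar>(1 - psi S a t) * max 0 (- Adv S a b t)\<bar> \<le> 1"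
      unfolding abs_mult using bnds[OF t] Adv_le[OF t] by (intro mult_le_one) auto
  qed (use a b in \<open>auto simp: Adv_def\<close>)
  have "(\<integral>t. psi S a t * Adv S a b t \<partial>Duser S) - (\<integral>t. (1 - psi S a t) * max 0 (- Adv S a b t) \<partial>Duser S)
    = (\<integral>t. psi S a t * Adv S a b t - (1 - psi S a t) * max 0 (- Adv S a b t) \<partial>Duser S)"
    using i2 i3 by simp
  also have "\<dots> \<le> (\<integral>t. val S b t - val S a t \<partial>Duser S)"
  proof (rule integral_mono)
    fix t assume "t \<in> space (Duser S)"
    then have t: "t \<in> space (taskS S)" by simp
    have "(1 - psi S a t) * (- Adv S a b t) \<le> (1 - psi S a t) * max 0 (- Adv S a b t)"
      using bnds[OF t] by (intro mult_left_mono) auto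
    then show "psi S a t * Adv S a b t - (1 - psi S a t) * max 0 (- Adv S a b t) \<le> val S b t - val S a t"
      by (simp add: Adv_def algebra_simps)
  qed (use i1 i2 i3 in auto)
  also have "\<dots> = J_user S b - J_user S a"
    using i1 by (simp add: J_user_def)
  finally show ?thesis .
qed

text \<open>The gap condition keeps the reduced risks positive, and they stay below 1, so the
  logarithms in the radii are nonnegative.\<close>

lemma eps_nonneg:
  assumes "gap_condition S"
  shows "0 \<le> epsV S" "0 \<le> epsZ S" "0 \<le> epsR S"
proof -
  have "0 \<le> 2 * real (nR S) * beta_mix S (gap S)"
    using beta_mix_nonneg by (intro mult_nonneg_nonneg) auto
  then show "0 \<le> epsV S" "0 \<le> epsZ S" "0 \<le> epsR S"
    using assms risks hoeffding_radius_nonneg[of _ "nR S"] hoeffding_radius_nonneg[of _ "nroll S"]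
    unfolding gap_condition_def epsV_def epsZ_def epsR_def hoeffding_radius_def
    by auto
qed

text \<open>A negative part is at most the absolute value, so the measured decrease is at most
  \<delta>. On the same path \<open>Mhat\<close> differs from the Two-Gate expression by replacing
  \<tau> with a value at least as large and \<delta> with one at most as large, under a nonnegative
  weight.\<close>

lemma Acc_two_gate_subset:
  assumes "gap_condition S"
  shows "Acc_two_gate S \<tau> \<delta> \<subseteq> Acc_margin S \<delta>"
proof
  fix \<omega> assume "\<omega> \<in> Acc_two_gate S \<tau> \<delta>"
  then have \<omega>: "\<omega> \<in> Cand S \<inter> Ready S" and L: "\<tau> \<le> Lhat S \<omega>" and D: "DRhat S \<omega> \<le> \<delta>"
    and M: "0 < \<tau> - epsL S \<omega> - (1 - Zhat S \<omega> + epsZ S) * (\<delta> + epsD S \<omega>)"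
    by (auto simp: Acc_two_gate_def)
  have "DRhat_minus S \<omega> \<le> DRhat S \<omega>"
    unfolding DRhat_def DRhat_minus_def by (intro divide_right_mono sum_mono) auto
  then have D': "DRhat_minus S \<omega> \<le> \<delta>" using D by simp
  moreover have "(1 - Zhat S \<omega> + epsZ S) * (DRhat_minus S \<omega> + epsD S \<omega>)
      \<le> (1 - Zhat S \<omega> + epsZ S) * (\<delta> + epsD S \<omega>)"
    using D' Zhat_bounds[of \<omega>] eps_nonneg[OF assms] by (intro mult_left_mono) auto
  ultimately show "\<omega> \<in> Acc_margin S \<delta>"
    using \<omega> L M by (simp add: Acc_margin_def Mhat_def)
qed

end

section \<open>Exceptional events and the union bound\<close>

context protocol_step
begin

definition Z_dev :: "'w set" where
  "Z_dev = {\<omega> \<in> space (Pr S). epsZ S < \<bar>Zhat S \<omega> - fail_mass S (cur S \<omega>)\<bar>}"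

text \<open>Taken over all stored records with weight zero on failures, which fixes the denominator.
  It uses true advantages rather than rollout estimates, so it is a function of \<open>info\<close>
  and \<open>records\<close>.\<close>

definition loss_mean :: "'w \<Rightarrow> real" where
  "loss_mean \<omega> = (\<Sum>j<nR S. of_bool (\<not> srec_lab S j \<omega>) *
     max 0 (- Adv S (cur S \<omega>) (candidate S \<omega>) (srec_task S j \<omega>))) / real (nR S)"

definition R_dev :: "'w set" where
  "R_dev = {\<omega> \<in> space (Pr S). epsR S < \<bar>loss_mean \<omega>
     - (\<integral>t. (1 - psi S (cur S \<omega>) t) * max 0 (- Adv S (cur S \<omega>) (candidate S \<omega>) t) \<partial>Duser S)\<bar>}"

text \<open>The event of \<open>batch_condition\<close>, with the mean under \<open>D_fail\<close>
  written as a quotient so that the failure mass can be cleared in the margin inequality.\<close>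

definition F_dev :: "'w set" where
  "F_dev = {\<omega> \<in> Cand S \<inter> RetF S. epsF S \<omega> <
     \<bar>(\<Sum>i<nF S. Adv S (cur S \<omega>) (candidate S \<omega>) (batch S i \<omega>)) / real (nF S)
      - (\<integral>t. psi S (cur S \<omega>) t * Adv S (cur S \<omega>) (candidate S \<omega>) t \<partial>Duser S) / fail_mass S (cur S \<omega>)\<bar>}"

lemma Z_dev_bound:
  assumes "stored_condition S" "gap_condition S"
  shows "Z_dev \<in> sets (Pr S)" "measure (Pr S) Z_dev \<le> betaZ S"
proof -
  let ?h = "\<lambda>(g, p). of_bool (snd p) :: real"
  have h: "?h \<in> borel_measurable (infoS S \<Otimes>\<^sub>M recS)"
    unfolding case_prod_beta' by measurable
  have h01: "0 \<le> ?h (g, p) \<and> ?h (g, p) \<le> 1" for g p by simp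
  have mean: "(\<integral>p. of_bool (snd p) \<partial>record_law S (cur S \<omega>)) = fail_mass S (cur S \<omega>)" if "\<omega> \<in> space (Pr S)" for \<omega>
    using measurable_space[OF cur_measurable that] by (subst integral_record_law) (auto simp: fail_mass_def)
  have "{\<omega> \<in> space (Pr S).
      hoeffding_radius (betaZ S - 2 * real (nR S) * beta_mix S (gap S)) (nR S)
      < \<bar>(\<Sum>j<nR S. ?h (info S \<omega>, (srec_task S j \<omega>, srec_lab S j \<omega>))) / real (nR S)
          - (\<integral>p. ?h (info S \<omega>, p) \<partial>record_law S (cur S \<omega>))\<bar>} = Z_dev"
    using mean by (auto simp: Z_dev_def epsZ_def hoeffding_radius_def Zhat_def)
  with stored_concentration[OF assms(1) h h01, of "betaZ S"] assms(2) risks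
  show "Z_dev \<in> sets (Pr S)" "measure (Pr S) Z_dev \<le> betaZ S"
    by (auto simp: gap_condition_def)
qed

lemma R_dev_bound:
  assumes "stored_condition S" "gap_condition S"
  shows "R_dev \<in> sets (Pr S)" "measure (Pr S) R_dev \<le> betaR S"
proof -
  \<comment> \<open>The candidate recomputed from \<open>info\<close>, as
    \<open>stored_concentration\<close> requires a summand depending on the path only through
    \<open>info\<close> and the record.\<close>
  define cd where "cd = (\<lambda>g :: 'a \<times> 'c option \<times> (nat \<Rightarrow> 't) \<times> nat \<times> 'u.
    case fst (snd g) of None \<Rightarrow> fst g | Some c \<Rightarrow> oplus S (fst g) c)"
  define h where "h = (\<lambda>(g, p). of_bool (\<not> snd p) * max 0 (- Adv S (fst g) (cd g) (fst p)))"
  have a[measurable]: "fst \<in> infoS S \<rightarrow>\<^sub>M agentS S" unfolding infoS_def by simp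
  have "(\<lambda>g. (fst g, fst (snd g))) \<in> infoS S \<rightarrow>\<^sub>M agentS S \<Otimes>\<^sub>M with_bot (modS S)"
    unfolding infoS_def by measurable
  from measurable_compose[OF this candidate_info_measurable]
  have cd[measurable]: "cd \<in> infoS S \<rightarrow>\<^sub>M agentS S" by (simp add: cd_def)
  have h: "h \<in> borel_measurable (infoS S \<Otimes>\<^sub>M recS)"
    unfolding h_def case_prod_beta' Adv_def by measurable
  have cd_info: "cd (info S \<omega>) = candidate S \<omega>" "fst (info S \<omega>) = cur S \<omega>" for \<omega>
    by (simp_all add: cd_def info_def candidate_def split: option.split)
  have h01: "0 \<le> h (g, p) \<and> h (g, p) \<le> 1" if "g \<in> space (infoS S)" "p \<in> space recS" for g p
    using that measurable_space[OF a] measurable_space[OF cd]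
      val_bounds[of "fst g" "fst p"] val_bounds[of "cd g" "fst p"]
    by (auto simp: h_def Adv_def space_pair_measure)
  have mean: "(\<integral>p. h (info S \<omega>, p) \<partial>record_law S (cur S \<omega>))
    = (\<integral>t. (1 - psi S (cur S \<omega>) t) * max 0 (- Adv S (cur S \<omega>) (candidate S \<omega>) t) \<partial>Duser S)"
    if "\<omega> \<in> space (Pr S)" for \<omega>
  proof -
    have i: "info S \<omega> \<in> space (infoS S)" using measurable_space[OF info_measurable that] .
    show ?thesis
      using measurable_space[OF cur_measurable that] measurable_Pair2[OF h i] h01[OF i]
      by (subst integral_record_law) (auto simp: h_def cd_info)
  qed
  have "{\<omega> \<in> space (Pr S).
      hoeffding_radius (betaR S - 2 * real (nR S) * beta_mix S (gap S)) (nR S)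
      < \<bar>(\<Sum>j<nR S. h (info S \<omega>, (srec_task S j \<omega>, srec_lab S j \<omega>))) / real (nR S)
          - (\<integral>p. h (info S \<omega>, p) \<partial>record_law S (cur S \<omega>))\<bar>} = R_dev"
    using mean by (auto simp: R_dev_def epsR_def hoeffding_radius_def loss_mean_def h_def cd_info)
  with stored_concentration[OF assms(1) h h01, of "betaR S"] assms(2) risks
  show "R_dev \<in> sets (Pr S)" "measure (Pr S) R_dev \<le> betaR S"
    by (auto simp: gap_condition_def)
qed

lemma F_dev_bound:
  assumes "batch_condition S"
  shows "F_dev \<in> sets (Pr S)" "measure (Pr S) F_dev \<le> betaF S"
proof -
  have [measurable]: "(\<lambda>\<omega>. \<integral>t. psi S (cur S \<omega>) t * Adv S (cur S \<omega>) (candidate S \<omega>) t \<partial>Duser S) \<in> borel_measurable (Pr S)"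
    by (rule D.borel_measurable_lebesgue_integral) (simp add: case_prod_beta' Adv_def)
  have [measurable]: "(\<lambda>\<omega>. fail_mass S (cur S \<omega>)) \<in> borel_measurable (Pr S)"
    unfolding fail_mass_def by (rule D.borel_measurable_lebesgue_integral) (simp add: case_prod_beta')
  have "F_dev = (Cand S \<inter> RetF S) \<inter> {\<omega> \<in> space (Pr S). epsF S \<omega> <
     \<bar>(\<Sum>i<nF S. Adv S (cur S \<omega>) (candidate S \<omega>) (batch S i \<omega>)) / real (nF S)
      - (\<integral>t. psi S (cur S \<omega>) t * Adv S (cur S \<omega>) (candidate S \<omega>) t \<partial>Duser S) / fail_mass S (cur S \<omega>)\<bar>}"
    unfolding F_dev_def Cand_def by blast
  also have "\<dots> \<in> sets (Pr S)"
    unfolding Adv_def[of S "cur S _" "candidate S _" "batch S _ _"] by measurable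
  finally show "F_dev \<in> sets (Pr S)" .
  have "F_dev = {\<omega> \<in> Cand S \<inter> RetF S.
      let f = Adv S (cur S \<omega>) (candidate S \<omega>) in
      epsF S \<omega> < \<bar>(\<Sum>i<nF S. f (batch S i \<omega>)) / real (nF S)
                   - (\<integral>t. f t \<partial>D_fail S (cur S \<omega>))\<bar>}"
    using measurable_space[OF cur_measurable] measurable_space[OF candidate_measurable] fail_mass_bounds
    by (auto simp: F_dev_def Let_def Cand_def integral_D_fail)
  then show "measure (Pr S) F_dev \<le> betaF S"
    using assms by (simp add: batch_condition_def)
qed

lemma Vhat_bounds:
  assumes "e \<in> eval_idx" "\<omega> \<in> space (Pr S)"
  shows "0 \<le> Vhat S b e \<omega>" "Vhat S b e \<omega> \<le> 1"
proof -
  have r: "0 \<le> rew S (eval_task S e \<omega>) (roll S b e l \<omega>) \<and> rew S (eval_task S e \<omega>) (roll S b e l \<omega>) \<le> 1" for l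
    using measurable_space[OF eval_task_measurable[OF assms(1)] assms(2)] measurable_space[OF roll_measurable assms(2)]
    by (intro rew_bounds)
  then show "0 \<le> Vhat S b e \<omega>" unfolding Vhat_def by (intro divide_nonneg_nonneg sum_nonneg) auto
  have "(\<Sum>l<nroll S. rew S (eval_task S e \<omega>) (roll S b e l \<omega>)) \<le> (\<Sum>l<nroll S. 1)"
    using r by (intro sum_mono) auto
  then show "Vhat S b e \<omega> \<le> 1" using sizes_pos by (simp add: Vhat_def)
qed

text \<open>No probability is left here: \<open>margin_lower_bound\<close> is applied to the
  quantities of a single path.\<close>

lemma Mhat_le_improvement:
  assumes gap: "gap_condition S" and acc: "\<omega> \<in> Acc_margin S \<delta>"
    and good: "\<omega> \<notin> Z_dev" "\<omega> \<notin> R_dev" "\<omega> \<notin> F_dev"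
    and roll: "\<And>b e. e \<in> eval_idx \<Longrightarrow> \<omega> \<notin> rollout_dev b e"
  shows "Mhat S \<omega> \<le> improvement S \<delta> \<omega>"
proof -
  have \<omega>: "\<omega> \<in> Cand S" "\<omega> \<in> Ready S" "\<omega> \<in> RetF S" "\<omega> \<in> ReadyR S" "\<omega> \<in> space (Pr S)"
    using acc by (auto simp: Acc_margin_def Ready_def Cand_def)
  let ?a = "cur S \<omega>" and ?b = "candidate S \<omega>"
  have ab: "?a \<in> space (agentS S)" "?b \<in> space (agentS S)"
    using measurable_space[OF cur_measurable] measurable_space[OF candidate_measurable] \<omega> by auto
  let ?d = "\<lambda>e. Vhat S True e \<omega> - Vhat S False e \<omega>"
  have dev: "\<bar>?d e - Adv S ?a ?b (eval_task S e \<omega>)\<bar> \<le> 2 * epsV S" if "e \<in> evaluated S \<omega>" for e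
  proof -
    have e: "e \<in> eval_idx" using that evaluated_subset by auto
    show ?thesis
      \<comment> \<open>Each of the two rollout groups contributes one \<open>epsV\<close>.\<close>
      using roll[OF e, of True] roll[OF e, of False] that \<omega>
      by (auto simp: rollout_dev_def eval_agent_def Adv_def)
  qed
  have fin: "finite (SR S \<omega>)" by (simp add: SR_def)
  let ?A = "\<lambda>i. Adv S ?a ?b (batch S i \<omega>)"
  have "Zhat S \<omega> * ((\<Sum>i<nF S. ?d (Inl i)) / real (nF S))
      - (epsZ S + (Zhat S \<omega> + epsZ S) * (2 * epsV S + epsF S \<omega>))
      - (1 - Zhat S \<omega> + epsZ S) * (DRhat_minus S \<omega> + (2 * epsV S + epsR S + epsZ S) / (1 - Zhat S \<omega>))
    \<le> J_user S ?b - J_user S ?a"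
  proof (rule margin_lower_bound)
    show "0 < fail_mass S ?a" using fail_mass_bounds \<omega> by auto
    show "\<bar>Zhat S \<omega> - fail_mass S ?a\<bar> \<le> epsZ S" using good \<omega> by (auto simp: Z_dev_def)
    show "\<bar>(\<Sum>i<nF S. ?A i) / real (nF S)
      - (\<integral>t. psi S ?a t * Adv S ?a ?b t \<partial>Duser S) / fail_mass S ?a\<bar> \<le> epsF S \<omega>"
      using good \<omega> by (auto simp: F_dev_def)
    show "\<bar>(\<Sum>i<nF S. ?A i) / real (nF S) - (\<Sum>i<nF S. ?d (Inl i)) / real (nF S)\<bar> \<le> 2 * epsV S"
    proof (rule abs_mean_diff_le)
      fix i assume "i < nF S"
      then show "\<bar>?A i - ?d (Inl i)\<bar> \<le> 2 * epsV S"
        using dev[of "Inl i"] by (simp add: evaluated_def eval_task_def abs_minus_commute)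
    qed (rule sizes_pos)
    \<comment> \<open>Comparing with the zero sequence bounds the mean itself by 1.\<close>
    have "\<bar>(\<Sum>i<nF S. ?d (Inl i)) / real (nF S) - (\<Sum>i<nF S. 0) / real (nF S)\<bar> \<le> 1"
    proof (rule abs_mean_diff_le)
      fix i assume "i < nF S"
      then have "Inl i \<in> eval_idx" by (simp add: eval_idx_def)
      then show "\<bar>?d (Inl i) - 0\<bar> \<le> 1"
        using Vhat_bounds[of "Inl i" \<omega> True] Vhat_bounds[of "Inl i" \<omega> False] \<omega> by auto
    qed (rule sizes_pos)
    then show "\<bar>(\<Sum>i<nF S. ?d (Inl i)) / real (nF S)\<bar> \<le> 1" by simp
    show "0 \<le> Zhat S \<omega>" by (rule Zhat_bounds)
    show Z1: "Zhat S \<omega> < 1" using \<omega> by (intro Zhat_less_1)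
    show "0 \<le> DRhat_minus S \<omega>" unfolding DRhat_minus_def by (intro divide_nonneg_nonneg sum_nonneg) auto
    show "0 \<le> epsV S" by (rule eps_nonneg[OF gap])
    show "\<bar>loss_mean \<omega> - (\<integral>t. (1 - psi S ?a t) * max 0 (- Adv S ?a ?b t) \<partial>Duser S)\<bar> \<le> epsR S"
      using good \<omega> by (auto simp: R_dev_def)
    show "loss_mean \<omega> \<le> (1 - Zhat S \<omega>) * (DRhat_minus S \<omega> + 2 * epsV S)"
    proof -
      let ?g = "\<lambda>j. max 0 (- Adv S ?a ?b (srec_task S j \<omega>))"
      have c: "0 < real (card (SR S \<omega>))" using card_SR[of \<omega>] Z1 sizes_pos by simp
      \<comment> \<open>Failure-labelled records drop out, leaving exactly the indices over which
        \<open>DRhat_minus\<close> averages.\<close>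
      have "(\<Sum>j<nR S. of_bool (\<not> srec_lab S j \<omega>) * ?g j) = (\<Sum>j\<in>SR S \<omega>. ?g j)"
        by (intro sum.mono_neutral_cong_right) (auto simp: SR_def)
      also have "\<dots> \<le> (\<Sum>j\<in>SR S \<omega>. max 0 (Vhat S False (Inr j) \<omega> - Vhat S True (Inr j) \<omega>) + 2 * epsV S)"
      proof (rule sum_mono)
        fix j assume "j \<in> SR S \<omega>"
        \<comment> \<open>The positive part is 1-Lipschitz, so it inherits the error of the
          estimated advantage.\<close>
        then show "?g j \<le> max 0 (Vhat S False (Inr j) \<omega> - Vhat S True (Inr j) \<omega>) + 2 * epsV S"
          using dev[of "Inr j"] eps_nonneg(1)[OF gap] by (auto simp: evaluated_def eval_task_def)
      qed
      also have "\<dots> = real (card (SR S \<omega>)) * (DRhat_minus S \<omega> + 2 * epsV S)"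
        using c by (simp add: sum.distrib DRhat_minus_def distrib_left)
      also have "\<dots> = real (nR S) * ((1 - Zhat S \<omega>) * (DRhat_minus S \<omega> + 2 * epsV S))"
        by (simp add: card_SR)
      finally show ?thesis
        using sizes_pos by (simp add: loss_mean_def divide_le_eq mult.commute)
    qed
    show "(\<integral>t. psi S ?a t * Adv S ?a ?b t \<partial>Duser S) - (\<integral>t. (1 - psi S ?a t) * max 0 (- Adv S ?a ?b t) \<partial>Duser S)
      \<le> J_user S ?b - J_user S ?a" by (rule J_user_diff_ge[OF ab])
  qed
  then show ?thesis
    using acc \<omega> by (simp add: Mhat_def Lhat_def epsL_def epsD_def improvement_def next_agent_def)
qed

text \<open>Stated for a general subset of the adoption event so that both probability claims are
  instances: the set is covered by the exceptional events, since elsewhere the margin is a valid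
  lower bound.\<close>

lemma Acc_margin_bound:
  assumes "standard_evaluation S" and A: "A \<subseteq> Acc_margin S \<delta>" "\<And>\<omega>. \<omega> \<in> A \<Longrightarrow> improvement S \<delta> \<omega> < Mhat S \<omega>"
  shows "measure (Pr S) A \<le> beta_step S"
proof -
  have cond: "stored_condition S" "gap_condition S" "batch_condition S"
    using assms(1) by (auto simp: standard_evaluation_def)
  let ?V = "\<Union>(b, e)\<in>UNIV \<times> eval_idx. rollout_dev b e"
  have fin: "finite eval_idx" by (simp add: eval_idx_def)
  \<comment> \<open>With two agents per evaluation task this gives the \<open>2 * (nF + nR)\<close>
    rollout groups of \<open>beta_step\<close>.\<close>
  have card: "card eval_idx = nF S + nR S"
    unfolding eval_idx_def by (subst card_Un_disjoint) (auto simp: card_image)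
  have V: "rollout_dev b e \<in> sets (Pr S)" if "e \<in> eval_idx" for b e using rollout_dev_sets[OF that] .
  have V_sets: "?V \<in> sets (Pr S)" using fin V by (intro sets.finite_UN) auto
  note sets = Z_dev_bound(1)[OF cond(1,2)] R_dev_bound(1)[OF cond(1,2)] F_dev_bound(1)[OF cond(3)] V_sets
  have "measure (Pr S) A \<le> measure (Pr S) (Z_dev \<union> (R_dev \<union> (F_dev \<union> ?V)))"
  proof (rule P.finite_measure_mono)
    show "A \<subseteq> Z_dev \<union> (R_dev \<union> (F_dev \<union> ?V))"
    proof
      fix \<omega> assume \<omega>: "\<omega> \<in> A"
      show "\<omega> \<in> Z_dev \<union> (R_dev \<union> (F_dev \<union> ?V))"
      proof (rule ccontr)
        assume "\<omega> \<notin> Z_dev \<union> (R_dev \<union> (F_dev \<union> ?V))"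
        then have "Mhat S \<omega> \<le> improvement S \<delta> \<omega>"
          using A \<omega> by (intro Mhat_le_improvement[OF cond(2)]) auto
        then show False using A(2)[OF \<omega>] by simp
      qed
    qed
  qed (use sets in auto)
  also have "\<dots> \<le> measure (Pr S) Z_dev + (measure (Pr S) R_dev + (measure (Pr S) F_dev + measure (Pr S) ?V))"
    using sets by (intro order.trans[OF measure_Un_le] add_left_mono sets.Un) auto
  also have "measure (Pr S) ?V \<le> (\<Sum>(b, e)\<in>UNIV \<times> eval_idx. measure (Pr S) (rollout_dev b e))"
    unfolding case_prod_beta' using fin V by (intro P.finite_measure_subadditive_finite) auto
  also have "\<dots> \<le> (\<Sum>(b, e)\<in>(UNIV :: bool set) \<times> eval_idx. betaV S)"
    unfolding case_prod_beta' by (intro sum_mono rollout_concentration) auto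
  also have "\<dots> = 2 * (real (nF S) + real (nR S)) * betaV S"
    by (simp add: card_cartesian_product card split_beta)
  \<comment> \<open>The events cost \<open>betaZ + betaR + betaF\<close> and the rollout term;
    positivity of \<open>betaZ\<close> leads to the \<open>2 * betaZ\<close> of
    \<open>beta_step\<close>.\<close>
  finally show ?thesis
    using Z_dev_bound(2)[OF cond(1,2)] R_dev_bound(2)[OF cond(1,2)] F_dev_bound(2)[OF cond(3)] risks
    by (simp add: beta_step_def)
qed

end

section \<open>A path accepted by the margin rule only\<close>

text \<open>A measure on all naturals rather than on two points, because the output space must also
  contain the candidate's output 2.\<close>

definition coin :: "nat measure" where
  "coin = measure_pmf (pmf_of_set {0, 1})"

definition coins :: "(nat \<Rightarrow> nat) measure" where
  "coins = (\<Pi>\<^sub>M i\<in>UNIV. coin)"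

lemma prob_space_coin: "prob_space coin"
  by (simp add: coin_def measure_pmf.prob_space_axioms)

lemma sets_coin [simp, measurable_cong]: "sets coin = sets (count_space UNIV)"
  by (simp add: coin_def)

lemma space_coin [simp]: "space coin = UNIV"
  by (simp add: coin_def)

lemma coins_space [simp]: "space coins = UNIV"
  by (simp add: coins_def space_PiM PiE_def)

lemma coins_component [measurable]: "(\<lambda>\<omega>. \<omega> i) \<in> coins \<rightarrow>\<^sub>M count_space UNIV"
proof -
  have "(\<lambda>\<omega>. \<omega> i) \<in> coins \<rightarrow>\<^sub>M coin"
    unfolding coins_def by (rule measurable_component_singleton) simp
  then show ?thesis by (simp only: measurable_cong_sets[OF refl sets_coin])
qed

lemma coins_pred [measurable]: "Measurable.pred coins (\<lambda>\<omega>. P (\<omega> i))"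
  by (rule measurable_compose[OF coins_component]) simp

lemma coins_Collect_component [measurable]: "{\<omega>. P (\<omega> i)} \<in> sets coins"
  using predE[OF coins_pred, of P i] by simp

interpretation coins: prob_space coins
  unfolding coins_def by (rule prob_space_PiM) (rule prob_space_coin)

text \<open>Filling up with 0 is only a convenient way to say which coordinates an event depends on.\<close>

lemma coins_indep:
  assumes E: "E \<in> sets coins" "\<And>\<omega>. \<omega> \<in> E \<longleftrightarrow> (\<lambda>i. if i \<in> J then \<omega> i else 0) \<in> E"
    and G: "G \<in> sets coins" "\<And>\<omega>. \<omega> \<in> G \<longleftrightarrow> (\<lambda>i. if i \<in> J then 0 else \<omega> i) \<in> G"
  shows "measure coins (E \<inter> G) = measure coins E * measure coins G"
proof -
  have iv: "coins.indep_vars (\<lambda>_. coin) (\<lambda>i \<omega>. \<omega> i) UNIV"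
    unfolding coins_def by (rule indep_vars_PiM_components) (rule prob_space_coin)
  have "coins.indep_var (PiM J (\<lambda>_. coin)) (\<lambda>\<omega>. restrict (\<lambda>i. \<omega> i) J)
      (PiM (- J) (\<lambda>_. coin)) (\<lambda>\<omega>. restrict (\<lambda>i. \<omega> i) (- J))"
    by (rule coins.indep_var_restrict[OF iv]) auto
  note indep = coins.indep_varD[OF this]
  have ext: "(\<lambda>x i. if i \<in> K then x i else 0) \<in> PiM K (\<lambda>_. coin) \<rightarrow>\<^sub>M coins" for K
    unfolding coins_def
  proof (rule measurable_PiM_single')
    fix i show "(\<lambda>x. if i \<in> K then x i else 0) \<in> PiM K (\<lambda>_. coin) \<rightarrow>\<^sub>M coin"
      by (cases "i \<in> K") auto
  qed auto
  \<comment> \<open>A set determined by the coordinates in \<open>K\<close> is the preimage under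
    restriction of its trace in the product over \<open>K\<close>.\<close>
  have pre: "(\<lambda>\<omega>. restrict \<omega> K) -` ((\<lambda>x i. if i \<in> K then x i else 0) -` A \<inter> space (PiM K (\<lambda>_. coin))) \<inter> space coins = A"
    if "\<And>\<omega>. \<omega> \<in> A \<longleftrightarrow> (\<lambda>i. if i \<in> K then \<omega> i else 0) \<in> A" for A K
  proof -
    have "(\<lambda>i. if i \<in> K then restrict \<omega> K i else 0) = (\<lambda>i. if i \<in> K then \<omega> i else 0)" for \<omega> :: "nat \<Rightarrow> nat"
      by auto
    then show ?thesis using that by (auto simp: space_PiM)
  qed
  let ?E = "(\<lambda>x i. if i \<in> J then x i else 0) -` E \<inter> space (PiM J (\<lambda>_. coin))"
  let ?G = "(\<lambda>x i. if i \<in> - J then x i else 0) -` G \<inter> space (PiM (- J) (\<lambda>_. coin))"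
  have "(\<lambda>i. if i \<in> J then 0 else \<omega> i) = (\<lambda>i. if i \<in> - J then \<omega> i else 0)" for \<omega> :: "nat \<Rightarrow> nat" by auto
  then have G': "\<omega> \<in> G \<longleftrightarrow> (\<lambda>i. if i \<in> - J then \<omega> i else 0) \<in> G" for \<omega> using G(2)[of \<omega>] by simp
  have "?E \<in> sets (PiM J (\<lambda>_. coin))" "?G \<in> sets (PiM (- J) (\<lambda>_. coin))"
    by (rule measurable_sets[OF ext E(1)], rule measurable_sets[OF ext G(1)])
  from indep[OF this] have "measure coins ((\<lambda>\<omega>. (restrict \<omega> J, restrict \<omega> (- J))) -` (?E \<times> ?G) \<inter> space coins)
    = measure coins E * measure coins G"
    by (simp only: pre[OF E(2)] pre[OF G'])
  moreover have "(\<lambda>\<omega>. (restrict \<omega> J, restrict \<omega> (- J))) -` (?E \<times> ?G) \<inter> space coins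
    = ((\<lambda>\<omega>. restrict \<omega> J) -` ?E \<inter> space coins) \<inter> ((\<lambda>\<omega>. restrict \<omega> (- J)) -` ?G \<inter> space coins)" by auto
  ultimately show ?thesis by (simp only: pre[OF E(2)] pre[OF G'])
qed

lemma coins_Collect:
  assumes "finite I"
  shows "{\<omega>. \<forall>i\<in>I. \<omega> i \<in> B i} \<in> sets coins"
    and "measure coins {\<omega>. \<forall>i\<in>I. \<omega> i \<in> B i} = (\<Prod>i\<in>I. measure coin (B i))"
proof -
  have "{\<omega> \<in> space coins. \<forall>i\<in>I. \<omega> i \<in> B i} \<in> sets coins"
    using assms by measurable
  then show "{\<omega>. \<forall>i\<in>I. \<omega> i \<in> B i} \<in> sets coins" by simp
  interpret coin: prob_space coin by (rule prob_space_coin)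
  interpret C: product_prob_space "\<lambda>_::nat. coin" UNIV
    using prob_space_coin by (intro product_prob_spaceI)
  have "emeasure (PiM UNIV (\<lambda>_. coin)) {\<omega> \<in> space (PiM UNIV (\<lambda>_. coin)). \<forall>i\<in>I. \<omega> i \<in> B i} = (\<Prod>i\<in>I. emeasure coin (B i))"
    by (rule C.emeasure_PiM_Collect) (use assms in auto)
  then have "emeasure coins {\<omega>. \<forall>i\<in>I. \<omega> i \<in> B i} = (\<Prod>i\<in>I. emeasure coin (B i))"
    unfolding coins_def[symmetric] by simp
  then show "measure coins {\<omega>. \<forall>i\<in>I. \<omega> i \<in> B i} = (\<Prod>i\<in>I. measure coin (B i))"
    by (simp add: coins.emeasure_eq_measure coin.emeasure_eq_measure prod_ennreal prod_nonneg)
qed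

text \<open>The form in which the laws of outputs and rollouts are verified: \<open>E\<close>
  collects the conditioning data, the coordinates in \<open>I\<close> are the fresh draws.\<close>

lemma coins_indep_Collect:
  assumes E: "E \<in> sets coins" "\<And>\<omega>. \<omega> \<in> E \<longleftrightarrow> (\<lambda>i. if i \<in> J then \<omega> i else 0) \<in> E"
    and I: "finite I" "I \<inter> J = {}"
  shows "measure coins {\<omega> \<in> E. \<forall>i\<in>I. \<omega> i \<in> B i} = measure coins E * (\<Prod>i\<in>I. measure coin (B i))"
proof -
  have "{\<omega> \<in> E. \<forall>i\<in>I. \<omega> i \<in> B i} = E \<inter> {\<omega>. \<forall>i\<in>I. \<omega> i \<in> B i}" by auto
  also have "measure coins \<dots> = measure coins E * measure coins {\<omega>. \<forall>i\<in>I. \<omega> i \<in> B i}"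
    using I by (intro coins_indep[OF E coins_Collect(1)]) auto
  finally show ?thesis by (simp add: coins_Collect I)
qed

text \<open>
  The task is always 0, so the stream is trivially mixing; the current agent tosses a coin, fails on 1 and never earns a reward,
  and the candidate always earns the reward 1. The outputs of the stream are the even coordinates,
  the rollouts of the current agent the odd ones. The number 600 makes all radii at most
  \<open>1/20\<close>, since \<open>ln 4 / 1200 \<le> 1 / 400\<close>.
\<close>

definition coin_step :: "(nat \<Rightarrow> nat, nat, nat, nat, nat, nat) step" where
  "coin_step = \<lparr>Pr = coins, taskS = count_space UNIV, outS = count_space UNIV, agentS = count_space UNIV,
    modS = count_space UNIV, auxS = count_space UNIV,
    runK = (\<lambda>a t. if a = 0 then coin else return (count_space UNIV) 2),
    genK = (\<lambda>a x. return (with_bot (count_space UNIV)) (Some 0)),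
    oplus = (\<lambda>a c. 1), rew = (\<lambda>t x. of_bool (x = 2)), fails = (\<lambda>t x. x = 1),
    Duser = return (count_space UNIV) 0,
    task = (\<lambda>n \<omega>. 0), outp = (\<lambda>n \<omega>. \<omega> (2 * n)), cur = (\<lambda>\<omega>. 0),
    modif = (\<lambda>\<omega>. if \<omega> 0 = 1 then Some 0 else None), aux = (\<lambda>\<omega>. 0), offset = (\<lambda>\<omega>. 0),
    gen_start = 0, gen_len = 1, sched = (\<lambda>u j. Suc j),
    srec_task = (\<lambda>j \<omega>. 0), srec_lab = (\<lambda>j \<omega>. \<omega> (2 * Suc j) = 1), valid_sample = UNIV,
    win_start = (\<lambda>\<omega>. 601), win_len = (\<lambda>\<omega>. 1), epsF = (\<lambda>\<omega>. 0),
    roll = (\<lambda>b e l \<omega>. if b then 2 else \<omega> (2 * l + 1)),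
    nF = 1, nR = 600, nroll = 600, gap = 1, betaV = 1/2, betaZ = 1/2, betaR = 1/2, betaF = 1/2\<rparr>"

lemma coin_step_simps [simp]:
  "Pr coin_step = coins"
  "taskS coin_step = count_space UNIV"
  "outS coin_step = count_space UNIV"
  "agentS coin_step = count_space UNIV"
  "modS coin_step = count_space UNIV"
  "auxS coin_step = count_space UNIV"
  "runK coin_step = (\<lambda>a t. if a = 0 then coin else return (count_space UNIV) 2)"
  "genK coin_step = (\<lambda>a x. return (with_bot (count_space UNIV)) (Some 0))"
  "oplus coin_step = (\<lambda>a c. 1)"
  "rew coin_step = (\<lambda>t x. of_bool (x = 2))"
  "fails coin_step = (\<lambda>t x. x = 1)"
  "Duser coin_step = return (count_space UNIV) 0"
  "task coin_step = (\<lambda>n \<omega>. 0)"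
  "outp coin_step = (\<lambda>n \<omega>. \<omega> (2 * n))"
  "cur coin_step = (\<lambda>\<omega>. 0)"
  "modif coin_step = (\<lambda>\<omega>. if \<omega> 0 = 1 then Some 0 else None)"
  "aux coin_step = (\<lambda>\<omega>. 0)"
  "offset coin_step = (\<lambda>\<omega>. 0)"
  "gen_start coin_step = 0"
  "gen_len coin_step = 1"
  "sched coin_step = (\<lambda>u j. Suc j)"
  "srec_task coin_step = (\<lambda>j \<omega>. 0)"
  "srec_lab coin_step = (\<lambda>j \<omega>. \<omega> (2 * Suc j) = 1)"
  "valid_sample coin_step = UNIV"
  "win_start coin_step = (\<lambda>\<omega>. 601)"
  "win_len coin_step = (\<lambda>\<omega>. 1)"
  "epsF coin_step = (\<lambda>\<omega>. 0)"
  "roll coin_step = (\<lambda>b e l \<omega>. if b then 2 else \<omega> (2 * l + 1))"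
  "nF coin_step = 1"
  "nR coin_step = 600"
  "nroll coin_step = 600"
  "gap coin_step = 1"
  "betaV coin_step = 1/2"
  "betaZ coin_step = 1/2"
  "betaR coin_step = 1/2"
  "betaF coin_step = 1/2"
  by (simp_all add: coin_step_def)

section \<open>The coin instance satisfies all conditions\<close>

lemma coin_vals: "psi coin_step 0 t = 1/2" "val coin_step 0 t = 0" "val coin_step (Suc 0) t = 1"
proof -
  have *: "(\<integral>x. of_bool (x = c) \<partial>coin) = pmf (pmf_of_set {0, 1}) c" for c :: nat
  proof -
    have "(\<integral>x. of_bool (x = c) \<partial>coin) = (\<integral>x. indicator {c} x \<partial>coin)"
      by (intro Bochner_Integration.integral_cong) (auto simp: indicator_def)
    also have "\<dots> = measure coin {c}" by simp
    finally show ?thesis by (simp only: coin_def measure_pmf_single)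
  qed
  then show "psi coin_step 0 t = 1/2" "val coin_step 0 t = 0"
    using *[of 1] *[of 2] by (simp_all add: psi_def val_def)
  show "val coin_step (Suc 0) t = 1" by (simp add: val_def integral_return measure_return)
qed

lemma coin_fail_mass: "fail_mass coin_step 0 = 1/2"
  by (simp add: fail_mass_def coin_vals measure_return)

lemma sets_with_bot_count_space: "sets (with_bot (count_space (UNIV :: nat set))) = UNIV"
proof -
  have "A \<in> sets (with_bot (count_space (UNIV :: nat set)))" for A
  proof -
    have "Some ` (Some -` A) \<in> sets (with_bot (count_space (UNIV :: nat set)))"
      by (rule Some_in_sets_with_bot) simp
    moreover have "A \<inter> {None} \<in> sets (with_bot (count_space (UNIV :: nat set)))"
      using None_in_sets_with_bot[of "count_space (UNIV :: nat set)"] by (cases "None \<in> A") auto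
    ultimately have "Some ` (Some -` A) \<union> (A \<inter> {None}) \<in> sets (with_bot (count_space (UNIV :: nat set)))"
      by (rule sets.Un)
    also have "Some ` (Some -` A) \<union> (A \<inter> {None}) = A"
    proof (rule set_eqI)
      fix x show "x \<in> Some ` (Some -` A) \<union> (A \<inter> {None}) \<longleftrightarrow> x \<in> A" by (cases x) auto
    qed
    finally show ?thesis .
  qed
  then show ?thesis by auto
qed

lemma coin_step_setting: "setting coin_step"
proof -
  have [simp]: "count_space UNIV \<Otimes>\<^sub>M count_space UNIV = (count_space UNIV :: (nat \<times> nat) measure)"
    by (simp add: pair_measure_countable)
  have runK: "(\<lambda>(a, t). runK coin_step a t) \<in> count_space UNIV \<rightarrow>\<^sub>M prob_algebra (count_space UNIV)"
    by (auto simp: measurable_count_space_eq1 space_prob_algebra prob_space_coin prob_space_return)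
  have "(\<lambda>\<omega>. if \<omega> 0 = 1 then Some 0 else None) \<in> coins \<rightarrow>\<^sub>M with_bot (count_space (UNIV :: nat set))"
    by (rule measurable_If) (auto simp: space_with_bot)
  moreover have "(\<lambda>(a, x). genK coin_step a x) \<in> agentS coin_step \<Otimes>\<^sub>M materialS coin_step \<rightarrow>\<^sub>M prob_algebra (with_bot (modS coin_step))"
    by (auto simp: space_prob_algebra space_with_bot case_prod_beta' intro!: prob_space_return)
  ultimately show ?thesis
    using runK sets.top[of coins] by (auto simp: setting_def coins.prob_space_axioms prob_space_return coin_fail_mass)
qed

interpretation coin_step: evaluation_step coin_step
  by unfold_locales (rule coin_step_setting)

text \<open>Time 0 is the generation window, times 1 to 600 hold the stored sample and time 601 is
  the evaluation window. The output at time \<open>n\<close> is coordinate \<open>2 * n\<close>,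
  hence the coordinates 0 and 1202.\<close>

lemma coin_events:
  "gen_full coin_step = {\<omega>. \<omega> 0 = 1}" "Cand coin_step = {\<omega>. \<omega> 0 = 1}" "RetF coin_step = {\<omega>. \<omega> 1202 = 1}"
  by (auto simp: gen_full_def Cand_def RetF_def marked_def)

lemma coin_idx: "\<omega> \<in> RetF coin_step \<Longrightarrow> win_idx coin_step 0 \<omega> = 601"
  "\<omega> \<in> gen_full coin_step \<Longrightarrow> gen_idx coin_step 0 \<omega> = 0"
  by (auto simp: coin_events win_idx_def gen_idx_def pick_def marked_def)

lemma coin_candidate: "\<omega> \<in> Cand coin_step \<Longrightarrow> candidate coin_step \<omega> = Suc 0"
  by (auto simp: coin_events candidate_def)

lemma coin_evaluated [measurable]: "Measurable.pred coins (\<lambda>\<omega>. e \<in> evaluated coin_step \<omega>)"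
proof (cases e)
  case (Inr j)
  then have "(\<lambda>\<omega>. e \<in> evaluated coin_step \<omega>) = (\<lambda>\<omega>. j \<in> SR coin_step \<omega>)" by (auto simp: evaluated_def)
  then show ?thesis using coin_step.SR_measurable[of j] by simp
qed (simp add: evaluated_def image_iff)

lemma coin_fresh_rollouts:
  assumes F: "F \<in> coins \<rightarrow>\<^sub>M N" "\<And>\<omega>. F (\<lambda>i. if even i then \<omega> i else 0) = F \<omega>"
  shows "fresh_rollouts coin_step F N"
  unfolding fresh_rollouts_def
proof (intro allI ballI impI)
  fix e C and B :: "bool \<Rightarrow> nat \<Rightarrow> nat set"
  assume C: "C \<in> sets N"
  note [measurable] = F(1) C
  define E where "E = {\<omega> \<in> Cand coin_step \<inter> Ready coin_step. e \<in> evaluated coin_step \<omega> \<and> F \<omega> \<in> C}"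
  have RetF: "RetF coin_step \<in> sets coins" unfolding coin_events by measurable
  have R: "Cand coin_step \<inter> Ready coin_step \<in> sets coins"
    using coin_step.Cand_sets coin_step.ReadyR_sets RetF unfolding Ready_def by (intro sets.Int) auto
  have "{\<omega> \<in> space coins. e \<in> evaluated coin_step \<omega> \<and> F \<omega> \<in> C} \<in> sets coins" by measurable
  from sets.Int[OF R this] have E: "E \<in> sets coins"
    by (simp add: E_def Int_def conj_ac)
  \<comment> \<open>Candidate, readiness, evaluated records and \<open>F\<close> read only even
    coordinates.\<close>
  have inv: "\<omega> \<in> E \<longleftrightarrow> (\<lambda>i. if i \<in> {i. even i} then \<omega> i else 0) \<in> E" for \<omega>
  proof -
    let ?\<omega> = "\<lambda>i. if even i then \<omega> i else 0"
    have "SR coin_step ?\<omega> = SR coin_step \<omega>" by (simp add: SR_def)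
    then show ?thesis
      by (simp add: E_def coin_events Ready_def ReadyR_def evaluated_def F(2))
  qed
  \<comment> \<open>On \<open>E\<close> the product of rollout probabilities does not vary with the
    path; this is its value.\<close>
  define c where "c = (\<Prod>l<600. measure coin (B False l)) * (\<Prod>l<600. indicator (B True l) (2::nat))"
  have "measure coins {\<omega> \<in> E. \<forall>b. \<forall>l<600. roll coin_step b e l \<omega> \<in> B b l} = measure coins E * c"
  \<comment> \<open>If some prescribed set misses the candidate's output 2, the event is empty and
    \<open>c\<close> vanishes; otherwise only the current agent's rollouts restrict the
    path.\<close>
  proof (cases "\<forall>l<600. 2 \<in> B True l")
    case True
    let ?I = "(\<lambda>l. 2 * l + 1) ` {..<600 :: nat}"
    have "{\<omega> \<in> E. \<forall>b. \<forall>l<600. roll coin_step b e l \<omega> \<in> B b l} = {\<omega> \<in> E. \<forall>i\<in>?I. \<omega> i \<in> B False (i div 2)}"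
      using True by (auto simp: all_bool_eq)
    also have "measure coins \<dots> = measure coins E * (\<Prod>i\<in>?I. measure coin (B False (i div 2)))"
      by (rule coins_indep_Collect[OF E inv]) auto
    also have "(\<Prod>i\<in>?I. measure coin (B False (i div 2))) = (\<Prod>l<600. measure coin (B False l))"
      by (subst prod.reindex) (auto simp: inj_on_def)
    also have "\<dots> = c" using True by (simp add: c_def)
    finally show ?thesis .
  next
    case False
    then obtain l where l: "l < 600" "2 \<notin> B True l" by blast
    then have "c = 0" by (auto simp: c_def intro!: bexI[of _ l])
    moreover have "{\<omega> \<in> E. \<forall>b. \<forall>l<600. roll coin_step b e l \<omega> \<in> B b l} = {}"
      using l by (auto dest!: spec[of _ True])
    ultimately show ?thesis by (simp only: measure_empty mult_zero_right)
  qed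
  also have "measure coins E * c = (\<integral>\<omega>. indicator E \<omega> * c \<partial>coins)"
    by simp
  also have "\<dots> = (\<integral>\<omega>. indicator E \<omega> * (\<Prod>b\<in>UNIV. \<Prod>l<600. measure (runK coin_step (eval_agent coin_step b \<omega>) (eval_task coin_step e \<omega>)) (B b l)) \<partial>coins)"
  proof (rule Bochner_Integration.integral_cong[OF refl])
    fix \<omega>
    show "indicator E \<omega> * c = indicator E \<omega> * (\<Prod>b\<in>UNIV. \<Prod>l<600. measure (runK coin_step (eval_agent coin_step b \<omega>) (eval_task coin_step e \<omega>)) (B b l))"
      by (cases "\<omega> \<in> E")
         (auto simp: E_def c_def UNIV_bool eval_agent_def coin_candidate measure_return)
  qed
  finally show "let E = {\<omega> \<in> Cand coin_step \<inter> Ready coin_step. e \<in> evaluated coin_step \<omega> \<and> F \<omega> \<in> C} in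
        measure (Pr coin_step) {\<omega> \<in> E. \<forall>b. \<forall>l<nroll coin_step. roll coin_step b e l \<omega> \<in> B b l}
        = (\<integral>\<omega>. indicator E \<omega> * (\<Prod>b\<in>UNIV. \<Prod>l<nroll coin_step.
              measure (runK coin_step (eval_agent coin_step b \<omega>) (eval_task coin_step e \<omega>)) (B b l)) \<partial>Pr coin_step)"
    unfolding E_def[symmetric] Let_def by simp
qed

text \<open>\<open>frozen_measurable\<close> presupposes the protocol, which is still to be verified
  for this instance, so measurability is shown directly from the constant batch.\<close>

lemma coin_frozen:
  shows "frozen coin_step \<in> coins \<rightarrow>\<^sub>M frozenS coin_step"
    and "frozen coin_step (\<lambda>i. if even i then \<omega> i else 0) = frozen coin_step \<omega>"
proof -
  have b: "batch coin_step i \<omega> = 0" for i \<omega> by (simp add: batch_def)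
  have m: "(\<lambda>\<omega>. \<lambda>i\<in>{..<nF coin_step}. batch coin_step i \<omega>) \<in> coins \<rightarrow>\<^sub>M materialS coin_step"
    unfolding materialS_def b by (intro measurable_restrict) simp
  show "frozen coin_step \<in> coins \<rightarrow>\<^sub>M frozenS coin_step"
    unfolding frozen_def[abs_def] frozenS_def
    by (intro measurable_Pair m) (simp_all add: coin_step.candidate_measurable[simplified] coin_step.records_measurable[simplified])
  show "frozen coin_step (\<lambda>i. if even i then \<omega> i else 0) = frozen coin_step \<omega>"
    by (simp add: frozen_def b candidate_def records_def)
qed

lemma coin_step_protocol: "one_candidate_protocol coin_step"
  unfolding one_candidate_protocol_def
proof (intro conjI)
  show "\<forall>C\<in>sets (agentS coin_step \<Otimes>\<^sub>M materialS coin_step). \<forall>B\<in>sets (with_bot (modS coin_step)).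
      measure (Pr coin_step) {\<omega> \<in> gen_full coin_step. (cur coin_step \<omega>, material coin_step \<omega>) \<in> C \<and> modif coin_step \<omega> \<in> B}
      = (\<integral>\<omega>. indicator {\<omega> \<in> gen_full coin_step. (cur coin_step \<omega>, material coin_step \<omega>) \<in> C} \<omega>
            * measure (genK coin_step (cur coin_step \<omega>) (material coin_step \<omega>)) B \<partial>Pr coin_step)"
  proof (intro ballI)
    fix C B
    let ?E = "{\<omega> \<in> gen_full coin_step. (cur coin_step \<omega>, material coin_step \<omega>) \<in> C}"
    have "{\<omega> \<in> gen_full coin_step. (cur coin_step \<omega>, material coin_step \<omega>) \<in> C \<and> modif coin_step \<omega> \<in> B}
      = (if Some 0 \<in> B then ?E else {})"
      by (auto simp: coin_events)
    moreover have "measure (return (with_bot (count_space UNIV)) (Some 0)) B = indicator B (Some (0::nat))"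
      by (rule measure_return) (simp add: sets_with_bot_count_space)
    ultimately show "measure (Pr coin_step) {\<omega> \<in> gen_full coin_step. (cur coin_step \<omega>, material coin_step \<omega>) \<in> C \<and> modif coin_step \<omega> \<in> B}
      = (\<integral>\<omega>. indicator ?E \<omega> * measure (genK coin_step (cur coin_step \<omega>) (material coin_step \<omega>)) B \<partial>Pr coin_step)"
      by simp
  qed
  show "fresh_rollouts coin_step (frozen coin_step) (frozenS coin_step)"
    by (rule coin_fresh_rollouts) (rule coin_frozen)+
qed (auto simp: coin_events Let_def)

text \<open>Conditioning does not change the probability of the empty set or the whole space, so the
  function 0 is admissible in the infimum.\<close>

lemma beta_dep_trivial:
  assumes M: "prob_space M" and F: "subalgebra M F" and G: "sets G \<subseteq> {{}, space M}"
  shows "beta_dep M F G = 0"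
proof -
  interpret prob_space M by fact
  interpret finite_measure_subalgebra M F by unfold_locales fact
  have "AE \<omega> in M. ennreal \<bar>real_cond_exp M F (indicator B) \<omega> - measure M B\<bar> \<le> (0 :: ennreal)" if "B \<in> sets G" for B
  proof -
    have B: "B = {} \<or> B = space M" using G that by auto
    then have "B \<in> sets F" using F sets.top[of F] by (auto simp: subalgebra_def)
    moreover have "B \<in> sets M" using B by auto
    ultimately have "AE \<omega> in M. real_cond_exp M F (indicator B) \<omega> = indicator B \<omega>"
      by (intro real_cond_exp_F_meas) (auto simp: integrable_indicator_iff emeasure_eq_measure)
    then show ?thesis using AE_space
      by eventually_elim (use B in \<open>auto simp: prob_space indicator_def\<close>)
  qed
  then have "beta_dep M F G \<le> (\<integral>\<^sup>+\<omega>. 0 \<partial>M)"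
    unfolding beta_dep_def by (intro INF_lower) auto
  then show ?thesis by simp
qed

text \<open>A constant stream generates only the trivial \<sigma>-algebra.\<close>

lemma coin_beta_mix: "beta_mix coin_step j = 0"
proof -
  have triv: "sets (stream_alg coin_step I) \<subseteq> {{}, space coins}" for I
  proof -
    have "(\<lambda>\<omega>. \<lambda>n\<in>I. 0) \<in> space coins \<rightarrow> space (\<Pi>\<^sub>M n\<in>I. count_space (UNIV :: nat set))"
      by (auto simp: space_PiM)
    then have "sets (stream_alg coin_step I) = {(\<lambda>\<omega>. \<lambda>n\<in>I. 0) -` A \<inter> space coins | A. A \<in> sets (\<Pi>\<^sub>M n\<in>I. count_space (UNIV :: nat set))}"
      by (simp add: stream_alg_def sets_vimage_algebra2)
    then show ?thesis by auto
  qed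
  have "subalgebra coins (stream_alg coin_step I)" for I
    using triv[of I] sets.top[of coins] by (auto simp: subalgebra_def stream_alg_def)
  then have "beta_dep coins (stream_alg coin_step {..n}) (stream_alg coin_step {n + j..}) = 0" for n
    by (rule beta_dep_trivial[OF coins.prob_space_axioms]) (rule triv)
  then show ?thesis by (simp add: beta_mix_def)
qed

text \<open>The law of the stream is the point mass at the zero sequence: it is shift invariant, and
  every event has probability 0 or 1.\<close>

lemma coin_stream_condition: "stream_condition coin_step"
proof -
  let ?N = "\<Pi>\<^sub>M n\<in>UNIV. count_space (UNIV :: nat set)"
  have c: "(\<lambda>n. 0) \<in> space ?N" by (simp add: space_PiM)
  then have const: "(\<lambda>\<omega> n. 0) \<in> coins \<rightarrow>\<^sub>M ?N" by (rule measurable_const)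
  have law: "stream_law coin_step = distr coins ?N (\<lambda>\<omega> n. 0)" by (simp add: stream_law_def)
  have shift: "(\<lambda>x n. x (Suc n)) \<in> ?N \<rightarrow>\<^sub>M ?N"
    by (rule measurable_PiM_single') (simp_all add: measurable_component_singleton space_PiM)
  show ?thesis
    unfolding stream_condition_def
  proof (intro conjI ballI impI allI)
    show "distr (stream_law coin_step) (\<Pi>\<^sub>M n\<in>UNIV. taskS coin_step) (\<lambda>x n. x (Suc n)) = stream_law coin_step"
      unfolding law coin_step_simps distr_distr[OF shift const] comp_def ..
    fix B assume "B \<in> sets (stream_law coin_step)"
    then have "measure (stream_law coin_step) B = measure coins ((\<lambda>\<omega> n. 0) -` B \<inter> space coins)"
      unfolding law by (intro measure_distr[OF const]) simp
    then have "measure (stream_law coin_step) B = (if (\<lambda>n. 0) \<in> B then measure coins (space coins) else 0)"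
      by (simp add: vimage_def)
    then show "measure (stream_law coin_step) B = 0 \<or> measure (stream_law coin_step) B = 1"
      using coins.prob_space by (cases "(\<lambda>n. 0) \<in> B") auto
  next
    fix n
    show "distr (Pr coin_step) (taskS coin_step) (task coin_step n) = Duser coin_step"
    proof (rule measure_eqI)
      fix A assume "A \<in> sets (distr (Pr coin_step) (taskS coin_step) (task coin_step n))"
      then show "emeasure (distr (Pr coin_step) (taskS coin_step) (task coin_step n)) A = emeasure (Duser coin_step) A"
        using coins.emeasure_space_1 by (auto simp: emeasure_distr indicator_def vimage_def)
    qed simp
  next
    show "beta_mix coin_step \<longlonglongrightarrow> 0" by (simp add: coin_beta_mix[abs_def])
  qed
qed

text \<open>The output at time \<open>n\<close> is coordinate \<open>2 * n\<close>, on which neither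
  the current agent nor the tasks and other outputs depend.\<close>

lemma coin_output_condition: "output_condition coin_step"
  unfolding output_condition_def
proof (intro conjI allI ballI)
  fix n :: nat and C B
  assume C: "C \<in> sets (agentS coin_step \<Otimes>\<^sub>M taskS coin_step \<Otimes>\<^sub>M (\<Pi>\<^sub>M i\<in>UNIV - {n}. taskS coin_step \<Otimes>\<^sub>M outS coin_step))"
  define f where "f = (\<lambda>\<omega> :: nat \<Rightarrow> nat. (0 :: nat, 0 :: nat, (\<lambda>i\<in>UNIV - {n}. (0 :: nat, \<omega> (2 * i)))))"
  define E where "E = {\<omega>. f \<omega> \<in> C}"
  have f: "f \<in> coins \<rightarrow>\<^sub>M count_space UNIV \<Otimes>\<^sub>M count_space UNIV \<Otimes>\<^sub>M (\<Pi>\<^sub>M i\<in>UNIV - {n}. count_space UNIV \<Otimes>\<^sub>M count_space UNIV)"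
    unfolding f_def by (intro measurable_Pair measurable_const measurable_restrict coins_component) auto
  have "f -` C \<inter> space coins \<in> sets coins" by (rule measurable_sets[OF f]) (use C in \<open>simp only: coin_step_simps\<close>)
  then have E: "E \<in> sets coins" by (simp add: E_def vimage_def)
  have inv: "\<omega> \<in> E \<longleftrightarrow> (\<lambda>i. if i \<in> - {2 * n} then \<omega> i else 0) \<in> E" for \<omega>
  proof -
    have "f (\<lambda>i. if i \<in> - {2 * n} then \<omega> i else 0) = f \<omega>"
      by (auto simp: f_def fun_eq_iff)
    then show ?thesis by (simp only: E_def mem_Collect_eq)
  qed
  have "measure coins {\<omega> \<in> E. \<omega> (2 * n) \<in> B} = measure coins E * measure coin B"
    using coins_indep_Collect[OF E inv, of "{2 * n}" "\<lambda>_. B"] by simp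
  then show "let E = {\<omega> \<in> space (Pr coin_step).
          (cur coin_step \<omega>, task coin_step n \<omega>, (\<lambda>i\<in>UNIV - {n}. (task coin_step i \<omega>, outp coin_step i \<omega>))) \<in> C} in
        measure (Pr coin_step) {\<omega> \<in> E. outp coin_step n \<omega> \<in> B}
        = (\<integral>\<omega>. indicator E \<omega> * measure (runK coin_step (cur coin_step \<omega>) (task coin_step n \<omega>)) B \<partial>Pr coin_step)"
    by (simp add: E_def f_def)
next
  let ?F = "\<lambda>\<omega>. (frozen coin_step \<omega>, (\<lambda>n. (task coin_step n \<omega>, outp coin_step n \<omega>)))"
  show "fresh_rollouts coin_step ?F (frozenS coin_step \<Otimes>\<^sub>M (\<Pi>\<^sub>M n\<in>UNIV. taskS coin_step \<Otimes>\<^sub>M outS coin_step))"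
  proof (rule coin_fresh_rollouts)
    have "(\<lambda>\<omega> n. (0 :: nat, \<omega> (2 * n) :: nat)) \<in> coins \<rightarrow>\<^sub>M (\<Pi>\<^sub>M n\<in>UNIV. count_space UNIV \<Otimes>\<^sub>M count_space UNIV)"
      by (rule measurable_PiM_single') (auto simp: space_pair_measure)
    then show "?F \<in> coins \<rightarrow>\<^sub>M frozenS coin_step \<Otimes>\<^sub>M (\<Pi>\<^sub>M n\<in>UNIV. taskS coin_step \<Otimes>\<^sub>M outS coin_step)"
      by (intro measurable_Pair coin_frozen) simp
    show "?F (\<lambda>i. if even i then \<omega> i else 0) = ?F \<omega>" for \<omega>
      by (simp add: coin_frozen(2))
  qed
qed

text \<open>The advantage of the candidate is 1 at every task, so batch mean and failure mean agree
  and the radius 0 suffices.\<close>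

lemma coin_batch_condition: "batch_condition coin_step"
proof -
  have "(\<integral>t. Adv coin_step 0 (Suc 0) t \<partial>D_fail coin_step 0) = 1"
    using coin_step.integral_D_fail[of 0 "Suc 0"] by (simp add: coin_fail_mass coin_vals Adv_def measure_return)
  then have "{\<omega> \<in> Cand coin_step \<inter> RetF coin_step.
      let f = Adv coin_step (cur coin_step \<omega>) (candidate coin_step \<omega>) in
      epsF coin_step \<omega> < \<bar>(\<Sum>i<nF coin_step. f (batch coin_step i \<omega>)) / real (nF coin_step)
                   - (\<integral>t. f t \<partial>D_fail coin_step (cur coin_step \<omega>))\<bar>} = {}"
    by (auto simp: coin_candidate) (simp add: Adv_def coin_vals)
  then show ?thesis unfolding batch_condition_def by (simp only: measure_empty) simp
qed

lemma coin_label: "distr coin (count_space UNIV) (\<lambda>x. x = 1) = measure_pmf (bernoulli_pmf (1/2))"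
proof -
  have "map_pmf (\<lambda>x. x = 1) (pmf_of_set {0, 1 :: nat}) = bernoulli_pmf (1/2)"
  proof (rule pmf_eqI)
    fix b
    have "(\<lambda>x. x = (1::nat)) -` {b} = (if b then {1} else - {1})" by auto
    then show "pmf (map_pmf (\<lambda>x. x = 1) (pmf_of_set {0, 1 :: nat})) b = pmf (bernoulli_pmf (1/2)) b"
      by (cases b) (simp_all add: pmf_map measure_pmf_of_set)
  qed
  then show ?thesis by (simp add: coin_def flip: map_pmf_rep_eq)
qed

lemma coin_record_sets: "sets (record_law coin_step 0) = sets (count_space UNIV \<Otimes>\<^sub>M count_space UNIV)"
  using coin_step.record_law_simps(2)[of 0, unfolded coin_step_simps] by simp

lemma coin_record_law: "record_law coin_step 0 = distr coin (count_space UNIV \<Otimes>\<^sub>M count_space UNIV) (\<lambda>x. (0, x = 1))"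
proof (rule measure_eqI)
  show "sets (record_law coin_step 0) = sets (distr coin (count_space UNIV \<Otimes>\<^sub>M count_space UNIV) (\<lambda>x. (0, x = 1)))"
    by (simp add: coin_record_sets)
  fix A assume "A \<in> sets (record_law coin_step 0)"
  then have A: "A \<in> sets (count_space UNIV \<Otimes>\<^sub>M count_space UNIV)" by (simp add: coin_record_sets)
  have "emeasure (record_law coin_step 0) A
    = emeasure (distr (measure_pmf (bernoulli_pmf (1/2))) (count_space UNIV \<Otimes>\<^sub>M count_space UNIV) (Pair 0)) A"
    using coin_step.emeasure_record_law[of 0 A, unfolded coin_step_simps] A by (simp add: coin_vals nn_integral_return)
  also have "distr (measure_pmf (bernoulli_pmf (1/2))) (count_space UNIV \<Otimes>\<^sub>M count_space UNIV) (Pair (0::nat))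
    = distr coin (count_space UNIV \<Otimes>\<^sub>M count_space UNIV) (\<lambda>x. (0, x = 1))"
    unfolding coin_label[symmetric] by (subst distr_distr) (auto simp: comp_def space_pair_measure cong: measurable_cong_sets)
  finally show "emeasure (record_law coin_step 0) A = emeasure (distr coin (count_space UNIV \<Otimes>\<^sub>M count_space UNIV) (\<lambda>x. (0, x = 1))) A" .
qed

text \<open>The records of this instance are already i.i.d., so their true law is the reference
  law.\<close>

lemma coin_records: "distr coins (recordS coin_step) (records coin_step) = ref_records coin_step 0"
proof -
  let ?I = "{..<nR coin_step}"
  let ?N = "count_space (UNIV :: nat set) \<Otimes>\<^sub>M count_space (UNIV :: bool set)"
  interpret R: prob_space "record_law coin_step 0" by (rule coin_step.record_law_simps) simp
  interpret RP: product_sigma_finite "\<lambda>_::nat. record_law coin_step 0" by unfold_locales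
  have s: "sets (record_law coin_step 0) = sets ?N" by (rule coin_record_sets)
  have "distr coins (recordS coin_step) (records coin_step) = (\<Pi>\<^sub>M j\<in>?I. record_law coin_step 0)"
  proof (rule RP.PiM_eqI)
    show "sets (distr coins (recordS coin_step) (records coin_step)) = sets (\<Pi>\<^sub>M j\<in>?I. record_law coin_step 0)"
      unfolding sets_distr recordS_def coin_step_simps by (intro sets_PiM_cong) (simp_all add: s)
    fix A assume "\<And>j. j \<in> ?I \<Longrightarrow> A j \<in> sets (record_law coin_step 0)"
    then have A: "\<And>j. j \<in> ?I \<Longrightarrow> A j \<in> sets ?N" by (simp add: s)
    then have PA: "Pi\<^sub>E ?I A \<in> sets (recordS coin_step)"
      unfolding recordS_def coin_step_simps by (intro sets_PiM_I_finite) simp_all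
    let ?B = "\<lambda>j. {x. (0, x = 1) \<in> A j}"
    \<comment> \<open>Coordinate of the \<open>j\<close>-th stored label; \<open>i div 2 - 1\<close>
      recovers \<open>j\<close> from it.\<close>
    let ?g = "\<lambda>j. 2 * Suc j"
    have "emeasure (distr coins (recordS coin_step) (records coin_step)) (Pi\<^sub>E ?I A)
      = emeasure coins (records coin_step -` Pi\<^sub>E ?I A \<inter> space coins)"
      using coin_step.records_measurable PA by (intro emeasure_distr) simp_all
    also have "records coin_step -` Pi\<^sub>E ?I A \<inter> space coins = {\<omega>. \<forall>i\<in>?g ` ?I. \<omega> i \<in> ?B (i div 2 - 1)}"
    proof -
      define I where "I = ?I"
      have "records coin_step \<omega> \<in> Pi\<^sub>E I A \<longleftrightarrow> (\<forall>j\<in>I. (0, \<omega> (?g j) = 1) \<in> A j)" for \<omega>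
        unfolding records_def I_def[symmetric] by (simp add: restrict_PiE_iff Pi_iff)
      then show ?thesis unfolding I_def[symmetric] by (simp add: vimage_def)
    qed
    also have "emeasure coins \<dots> = ennreal (\<Prod>i\<in>?g ` ?I. measure coin (?B (i div 2 - 1)))"
      unfolding coins.emeasure_eq_measure by (subst coins_Collect) auto
    also have "(\<Prod>i\<in>?g ` ?I. measure coin (?B (i div 2 - 1))) = (\<Prod>j\<in>?I. measure coin (?B j))"
      by (subst prod.reindex) (auto simp: inj_on_def)
    also have "ennreal \<dots> = (\<Prod>j\<in>?I. emeasure (record_law coin_step 0) (A j))"
    proof -
      have "emeasure (record_law coin_step 0) (A j) = ennreal (measure coin (?B j))" if "j \<in> ?I" for j
      proof -
        interpret coin: prob_space coin by (rule prob_space_coin)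
        have "emeasure (record_law coin_step 0) (A j) = emeasure coin ((\<lambda>x. (0, x = 1)) -` A j \<inter> space coin)"
          unfolding coin_record_law using A[OF that] by (intro emeasure_distr) (auto cong: measurable_cong_sets)
        then show ?thesis by (simp add: coin.emeasure_eq_measure vimage_def)
      qed
      then show ?thesis by (simp add: prod_ennreal)
    qed
    finally show "emeasure (distr coins (recordS coin_step) (records coin_step)) (Pi\<^sub>E ?I A)
      = (\<Prod>j\<in>?I. emeasure (record_law coin_step 0) (A j))" .
  qed simp
  then show ?thesis using coin_step.ref_records_eq[of 0] by simp
qed

lemma total_variation_self: "total_variation M M = 0"
proof -
  have "sets M \<noteq> {}" by auto
  then show ?thesis by (simp add: total_variation_def)
qed

text \<open>The true joint law serves as its own reference law, at distance 0. The required product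
  form holds because \<open>info\<close> is determined by coordinate 0, which the records do not
  read.\<close>

lemma coin_stored_condition: "stored_condition coin_step"
  unfolding stored_condition_def
proof (intro conjI ballI allI impI)
  fix \<omega> i i'
  assume "\<omega> \<in> gen_full coin_step" "i < nF coin_step" "\<omega> \<in> RetF coin_step" "i' < nF coin_step"
  then show "win_idx coin_step i' \<omega> \<noteq> gen_idx coin_step i \<omega>" by (simp add: coin_idx)
next
  fix \<omega> i j
  assume "\<omega> \<in> gen_full coin_step" "i < nF coin_step"
  then show "sched coin_step (offset coin_step \<omega>) j \<noteq> gen_idx coin_step i \<omega>" by (simp add: coin_idx)
next
  let ?N = "infoS coin_step \<Otimes>\<^sub>M recordS coin_step"
  let ?f = "\<lambda>\<omega>. (info coin_step \<omega>, records coin_step \<omega>)"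
  let ?P0 = "distr coins ?N ?f"
  have info: "info coin_step \<in> coins \<rightarrow>\<^sub>M infoS coin_step"
    and recs: "records coin_step \<in> coins \<rightarrow>\<^sub>M recordS coin_step"
    using coin_step.info_measurable coin_step.records_measurable by simp_all
  have f: "?f \<in> coins \<rightarrow>\<^sub>M ?N" using info recs by (rule measurable_Pair)
  have fst_P0: "distr ?P0 (infoS coin_step) fst = distr coins (infoS coin_step) (info coin_step)"
    using f by (simp add: distr_distr comp_def)
  have rect: "emeasure ?P0 (C \<times> R) = (\<integral>\<^sup>+g\<in>C. emeasure (ref_records coin_step (fst g)) R \<partial>distr ?P0 (infoS coin_step) fst)"
    if C: "C \<in> sets (infoS coin_step)" and R: "R \<in> sets (recordS coin_step)" for C R
  proof -
    have E: "info coin_step -` C \<in> sets coins" and G: "records coin_step -` R \<in> sets coins"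
      using measurable_sets[OF info C] measurable_sets[OF recs R] by simp_all
    have info_inv: "info coin_step (\<lambda>i. if i \<in> {0} then \<omega> i else 0) = info coin_step \<omega>" for \<omega>
      by (simp add: info_def material_def)
    have recs_inv: "records coin_step (\<lambda>i. if i \<in> {0} then 0 else \<omega> i) = records coin_step \<omega>" for \<omega>
      by (simp add: records_def)
    have "emeasure ?P0 (C \<times> R) = emeasure coins (info coin_step -` C \<inter> records coin_step -` R)"
      using f C R by (subst emeasure_distr) (auto intro!: arg_cong2[where f=emeasure])
    also have "\<dots> = ennreal (measure coins (info coin_step -` C) * measure coins (records coin_step -` R))"
      unfolding coins.emeasure_eq_measure
      by (subst coins_indep[OF E _ G, where J="{0}"]) (simp_all only: vimage_eq info_inv recs_inv)
    also have "\<dots> = emeasure (ref_records coin_step 0) R * emeasure coins (info coin_step -` C)"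
      using recs R by (simp add: coin_records[symmetric] emeasure_distr coins.emeasure_eq_measure ennreal_mult mult.commute)
    also have "\<dots> = (\<integral>\<^sup>+\<omega>. emeasure (ref_records coin_step 0) R * indicator (info coin_step -` C) \<omega> \<partial>coins)"
      using E by (simp add: nn_integral_cmult_indicator)
    also have "\<dots> = (\<integral>\<^sup>+\<omega>. emeasure (ref_records coin_step (fst (info coin_step \<omega>))) R * indicator C (info coin_step \<omega>) \<partial>coins)"
      by (intro nn_integral_cong) (simp add: info_def indicator_def)
    also have "\<dots> = (\<integral>\<^sup>+g\<in>C. emeasure (ref_records coin_step (fst g)) R \<partial>distr coins (infoS coin_step) (info coin_step))"
    proof (rule nn_integral_distr[OF info, symmetric])
      have "(\<lambda>g. emeasure (ref_records coin_step (fst g)) R) \<in> borel_measurable (infoS coin_step)"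
      proof (rule measurable_compose[of fst _ "count_space UNIV"])
        show "fst \<in> infoS coin_step \<rightarrow>\<^sub>M count_space UNIV" by (simp add: infoS_def)
      qed simp
      then show "(\<lambda>g. emeasure (ref_records coin_step (fst g)) R * indicator C g) \<in> borel_measurable (distr coins (infoS coin_step) (info coin_step))"
        using C by simp
    qed
    finally show ?thesis unfolding fst_P0 .
  qed
  show "\<exists>P0. prob_space P0 \<and> sets P0 = sets ?N \<and>
      distr P0 (infoS coin_step) fst = distr (Pr coin_step) (infoS coin_step) (info coin_step) \<and>
      (\<forall>C\<in>sets (infoS coin_step). \<forall>R\<in>sets (recordS coin_step).
        emeasure P0 (C \<times> R)
        = (\<integral>\<^sup>+g\<in>C. emeasure (ref_records coin_step (fst g)) R \<partial>distr P0 (infoS coin_step) fst)) \<and>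
      total_variation (distr (Pr coin_step) ?N ?f) P0
        \<le> 2 * real (nR coin_step) * beta_mix coin_step (gap coin_step)"
  proof (intro exI[of _ ?P0] conjI ballI rect)
    show "prob_space ?P0" by (rule coins.prob_space_distr[OF f])
  qed (simp_all only: fst_P0 total_variation_self coin_beta_mix coin_step_simps sets_distr mult_zero_right)
qed

lemma coin_standard_evaluation: "standard_evaluation coin_step"
  using coin_stream_condition coin_output_condition coin_stored_condition coin_batch_condition
  by (simp add: standard_evaluation_def gap_condition_def coin_beta_mix)

text \<open>On this path coordinate 0 yields a candidate and coordinate 1202 a returned failure
  task. The current agent's rollouts are 0 or 1 and earn nothing, so every estimated advantage is 1.
  Half of the stored labels are failures, which puts \<open>Lhat\<close> at 1/2, below the threshold
  1, although the margin is positive.\<close>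

lemma coin_accepted:
  defines "\<omega> \<equiv> \<lambda>i. of_bool (i = 0 \<or> 602 \<le> i) :: nat"
  shows "\<omega> \<in> Acc_margin coin_step 1" "\<omega> \<notin> Acc_two_gate coin_step 1 1"
proof -
  define r where "r = epsV coin_step"
  \<comment> \<open>The risks are all 1/2, the sample sizes all 600 and mixing vanishes, so the
    three radii coincide.\<close>
  have r_eq: "epsV coin_step = r" "epsZ coin_step = r" "epsR coin_step = r"
    by (simp_all add: r_def epsV_def epsZ_def epsR_def coin_beta_mix)
  have r0: "0 \<le> r" unfolding r_def by (simp add: epsV_def)
  have r1: "r \<le> 1/20"
  proof -
    have "ln 4 \<le> (4::real) - 1" by (rule ln_le_minus_one) simp
    then have "r \<le> sqrt ((1/20)\<^sup>2)"
      unfolding r_def epsV_def by (intro real_sqrt_le_mono) (simp add: power2_eq_square)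
    then show ?thesis by simp
  qed
  \<comment> \<open>Label \<open>j\<close> sits at coordinate \<open>2 * Suc j\<close>, which
    reaches the cut 602 exactly from \<open>j = 300\<close> on.\<close>
  have SR: "SR coin_step \<omega> = {..<300}" by (auto simp: SR_def \<omega>_def)
  have V: "Vhat coin_step True e \<omega> = 1" "Vhat coin_step False e \<omega> = 0" for e
    by (simp_all add: Vhat_def \<omega>_def)
  have Z: "Zhat coin_step \<omega> = 1/2"
    using coin_step.card_SR[of \<omega>] by (simp add: SR)
  have L: "Lhat coin_step \<omega> = 1/2" by (simp add: Lhat_def Z V)
  have D: "DRhat_minus coin_step \<omega> = 0" by (simp add: DRhat_minus_def V)
  have \<omega>: "\<omega> \<in> Cand coin_step \<inter> Ready coin_step"
    by (simp add: coin_events Ready_def ReadyR_def SR) (simp add: \<omega>_def)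
  \<comment> \<open>Here \<open>Mhat\<close> equals \<open>1/2 - 6 * r - 10 * r * r\<close>, which
    is positive for \<open>r\<close> up to 1/20.\<close>
  have "r * r \<le> r * (1/20)" using r0 r1 by (intro mult_left_mono)
  then have "0 < Mhat coin_step \<omega>"
    using \<omega> r1 r0 by (simp add: Mhat_def L D epsL_def epsD_def Z r_eq algebra_simps)
  then show "\<omega> \<in> Acc_margin coin_step 1" using \<omega> by (simp add: Acc_margin_def D)
  show "\<omega> \<notin> Acc_two_gate coin_step 1 1" by (simp add: Acc_two_gate_def L)
qed

theorem proposition18:
  fixes S :: "('w, 't, 'o, 'a, 'c, 'u) step" and \<delta>m :: real
  assumes "setting S" and "one_candidate_protocol S" and "standard_evaluation S"
    and "\<delta>m > 0"
  shows
    "(measure (Pr S) (Acc_margin S \<delta>m \<inter> {\<omega>. improvement S \<delta>m \<omega> < Mhat S \<omega>}) \<le> beta_step S \<and>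
      measure (Pr S) (Acc_margin S \<delta>m \<inter> {\<omega>. improvement S \<delta>m \<omega> \<le> 0}) \<le> beta_step S) \<and>
     (\<forall>\<tau> \<delta>. \<tau> > 0 \<longrightarrow> \<delta> > 0 \<longrightarrow> \<delta>m = \<delta> \<longrightarrow> Acc_two_gate S \<tau> \<delta> \<subseteq> Acc_margin S \<delta>m) \<and>
     (\<exists>(S' :: (nat \<Rightarrow> nat, nat, nat, nat, nat, nat) step) \<tau> \<delta>.
        setting S' \<and> one_candidate_protocol S' \<and> standard_evaluation S' \<and> \<tau> > 0 \<and> \<delta> > 0 \<and>
        \<not> Acc_margin S' \<delta> \<subseteq> Acc_two_gate S' \<tau> \<delta>)"
proof -
  interpret protocol_step S by unfold_locales (rule assms)+
  have gap: "gap_condition S" using assms(3) by (simp add: standard_evaluation_def)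
  have "measure (Pr S) (Acc_margin S \<delta>m \<inter> {\<omega>. improvement S \<delta>m \<omega> < Mhat S \<omega>}) \<le> beta_step S"
    by (rule Acc_margin_bound[OF assms(3), of _ \<delta>m]) auto
  \<comment> \<open>Adoption forces \<open>Mhat\<close> to be positive, so a nonpositive improvement
    lies strictly below it.\<close>
  moreover have "measure (Pr S) (Acc_margin S \<delta>m \<inter> {\<omega>. improvement S \<delta>m \<omega> \<le> 0}) \<le> beta_step S"
    by (rule Acc_margin_bound[OF assms(3), of _ \<delta>m]) (auto simp: Acc_margin_def)
  moreover have "\<not> Acc_margin coin_step 1 \<subseteq> Acc_two_gate coin_step 1 1"
    using coin_accepted by blast
  ultimately show ?thesis
    using Acc_two_gate_subset[OF gap] coin_step_setting coin_step_protocol coin_standard_evaluation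
      zero_less_one[where 'a=real]
    by blast
qed

end
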